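(* Let $\varphi:\mathcal{L}_0\to\mathbb{C}$ be a linear map and $V(\varphi)$ the corresponding irreducible highest weight module over the loop-Virasoro algebra $\mathcal{L}=\mathrm{Vir}\otimes\mathbb{C}[t^{\pm1}]$. Then $V(\varphi)$ is a Harish-Chandra module if and only if there is a polynomial $P(t)\in\mathbb{C}[t]$ with nonzero constant term such that $$\varphi(d_0\otimes t^kP(t))=0,\qquad \varphi(c\otimes t^kP(t))=0\qquad\text{for all }k\in\mathbb{Z},$$ in which case $(d_i\otimes\langle P(t)\rangle)V(\varphi)=0$ for all $i\in\mathbb{Z}$, where $\langle P(t)\rangle$ is the ideal of $\mathbb{C}[t^{\pm1}]$ generated by $P(t)$. Consequently, $V(\varphi)$ can be viewed as a module over $\mathrm{Vir}\otimes(\mathbb{C}[t^{\pm1}]/\langle P(t)\rangle)$ if it is a Harish-Chandra module.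
   Context: The Virasoro algebra $\mathrm{Vir}$ is the complex Lie algebra with basis $\{c,d_i : i\in\mathbb{Z}\}$ and brackets $[d_m,d_n]=(n-m)d_{m+n}+\delta_{m,-n}\frac{m^3-m}{12}c$, $[d_m,c]=0$. The loop-Virasoro algebra is $\mathcal{L}=\mathrm{Vir}\otimes\mathbb{C}[t^{\pm1}]$ with brackets $[d_i\otimes t^j,d_k\otimes t^l]=(k-i)\,d_{i+k}\otimes t^{j+l}+\delta_{i+k,0}\frac{i^3-i}{12}\,c\otimes t^{j+l}$, and with $c\otimes t^l$ central. Write $d_i=d_i\otimes 1$. Let $\mathcal{L}_i=(\mathbb{C}d_i\oplus\delta_{i,0}\mathbb{C}c)\otimes\mathbb{C}[t^{\pm1}]$ and $\mathcal{L}_+=\bigoplus_{i>0}\mathcal{L}_i$. For a linear map $\varphi:\mathcal{L}_0\to\mathbb{C}$, let $\mathbb{C}v_0$ be the one-dimensional $(\mathcal{L}_0+\mathcal{L}_+)$-module with $\mathcal{L}_+v_0=0$ and $xv_0=\varphi(x)v_0$ for $x\in\mathcal{L}_0$; let $\bar V(\varphi)=U(\mathcal{L})\otimes_{U(\mathcal{L}_0+\mathcal{L}_+)}\mathbb{C}v_0$ and let $V(\varphi)$ be the quotient of $\bar V(\varphi)$ by its unique maximal proper submodule. A weight space is $V_\lambda=\{v\in V: d_0v=\lambda v\}$, $\lambda\in\mathbb{C}$; a Harish-Chandra module is a module which is the sum of its weight spaces and all of whose weight spaces are finite-dimensional. *)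

theory Defs
  imports
    "Jordan_Normal_Form.VS_Connect"
    "HOL-Algebra.QuotRing"
    "HOL-Library.Poly_Mapping"
    "HOL-Computational_Algebra.Polynomial"
begin

text \<open>
  All vector spaces are over the complex field \<open>class_ring :: complex ring\<close>.  A vector space that
  is not an algebra has \<open>undefined\<close> in the fields \<open>mult\<close> and \<open>one\<close> of its \<open>module\<close> record.
\<close>

abbreviation cspan :: "(complex, 'a, 'm) module_scheme \<Rightarrow> 'a set \<Rightarrow> 'a set" where
  "cspan \<equiv> LinearCombinations.module.span class_ring"


section \<open>Lie algebras and their modules\<close>

record 'a lie_alg = "(complex, 'a) module" +
  lie_br :: "'a \<Rightarrow> 'a \<Rightarrow> 'a"

locale lie_algebra = vectorspace class_ring L
  for L :: "('a, 'm) lie_alg_scheme" (structure) +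
  assumes br_closed: "\<lbrakk>x \<in> carrier L; y \<in> carrier L\<rbrakk> \<Longrightarrow> lie_br L x y \<in> carrier L"
    and br_add_left: "\<lbrakk>x \<in> carrier L; y \<in> carrier L; z \<in> carrier L\<rbrakk> \<Longrightarrow>
      lie_br L (x \<oplus> y) z = lie_br L x z \<oplus> lie_br L y z"
    and br_add_right: "\<lbrakk>x \<in> carrier L; y \<in> carrier L; z \<in> carrier L\<rbrakk> \<Longrightarrow>
      lie_br L x (y \<oplus> z) = lie_br L x y \<oplus> lie_br L x z"
    and br_smult_left: "\<lbrakk>x \<in> carrier L; y \<in> carrier L\<rbrakk> \<Longrightarrow>
      lie_br L (a \<odot> x) y = a \<odot> lie_br L x y"
    and br_smult_right: "\<lbrakk>x \<in> carrier L; y \<in> carrier L\<rbrakk> \<Longrightarrow>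
      lie_br L x (a \<odot> y) = a \<odot> lie_br L x y"
    and br_alternating: "x \<in> carrier L \<Longrightarrow> lie_br L x x = \<zero>"
    and br_jacobi: "\<lbrakk>x \<in> carrier L; y \<in> carrier L; z \<in> carrier L\<rbrakk> \<Longrightarrow>
      lie_br L x (lie_br L y z) \<oplus> lie_br L y (lie_br L z x) \<oplus> lie_br L z (lie_br L x y) = \<zero>"

locale lie_module = L: lie_algebra L + V: vectorspace class_ring V
  for L :: "('a, 'm) lie_alg_scheme" (structure)
    and V :: "(complex, 'v, 'n) module_scheme" +
  fixes act :: "'a \<Rightarrow> 'v \<Rightarrow> 'v"
  assumes act_closed: "\<lbrakk>x \<in> carrier L; v \<in> carrier V\<rbrakk> \<Longrightarrow> act x v \<in> carrier V"
    and act_add_left: "\<lbrakk>x \<in> carrier L; y \<in> carrier L; v \<in> carrier V\<rbrakk> \<Longrightarrow>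
      act (x \<oplus> y) v = act x v \<oplus>\<^bsub>V\<^esub> act y v"
    and act_smult_left: "\<lbrakk>x \<in> carrier L; v \<in> carrier V\<rbrakk> \<Longrightarrow>
      act (a \<odot> x) v = a \<odot>\<^bsub>V\<^esub> act x v"
    and act_add_right: "\<lbrakk>x \<in> carrier L; v \<in> carrier V; w \<in> carrier V\<rbrakk> \<Longrightarrow>
      act x (v \<oplus>\<^bsub>V\<^esub> w) = act x v \<oplus>\<^bsub>V\<^esub> act x w"
    and act_smult_right: "\<lbrakk>x \<in> carrier L; v \<in> carrier V\<rbrakk> \<Longrightarrow>
      act x (a \<odot>\<^bsub>V\<^esub> v) = a \<odot>\<^bsub>V\<^esub> act x v"
    and act_br: "\<lbrakk>x \<in> carrier L; y \<in> carrier L; v \<in> carrier V\<rbrakk> \<Longrightarrow>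
      act (lie_br L x y) v = act x (act y v) \<ominus>\<^bsub>V\<^esub> act y (act x v)"

definition lie_submodule ::
    "('a, 'm) lie_alg_scheme \<Rightarrow> (complex, 'v, 'n) module_scheme \<Rightarrow> ('a \<Rightarrow> 'v \<Rightarrow> 'v) \<Rightarrow> 'v set \<Rightarrow> bool"
  where "lie_submodule L V act N \<longleftrightarrow>
    subspace class_ring N V \<and> (\<forall>x\<in>carrier L. \<forall>v\<in>N. act x v \<in> N)"

definition maximal_proper_submodule ::
    "('a, 'm) lie_alg_scheme \<Rightarrow> (complex, 'v, 'n) module_scheme \<Rightarrow> ('a \<Rightarrow> 'v \<Rightarrow> 'v) \<Rightarrow> 'v set \<Rightarrow> bool"
  where "maximal_proper_submodule L V act N \<longleftrightarrow>
    lie_submodule L V act N \<and> N \<noteq> carrier V \<and>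
    (\<forall>N'. lie_submodule L V act N' \<and> N \<subseteq> N' \<and> N' \<noteq> carrier V \<longrightarrow> N' = N)"


section \<open>Quotients\<close>

text \<open>The map induced by \<open>f\<close> on cosets of \<open>N\<close>, sending \<open>N + v\<close> to \<open>N + f v\<close> whenever \<open>f\<close> is
  additive and preserves \<open>N\<close>.\<close>

definition quot_map :: "(complex, 'v, 'n) module_scheme \<Rightarrow> 'v set \<Rightarrow> ('v \<Rightarrow> 'v) \<Rightarrow> 'v set \<Rightarrow> 'v set" where
  "quot_map V N f X = (\<Union>v\<in>X. N +>\<^bsub>V\<^esub> f v)"

text \<open>Used both for vector spaces modulo a subspace and for algebras modulo a two-sided ideal.\<close>

definition quot_module :: "(complex, 'v, 'n) module_scheme \<Rightarrow> 'v set \<Rightarrow> (complex, 'v set) module" where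
  "quot_module V N = ring.extend (V Quot N) (module.fields (\<lambda>a. quot_map V N (\<lambda>v. a \<odot>\<^bsub>V\<^esub> v)))"


section \<open>Free vector spaces and monoid algebras\<close>

text \<open>The basis vector attached to \<open>x \<in> X\<close> is \<open>Poly_Mapping.single x 1\<close>.\<close>

definition free_space :: "'x set \<Rightarrow> (complex, 'x \<Rightarrow>\<^sub>0 complex) module" where
  "free_space X =
    \<lparr>carrier = {f. Poly_Mapping.keys f \<subseteq> X}, mult = undefined, one = undefined,
     zero = 0, add = (+), smult = (\<lambda>a. Poly_Mapping.map ((*) a))\<rparr>"

definition lin_ext :: "('x \<Rightarrow> 'y) \<Rightarrow> ('x \<Rightarrow>\<^sub>0 complex) \<Rightarrow> 'y \<Rightarrow>\<^sub>0 complex" where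
  "lin_ext h f = (\<Sum>x\<in>Poly_Mapping.keys f. Poly_Mapping.single (h x) (Poly_Mapping.lookup f x))"

definition monoid_algebra :: "'x::monoid_add set \<Rightarrow> (complex, 'x \<Rightarrow>\<^sub>0 complex) module" where
  "monoid_algebra X = (free_space X)\<lparr>mult := (*), one := 1\<rparr>"

text \<open>Laurent polynomials are the group algebra of the integers: \<open>t\<^sup>n\<close> is
  \<open>Poly_Mapping.single n 1\<close>.\<close>

type_synonym laurent = "int \<Rightarrow>\<^sub>0 complex"

definition laurent_algebra :: "(complex, laurent) module" where
  "laurent_algebra = monoid_algebra UNIV"

definition laurent_of_poly :: "complex poly \<Rightarrow> laurent" where
  "laurent_of_poly P = (\<Sum>n\<le>degree P. Poly_Mapping.single (int n) (coeff P n))"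

text \<open>Words form the free monoid under concatenation, so that \<open>monoid_algebra (lists S)\<close> is the free
  associative unital algebra on \<open>S\<close>.\<close>

instantiation list :: (type) monoid_add
begin
definition zero_list :: "'a list" where "zero_list = []"
definition plus_list :: "'a list \<Rightarrow> 'a list \<Rightarrow> 'a list" where "plus_list = (@)"
instance by standard (simp_all add: zero_list_def plus_list_def)
end


section \<open>Universal enveloping algebras and induced modules\<close>

definition word :: "'a list \<Rightarrow> 'a list \<Rightarrow>\<^sub>0 complex" where
  "word w = Poly_Mapping.single w 1"

text \<open>The linear relations turn the free algebra on the set \<open>carrier L\<close> into the tensor algebra of
  the vector space \<open>L\<close>.\<close>

definition env_relations :: "('a, 'm) lie_alg_scheme \<Rightarrow> ('a list \<Rightarrow>\<^sub>0 complex) set" where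
  "env_relations L =
     {word [x \<oplus>\<^bsub>L\<^esub> y] - word [x] - word [y] | x y. x \<in> carrier L \<and> y \<in> carrier L}
   \<union> {word [a \<odot>\<^bsub>L\<^esub> x] - Poly_Mapping.single [x] a | a x. x \<in> carrier L}
   \<union> {word [x, y] - word [y, x] - word [lie_br L x y] | x y. x \<in> carrier L \<and> y \<in> carrier L}"

definition env_ideal :: "('a, 'm) lie_alg_scheme \<Rightarrow> ('a list \<Rightarrow>\<^sub>0 complex) set" where
  "env_ideal L = Idl\<^bsub>monoid_algebra (lists (carrier L))\<^esub> (env_relations L)"

definition env_algebra :: "('a, 'm) lie_alg_scheme \<Rightarrow> (complex, ('a list \<Rightarrow>\<^sub>0 complex) set) module" where
  "env_algebra L = quot_module (monoid_algebra (lists (carrier L))) (env_ideal L)"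

definition env_of :: "('a, 'm) lie_alg_scheme \<Rightarrow> 'a \<Rightarrow> ('a list \<Rightarrow>\<^sub>0 complex) set" where
  "env_of L x = env_ideal L +>\<^bsub>monoid_algebra (lists (carrier L))\<^esub> word [x]"

text \<open>
  For a subalgebra \<open>H\<close> of \<open>L\<close> and an \<open>H\<close>-module \<open>W\<close>, the induced module is the tensor product of
  \<open>U(L)\<close> and \<open>W\<close> over \<open>U(H)\<close>: the free vector space on pairs \<open>(u, w)\<close> modulo the bilinearity
  relations and \<open>(u h, w) = (u, h w)\<close>.  As \<open>H\<close> generates \<open>U(H)\<close>, it suffices to impose the last
  relation for \<open>h \<in> H\<close>.
\<close>

definition pair :: "'u \<Rightarrow> 'w \<Rightarrow> 'u \<times> 'w \<Rightarrow>\<^sub>0 complex" where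
  "pair u w = Poly_Mapping.single (u, w) 1"

type_synonym ('a, 'w) induced_pre = "('a list \<Rightarrow>\<^sub>0 complex) set \<times> 'w \<Rightarrow>\<^sub>0 complex"

definition induced_pre_space ::
    "('a, 'm) lie_alg_scheme \<Rightarrow> (complex, 'w, 'n) module_scheme \<Rightarrow> (complex, ('a, 'w) induced_pre) module"
  where "induced_pre_space L W = free_space (carrier (env_algebra L) \<times> carrier W)"

definition induced_relations ::
    "('a, 'm) lie_alg_scheme \<Rightarrow> 'a set \<Rightarrow> (complex, 'w, 'n) module_scheme \<Rightarrow> ('a \<Rightarrow> 'w \<Rightarrow> 'w)
      \<Rightarrow> ('a, 'w) induced_pre set"
  where "induced_relations L H W act = (let U = env_algebra L in
     {pair (u \<oplus>\<^bsub>U\<^esub> u') w - pair u w - pair u' w | u u' w.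
        u \<in> carrier U \<and> u' \<in> carrier U \<and> w \<in> carrier W}
   \<union> {pair u (w \<oplus>\<^bsub>W\<^esub> w') - pair u w - pair u w' | u w w'.
        u \<in> carrier U \<and> w \<in> carrier W \<and> w' \<in> carrier W}
   \<union> {pair (a \<odot>\<^bsub>U\<^esub> u) w - Poly_Mapping.single (u, w) a | a u w. u \<in> carrier U \<and> w \<in> carrier W}
   \<union> {pair u (a \<odot>\<^bsub>W\<^esub> w) - Poly_Mapping.single (u, w) a | a u w. u \<in> carrier U \<and> w \<in> carrier W}
   \<union> {pair (u \<otimes>\<^bsub>U\<^esub> env_of L h) w - pair u (act h w) | u h w.
        u \<in> carrier U \<and> h \<in> H \<and> w \<in> carrier W})"

definition induced_kernel ::
    "('a, 'm) lie_alg_scheme \<Rightarrow> 'a set \<Rightarrow> (complex, 'w, 'n) module_scheme \<Rightarrow> ('a \<Rightarrow> 'w \<Rightarrow> 'w)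
      \<Rightarrow> ('a, 'w) induced_pre set"
  where "induced_kernel L H W act = cspan (induced_pre_space L W) (induced_relations L H W act)"

definition induced_space ::
    "('a, 'm) lie_alg_scheme \<Rightarrow> 'a set \<Rightarrow> (complex, 'w, 'n) module_scheme \<Rightarrow> ('a \<Rightarrow> 'w \<Rightarrow> 'w)
      \<Rightarrow> (complex, ('a, 'w) induced_pre set) module"
  where "induced_space L H W act = quot_module (induced_pre_space L W) (induced_kernel L H W act)"

definition induced_act ::
    "('a, 'm) lie_alg_scheme \<Rightarrow> 'a set \<Rightarrow> (complex, 'w, 'n) module_scheme \<Rightarrow> ('a \<Rightarrow> 'w \<Rightarrow> 'w)
      \<Rightarrow> 'a \<Rightarrow> ('a, 'w) induced_pre set \<Rightarrow> ('a, 'w) induced_pre set"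
  where "induced_act L H W act x =
    quot_map (induced_pre_space L W) (induced_kernel L H W act)
      (lin_ext (\<lambda>(u, w). (env_of L x \<otimes>\<^bsub>env_algebra L\<^esub> u, w)))"


section \<open>The loop-Virasoro algebra\<close>

datatype vir_gen = VD int | VC

fun vir_br :: "vir_gen \<Rightarrow> vir_gen \<Rightarrow> vir_gen \<Rightarrow>\<^sub>0 complex" where
  "vir_br (VD m) (VD n) =
     Poly_Mapping.single (VD (m + n)) (of_int (n - m)) +
     (if m = - n then Poly_Mapping.single VC (of_int (m ^ 3 - m) / 12) else 0)"
| "vir_br _ _ = 0"

text \<open>
  \<open>Vir \<otimes> A\<close> for a commutative algebra \<open>A\<close>.  Since \<open>Vir\<close> has the basis \<open>vir_gen\<close>, an element
  \<open>\<Sum>\<^sub>p p \<otimes> x p\<close> is represented by its finitely supported family \<open>x\<close> of coefficients in \<open>A\<close>.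
  The bracket is \<open>[p \<otimes> a, q \<otimes> b] = [p, q] \<otimes> ab\<close>.
\<close>

definition vir_tensor :: "(complex, 'a, 'm) module_scheme \<Rightarrow> (vir_gen \<Rightarrow> 'a) lie_alg" where
  "vir_tensor A =
    \<lparr>carrier = {x. (\<forall>p. x p \<in> carrier A) \<and> finite {p. x p \<noteq> \<zero>\<^bsub>A\<^esub>}},
     mult = undefined, one = undefined,
     zero = (\<lambda>p. \<zero>\<^bsub>A\<^esub>),
     add = (\<lambda>x y p. x p \<oplus>\<^bsub>A\<^esub> y p),
     smult = (\<lambda>a x p. a \<odot>\<^bsub>A\<^esub> x p),
     lie_br = (\<lambda>x y r.
       \<Oplus>\<^bsub>A\<^esub>p\<in>{p. x p \<noteq> \<zero>\<^bsub>A\<^esub>}. \<Oplus>\<^bsub>A\<^esub>q\<in>{q. y q \<noteq> \<zero>\<^bsub>A\<^esub>}.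
         Poly_Mapping.lookup (vir_br p q) r \<odot>\<^bsub>A\<^esub> (x p \<otimes>\<^bsub>A\<^esub> y q))\<rparr>"

type_synonym loop_elt = "vir_gen \<Rightarrow> laurent"

definition loop_vir :: "loop_elt lie_alg" where
  "loop_vir = vir_tensor laurent_algebra"

definition ptensor :: "vir_gen \<Rightarrow> laurent \<Rightarrow> loop_elt" where
  "ptensor p f = (\<lambda>q. if q = p then f else 0)"

fun vir_deg :: "vir_gen \<Rightarrow> int" where
  "vir_deg (VD i) = i"
| "vir_deg VC = 0"

text \<open>\<open>loop_part S\<close> is the direct sum of the graded components of degrees \<open>i \<in> S\<close>.\<close>

definition loop_part :: "int set \<Rightarrow> loop_elt set" where
  "loop_part S = {x \<in> carrier loop_vir. \<forall>p. x p \<noteq> 0 \<longrightarrow> vir_deg p \<in> S}"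

abbreviation "loop_zero \<equiv> loop_part {0}"
abbreviation "loop_plus \<equiv> loop_part {0<..}"

definition degree_zero_part :: "loop_elt \<Rightarrow> loop_elt" where
  "degree_zero_part x = (\<lambda>p. if vir_deg p = 0 then x p else 0)"


section \<open>Highest weight modules\<close>

definition complex_space :: "(complex, complex) module" where
  "complex_space = ring.extend class_ring (module.fields (*))"

text \<open>The action on \<open>\<complex> v\<^sub>0\<close>: the degree zero part acts by \<open>\<phi>\<close> and the positive part by zero.
  Only the values of \<open>\<phi>\<close> on \<open>loop_zero\<close> matter.\<close>

definition hw_line_act :: "(loop_elt \<Rightarrow> complex) \<Rightarrow> loop_elt \<Rightarrow> complex \<Rightarrow> complex" where
  "hw_line_act \<phi> x z = \<phi> (degree_zero_part x) * z"

type_synonym verma_elt = "(loop_elt, complex) induced_pre set"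

definition verma_space :: "(loop_elt \<Rightarrow> complex) \<Rightarrow> (complex, verma_elt) module" where
  "verma_space \<phi> =
    induced_space loop_vir (loop_zero <+>\<^bsub>loop_vir\<^esub> loop_plus) complex_space (hw_line_act \<phi>)"

definition verma_act :: "(loop_elt \<Rightarrow> complex) \<Rightarrow> loop_elt \<Rightarrow> verma_elt \<Rightarrow> verma_elt" where
  "verma_act \<phi> =
    induced_act loop_vir (loop_zero <+>\<^bsub>loop_vir\<^esub> loop_plus) complex_space (hw_line_act \<phi>)"

definition verma_radical :: "(loop_elt \<Rightarrow> complex) \<Rightarrow> verma_elt set" where
  "verma_radical \<phi> = (THE N. maximal_proper_submodule loop_vir (verma_space \<phi>) (verma_act \<phi>) N)"

definition hw_space :: "(loop_elt \<Rightarrow> complex) \<Rightarrow> (complex, verma_elt set) module" where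
  "hw_space \<phi> = quot_module (verma_space \<phi>) (verma_radical \<phi>)"

definition hw_act :: "(loop_elt \<Rightarrow> complex) \<Rightarrow> loop_elt \<Rightarrow> verma_elt set \<Rightarrow> verma_elt set" where
  "hw_act \<phi> x = quot_map (verma_space \<phi>) (verma_radical \<phi>) (verma_act \<phi> x)"


section \<open>Harish-Chandra modules\<close>

definition weight_space ::
    "(complex, 'v, 'n) module_scheme \<Rightarrow> (loop_elt \<Rightarrow> 'v \<Rightarrow> 'v) \<Rightarrow> complex \<Rightarrow> 'v set"
  where "weight_space V act \<mu> = {v \<in> carrier V. act (ptensor (VD 0) 1) v = \<mu> \<odot>\<^bsub>V\<^esub> v}"

definition harish_chandra ::
    "(complex, 'v, 'n) module_scheme \<Rightarrow> (loop_elt \<Rightarrow> 'v \<Rightarrow> 'v) \<Rightarrow> bool"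
  where "harish_chandra V act \<longleftrightarrow>
    lie_module loop_vir V act \<and>
    cspan V (\<Union>\<mu>. weight_space V act \<mu>) = carrier V \<and>
    (\<forall>\<mu>. vectorspace.fin_dim class_ring (V\<lparr>carrier := weight_space V act \<mu>\<rparr>))"

definition laurent_ideal :: "complex poly \<Rightarrow> laurent set" where
  "laurent_ideal P = Idl\<^bsub>laurent_algebra\<^esub> {laurent_of_poly P}"

definition annihilating_poly :: "(loop_elt \<Rightarrow> complex) \<Rightarrow> complex poly \<Rightarrow> bool" where
  "annihilating_poly \<phi> P \<longleftrightarrow> coeff P 0 \<noteq> 0 \<and>
    (\<forall>k::int. \<phi> (ptensor (VD 0) (Poly_Mapping.single k 1 * laurent_of_poly P)) = 0
            \<and> \<phi> (ptensor VC (Poly_Mapping.single k 1 * laurent_of_poly P)) = 0)"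

text \<open>The action factors through the projection
  \<open>Vir \<otimes> \<complex>[t, t\<^sup>-\<^sup>1] \<rightarrow> Vir \<otimes> (\<complex>[t, t\<^sup>-\<^sup>1] / \<langle>P\<rangle>)\<close>, which takes each coefficient to its coset.\<close>

definition factors_through_quotient ::
    "(complex, 'v, 'n) module_scheme \<Rightarrow> (loop_elt \<Rightarrow> 'v \<Rightarrow> 'v) \<Rightarrow> complex poly \<Rightarrow> bool"
  where "factors_through_quotient V act P \<longleftrightarrow>
    (\<exists>act'. lie_module (vir_tensor (quot_module laurent_algebra (laurent_ideal P))) V act' \<and>
      (\<forall>x\<in>carrier loop_vir. \<forall>v\<in>carrier V.
         act' (\<lambda>p. laurent_ideal P +>\<^bsub>laurent_algebra\<^esub> x p) v = act x v))"

end

theory Submission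
  imports Defs
begin

text \<open>
  No Poincare-Birkhoff-Witt theorem is needed.  The projection of \<open>U(\<L>)\<close> onto \<open>U(\<L>\<^sub>0)\<close> along
  \<open>\<L>\<^sub>- U(\<L>) + U(\<L>) \<L>\<^sub>+\<close>, followed by \<open>\<phi>\<close>, is given by an explicit recursion on words.  It descends to a
  functional \<open>l\<close> on the Verma module with \<open>l v\<^sub>0 = 1\<close> and \<open>l (\<L>\<^sub>- V) = 0\<close>; the largest submodule in its
  kernel is the unique maximal proper submodule.

  If \<open>\<phi>\<close> kills \<open>d\<^sub>0 \<otimes> \<langle>P\<rangle>\<close> and \<open>c \<otimes> \<langle>P\<rangle>\<close>, then \<open>l\<close> vanishes on the submodule
  \<open>(Vir \<otimes> \<langle>P\<rangle>) V(\<phi>)\<close>, which is therefore zero, and each weight space is spanned by the finitely many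
  words in the \<open>d\<^sub>-\<^sub>k \<otimes> t\<^sup>j\<close> with \<open>k > 0\<close> and \<open>0 \<le> j < deg P\<close> of the right degree.  Conversely, if
  the weight space of depth \<open>2\<close> is finite-dimensional, then \<open>(d\<^sub>-\<^sub>2 \<otimes> R) v\<^sub>0 = 0\<close> for some \<open>R \<noteq> 0\<close>;
  applying \<open>d\<^sub>1 \<otimes> f\<close>, then \<open>d\<^sub>1\<close>, and on the other hand \<open>d\<^sub>2 \<otimes> f\<close>, shows that \<open>\<phi>\<close> kills
  \<open>d\<^sub>0 \<otimes> \<langle>R\<rangle>\<close> and \<open>c \<otimes> \<langle>R\<rangle>\<close>.
\<close>

section \<open>Complex vector spaces and their quotients\<close>

text \<open>The recursion comes from splitting a first letter as \<open>x = h + n\<close> with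
  \<open>h\<close> in \<open>H\<close> and \<open>n\<close> in the complement. The word
  \<open>n w\<close> is projected away, while \<open>h w = [h, w] + w h\<close>, and
  \<open>w h\<close> goes to \<open>\<psi> h\<close> times the image of \<open>w\<close>, as the
  projection is right linear over \<open>H\<close>. The induced module is a quotient built from
  another quotient, so it is not visible that its generator is nonzero; the functional settles this,
  at the price of checking that the recursion respects all relations. Every proper submodule lies in
  the kernel of \<open>l\<close> because the weights \<open>hw - n\<close> are pairwise distinct in
  characteristic zero: applying \<open>d0\<close> minus a weight strips the deeper components off a
  vector and isolates its component along the highest weight vector. Depth 2 is forced by the
  cocycle \<open>(m^3 - m) / 12\<close>. It vanishes at \<open>m = 1\<close>, so depth 1 carries no
  information on \<open>c\<close>; at \<open>m = 2\<close> it is \<open>1/2\<close>. The dependence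
  found there is a Laurent polynomial; dividing by its lowest power of \<open>t\<close>, a unit,
  gives a polynomial with nonzero constant term. That constant term is what allows negative powers
  of \<open>t\<close> to be reduced modulo \<open>P\<close>.\<close>

lemma field_class_ring: "field (class_ring :: complex ring)"
  by unfold_locales

lemma cvectorspaceI:
  fixes V :: "(complex, 'v, 'n) module_scheme"
  assumes "\<zero>\<^bsub>V\<^esub> \<in> carrier V"
    and "\<And>v w. \<lbrakk>v \<in> carrier V; w \<in> carrier V\<rbrakk> \<Longrightarrow> v \<oplus>\<^bsub>V\<^esub> w \<in> carrier V"
    and "\<And>a v. v \<in> carrier V \<Longrightarrow> a \<odot>\<^bsub>V\<^esub> v \<in> carrier V"
    and "\<And>v w. \<lbrakk>v \<in> carrier V; w \<in> carrier V\<rbrakk> \<Longrightarrow> v \<oplus>\<^bsub>V\<^esub> w = w \<oplus>\<^bsub>V\<^esub> v"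
    and "\<And>v w x. \<lbrakk>v \<in> carrier V; w \<in> carrier V; x \<in> carrier V\<rbrakk> \<Longrightarrow>
      (v \<oplus>\<^bsub>V\<^esub> w) \<oplus>\<^bsub>V\<^esub> x = v \<oplus>\<^bsub>V\<^esub> (w \<oplus>\<^bsub>V\<^esub> x)"
    and "\<And>v. v \<in> carrier V \<Longrightarrow> v \<oplus>\<^bsub>V\<^esub> \<zero>\<^bsub>V\<^esub> = v"
    and "\<And>v. v \<in> carrier V \<Longrightarrow> v \<oplus>\<^bsub>V\<^esub> (-1) \<odot>\<^bsub>V\<^esub> v = \<zero>\<^bsub>V\<^esub>"
    and "\<And>a b v. v \<in> carrier V \<Longrightarrow> (a * b) \<odot>\<^bsub>V\<^esub> v = a \<odot>\<^bsub>V\<^esub> (b \<odot>\<^bsub>V\<^esub> v)"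
    and "\<And>v. v \<in> carrier V \<Longrightarrow> 1 \<odot>\<^bsub>V\<^esub> v = v"
    and "\<And>a b v. v \<in> carrier V \<Longrightarrow> (a + b) \<odot>\<^bsub>V\<^esub> v = a \<odot>\<^bsub>V\<^esub> v \<oplus>\<^bsub>V\<^esub> b \<odot>\<^bsub>V\<^esub> v"
    and "\<And>a v w. \<lbrakk>v \<in> carrier V; w \<in> carrier V\<rbrakk> \<Longrightarrow>
      a \<odot>\<^bsub>V\<^esub> (v \<oplus>\<^bsub>V\<^esub> w) = a \<odot>\<^bsub>V\<^esub> v \<oplus>\<^bsub>V\<^esub> a \<odot>\<^bsub>V\<^esub> w"
  shows "vectorspace class_ring V"
proof (rule vs_criteria[OF field_class_ring])
  show "\<forall>v\<in>carrier V. \<exists>w\<in>carrier V. v \<oplus>\<^bsub>V\<^esub> w = \<zero>\<^bsub>V\<^esub>"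
    using assms(3,7) by blast
qed (use assms in auto)

text \<open>Restates the module laws with the arithmetic of \<open>complex\<close> in place of the
  operations of \<open>class_ring\<close>, so that scalars simplify.\<close>

locale cvectorspace = vectorspace class_ring V
  for V :: "(complex, 'v, 'n) module_scheme" (structure)
begin

lemma smult_cl [simp, intro]: "v \<in> carrier V \<Longrightarrow> a \<odot> v \<in> carrier V"
  using smult_closed[of a v] by simp

lemma smult_add_left: "v \<in> carrier V \<Longrightarrow> (a + b) \<odot> v = a \<odot> v \<oplus> b \<odot> v"
  using smult_l_distr[of a b v] by simp

lemma smult_add_right: "\<lbrakk>v \<in> carrier V; w \<in> carrier V\<rbrakk> \<Longrightarrow> a \<odot> (v \<oplus> w) = a \<odot> v \<oplus> a \<odot> w"
  using smult_r_distr[of a v w] by simp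

lemma smult_smult [simp]: "v \<in> carrier V \<Longrightarrow> a \<odot> (b \<odot> v) = (a * b) \<odot> v"
  using smult_assoc1[of a b v] by simp

lemma smult_1 [simp]: "v \<in> carrier V \<Longrightarrow> 1 \<odot> v = v"
  using smult_one[of v] by simp

lemma smult_0_left [simp]: "v \<in> carrier V \<Longrightarrow> 0 \<odot> v = \<zero>"
  using lmult_0[of v] by simp

lemma smult_0_right [simp]: "a \<odot> \<zero> = \<zero>"
  using rmult_0[of a] by simp

lemma uminus_smult: "v \<in> carrier V \<Longrightarrow> \<ominus> v = (-1) \<odot> v"
  using smult_minus_1[of v] by (simp add: class_ring_simps)

lemma minus_smult: "\<lbrakk>v \<in> carrier V; w \<in> carrier V\<rbrakk> \<Longrightarrow> v \<ominus> w = v \<oplus> (-1) \<odot> w"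
  by (simp add: a_minus_def uminus_smult)

lemma smult_eq_0: "\<lbrakk>v \<in> carrier V; a \<odot> v = \<zero>; a \<noteq> 0\<rbrakk> \<Longrightarrow> v = \<zero>"
  using smult_smult[of v "inverse a" a] by (simp del: smult_smult)

lemma add_self_neg [simp]: "v \<in> carrier V \<Longrightarrow> v \<oplus> (-1) \<odot> v = \<zero>"
  using smult_add_left[of v 1 "-1"] by simp

lemma neg_add_self [simp]: "v \<in> carrier V \<Longrightarrow> (-1) \<odot> v \<oplus> v = \<zero>"
  using smult_add_left[of v "-1" 1] by simp

lemma eq_iff_diff: "\<lbrakk>v \<in> carrier V; w \<in> carrier V\<rbrakk> \<Longrightarrow> v = w \<longleftrightarrow> v \<oplus> (-1) \<odot> w = \<zero>"
proof (intro iffI)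
  assume *: "v \<in> carrier V" "w \<in> carrier V" "v \<oplus> (-1) \<odot> w = \<zero>"
  then have "v \<oplus> ((-1) \<odot> w \<oplus> w) = w" using a_assoc[of v "(-1) \<odot> w" w] by simp
  then show "v = w" using * by simp
qed simp

lemma subspaceI:
  assumes "N \<subseteq> carrier V" "\<zero> \<in> N"
    and "\<And>v w. \<lbrakk>v \<in> N; w \<in> N\<rbrakk> \<Longrightarrow> v \<oplus> w \<in> N"
    and "\<And>a v. v \<in> N \<Longrightarrow> a \<odot> v \<in> N"
  shows "subspace class_ring N V"
  using assms by unfold_locales auto

lemma
  assumes "subspace class_ring N V"
  shows subspace_sub: "N \<subseteq> carrier V"
    and subspace_mem: "v \<in> N \<Longrightarrow> v \<in> carrier V"
    and subspace_0: "\<zero> \<in> N"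
    and subspace_add: "\<lbrakk>v \<in> N; w \<in> N\<rbrakk> \<Longrightarrow> v \<oplus> w \<in> N"
    and subspace_smult: "v \<in> N \<Longrightarrow> a \<odot> v \<in> N"
proof -
  interpret submodule class_ring N V
    using assms unfolding VectorSpace.subspace_def by simp
  show "N \<subseteq> carrier V" "v \<in> N \<Longrightarrow> v \<in> carrier V" "\<zero> \<in> N" "\<lbrakk>v \<in> N; w \<in> N\<rbrakk> \<Longrightarrow> v \<oplus> w \<in> N"
    using subset by auto
  show "a \<odot> v \<in> N" if "v \<in> N" using smult_closed[of a v] that by simp
qed

lemma subspace_smult_cancel:
  assumes N: "subspace class_ring N V" and v: "v \<in> carrier V" and "a \<odot> v \<in> N" "a \<noteq> 0"
  shows "v \<in> N"
  using subspace_smult[OF N assms(3), of "inverse a"] assms by simp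

lemma cspan_subspace:
  assumes "S \<subseteq> carrier V"
  shows "subspace class_ring (cspan V S) V"
  using span_is_subspace[OF assms] .

lemma cspan_mem: "\<lbrakk>S \<subseteq> carrier V; v \<in> S\<rbrakk> \<Longrightarrow> v \<in> cspan V S"
  using in_own_span by blast

lemma cspan_least:
  assumes "subspace class_ring N V" "S \<subseteq> N"
  shows "cspan V S \<subseteq> N"
  using span_is_subset[of S N] assms unfolding VectorSpace.subspace_def by auto

context
  fixes N
  assumes N: "subspace class_ring N V"
begin

lemma abelian_subgroup_subspace: "abelian_subgroup N V"
proof (rule abelian_subgroupI3)
  show "additive_subgroup N V"
  proof (rule additive_subgroupI, rule add.subgroupI)
    show "N \<subseteq> carrier V" using subspace_sub[OF N] .
    show "N \<noteq> {}" using subspace_0[OF N] by auto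
    show "\<And>a. a \<in> N \<Longrightarrow> \<ominus> a \<in> N"
      using N by (simp add: uminus_smult subspace_mem subspace_smult)
    show "\<And>a b. a \<in> N \<Longrightarrow> b \<in> N \<Longrightarrow> a \<oplus> b \<in> N"
      using subspace_add[OF N] .
  qed
qed (rule abelian_group_axioms)

interpretation NV: abelian_subgroup N V by (rule abelian_subgroup_subspace)

lemma coset_eq_iff:
  assumes "v \<in> carrier V" "w \<in> carrier V"
  shows "N +> v = N +> w \<longleftrightarrow> v \<oplus> (-1) \<odot> w \<in> N"
proof
  assume "N +> v = N +> w"
  then have "v \<in> N +> w" using NV.a_rcos_self[OF assms(1)] by simp
  then obtain n where n: "n \<in> N" "v = n \<oplus> w" unfolding a_r_coset_def' by auto
  then have "v \<oplus> (-1) \<odot> w = n \<oplus> (w \<oplus> (-1) \<odot> w)"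
    using assms subspace_mem[OF N] by (simp only: a_assoc smult_cl)
  then show "v \<oplus> (-1) \<odot> w \<in> N" using n assms subspace_mem[OF N] by simp
next
  assume *: "v \<oplus> (-1) \<odot> w \<in> N"
  have "(v \<oplus> (-1) \<odot> w) \<oplus> w = v \<oplus> ((-1) \<odot> w \<oplus> w)"
    using assms by (simp only: a_assoc smult_cl)
  then have "v = (v \<oplus> (-1) \<odot> w) \<oplus> w" using assms by simp
  then have "v \<in> N +> w" using * unfolding a_r_coset_def' by blast
  then show "N +> v = N +> w"
    by (metis a_repr_independence assms(2) NV.a_subgroup)
qed

lemma coset_eq_self_iff: "v \<in> carrier V \<Longrightarrow> N +> v = N \<longleftrightarrow> v \<in> N"
  using coset_eq_iff[of v \<zero>] a_coset_add_zero[of N] subspace_sub[OF N] by simp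

lemma quot_carrier: "carrier (quot_module V N) = {N +> v | v. v \<in> carrier V}"
  by (auto simp: quot_module_def ring.defs module.defs FactRing_def A_RCOSETS_def')

lemma quot_carrierI: "v \<in> carrier V \<Longrightarrow> N +> v \<in> carrier (quot_module V N)"
  by (auto simp: quot_carrier)

lemma quot_carrierE:
  assumes "X \<in> carrier (quot_module V N)"
  obtains v where "v \<in> carrier V" "X = N +> v"
  using assms by (auto simp: quot_carrier)

lemma quot_zero: "\<zero>\<^bsub>quot_module V N\<^esub> = N"
  by (auto simp: quot_module_def ring.defs module.defs FactRing_def)

lemma quot_add:
  "\<lbrakk>v \<in> carrier V; w \<in> carrier V\<rbrakk> \<Longrightarrow> (N +> v) \<oplus>\<^bsub>quot_module V N\<^esub> (N +> w) = N +> (v \<oplus> w)"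
  by (simp add: quot_module_def ring.defs module.defs FactRing_def NV.a_rcos_sum)

text \<open>The union that defines \<open>quot_map\<close> runs over all representatives of the
  coset; as \<open>f\<close> is additive and preserves \<open>N\<close>, the cosets in it all
  coincide.\<close>

lemma quot_map_coset:
  assumes "\<And>v w. \<lbrakk>v \<in> carrier V; w \<in> carrier V\<rbrakk> \<Longrightarrow> f (v \<oplus> w) = f v \<oplus> f w"
    and "\<And>v. v \<in> carrier V \<Longrightarrow> f v \<in> carrier V" and "\<And>v. v \<in> N \<Longrightarrow> f v \<in> N"
    and v: "v \<in> carrier V"
  shows "quot_map V N f (N +> v) = N +> f v"
proof -
  have "N +> f x = N +> f v" if x: "x \<in> N +> v" for x
  proof -
    obtain n where n: "n \<in> N" "x = n \<oplus> v" using x unfolding a_r_coset_def' by auto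
    then have "f x = f n \<oplus> f v" using assms(1) subspace_mem[OF N] v by auto
    moreover have "f n \<in> N" using n assms(3) by auto
    ultimately have "f x \<in> N +> f v" unfolding a_r_coset_def' by auto
    then show ?thesis by (metis a_repr_independence assms(2) NV.a_subgroup v)
  qed
  moreover have "v \<in> N +> v" using NV.a_rcos_self[OF v] .
  ultimately show ?thesis unfolding quot_map_def by blast
qed

lemma quot_smult: "v \<in> carrier V \<Longrightarrow> a \<odot>\<^bsub>quot_module V N\<^esub> (N +> v) = N +> (a \<odot> v)"
  using quot_map_coset[of "\<lambda>v. a \<odot> v" v] subspace_smult[OF N]
  by (simp add: quot_module_def ring.defs module.defs FactRing_def smult_add_right)

lemma quot_cvectorspace: "cvectorspace (quot_module V N)"
proof -
  \<comment> \<open>The zero of the quotient record is the set \<open>N\<close> itself and must be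
    seen as a coset before \<open>quot_add\<close> applies to it.\<close>
  have 0: "N = N +> \<zero>" using coset_eq_self_iff[of \<zero>] subspace_0[OF N] by simp
  have "vectorspace class_ring (quot_module V N)"
    by (rule cvectorspaceI; (elim quot_carrierE)?; (subst quot_zero, subst 0)?)
       (auto simp: quot_add quot_smult quot_zero quot_carrier 
         smult_add_left smult_add_right a_ac  intro: exI[of _ \<zero>] 0)
  then show ?thesis by (simp add: cvectorspace_def)
qed

end

end


section \<open>Free vector spaces\<close>

lemma lookup_scale [simp]: "Poly_Mapping.lookup (Poly_Mapping.map ((*) a) f) x = (a::complex) * Poly_Mapping.lookup f x"
  by (simp add: Poly_Mapping.map.rep_eq "when_def")

lemma keys_scale: "Poly_Mapping.keys (Poly_Mapping.map ((*) (a::complex)) f) \<subseteq> Poly_Mapping.keys f"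
  by (auto simp: in_keys_iff)

lemma scale_single: "Poly_Mapping.map ((*) a) (Poly_Mapping.single x b) = Poly_Mapping.single x ((a::complex) * b)"
  by (rule poly_mapping_eqI) (simp add: lookup_single when_def)

lemma scale_add: "Poly_Mapping.map ((*) (a::complex)) (f + g) = Poly_Mapping.map ((*) a) f + Poly_Mapping.map ((*) a) g"
  by (rule poly_mapping_eqI) (simp add: lookup_add algebra_simps)

lemma scale_scale: "Poly_Mapping.map ((*) (a::complex)) (Poly_Mapping.map ((*) b) f) = Poly_Mapping.map ((*) (a * b)) f"
  by (rule poly_mapping_eqI) (simp add: algebra_simps)

lemma scale_minus_1: "Poly_Mapping.map ((*) (-1::complex)) f = - f"
  by (rule poly_mapping_eqI) simp

lemma scale_add_left: "Poly_Mapping.map ((*) (a + b::complex)) f = Poly_Mapping.map ((*) a) f + Poly_Mapping.map ((*) b) f"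
  by (rule poly_mapping_eqI) (simp add: lookup_add algebra_simps)

lemma free_space_simps [simp]:
  "carrier (free_space X) = {f. Poly_Mapping.keys f \<subseteq> X}"
  "add (free_space X) = (+)" "zero (free_space X) = 0"
  "smult (free_space X) = (\<lambda>a. Poly_Mapping.map ((*) a))"
  by (simp_all add: free_space_def)

text \<open>Stated for any record with these four fields, to cover both \<open>free_space X\<close>
  and \<open>monoid_algebra X\<close>, which differ in \<open>mult\<close> and
  \<open>one\<close>.\<close>

lemma cvectorspace_free_like:
  assumes "carrier V = {f::'x \<Rightarrow>\<^sub>0 complex. Poly_Mapping.keys f \<subseteq> X}" "add V = (+)" "zero V = 0"
    and "smult V = (\<lambda>a. Poly_Mapping.map ((*) a))"
  shows "cvectorspace V"
  unfolding cvectorspace_def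
proof (rule cvectorspaceI, unfold assms)
  show "\<And>v w. \<lbrakk>v \<in> {f. Poly_Mapping.keys f \<subseteq> X}; w \<in> {f. Poly_Mapping.keys f \<subseteq> X}\<rbrakk>
      \<Longrightarrow> v + w \<in> {f. Poly_Mapping.keys f \<subseteq> X}"
    using Poly_Mapping.keys_add by fastforce
  show "\<And>(a::complex) v. v \<in> {f. Poly_Mapping.keys f \<subseteq> X} \<Longrightarrow> Poly_Mapping.map ((*) a) v \<in> {f. Poly_Mapping.keys f \<subseteq> X}"
    by (rule CollectI, rule order_trans[OF keys_scale]) simp
  show "\<And>v. v \<in> {f. Poly_Mapping.keys f \<subseteq> X} \<Longrightarrow> Poly_Mapping.map ((*) (1::complex)) v = v"
    by (intro poly_mapping_eqI) simp
qed (auto simp: algebra_simps scale_scale scale_add scale_add_left scale_minus_1)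

lemma cvectorspace_free_space: "cvectorspace (free_space X)"
  by (rule cvectorspace_free_like) auto

lemma free_space_induct [consumes 1, case_names zero add single]:
  fixes f :: "'x \<Rightarrow>\<^sub>0 complex"
  assumes "Poly_Mapping.keys f \<subseteq> X"
    and "P 0"
    and "\<And>f g. \<lbrakk>Poly_Mapping.keys f \<subseteq> X; Poly_Mapping.keys g \<subseteq> X; P f; P g\<rbrakk> \<Longrightarrow> P (f + g)"
    and "\<And>x a. x \<in> X \<Longrightarrow> P (Poly_Mapping.single x a)"
  shows "P f"
proof -
  have "finite (Poly_Mapping.keys f)" by simp
  moreover have "P f" if "finite K" "K \<subseteq> X" "Poly_Mapping.keys f = K" for K f
    using that
  proof (induction K arbitrary: f rule: finite_induct)
    case empty
    then show ?case using assms(2) by simp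
  next
    case (insert k K f)
    let ?s = "Poly_Mapping.single k (Poly_Mapping.lookup f k)"
    have "Poly_Mapping.keys (f - ?s) = K"
      using insert by (auto simp: in_keys_iff lookup_minus lookup_single when_def split: if_splits)
        (metis in_keys_iff insert_iff)+
    then have "P (f - ?s)" using insert by blast
    then have "P ((f - ?s) + ?s)"
      using \<open>Poly_Mapping.keys (f - ?s) = K\<close> insert by (intro assms(3,4)) auto
    then show ?case by simp
  qed
  ultimately show ?thesis using assms(1) by blast
qed

text \<open>The linear extension of a function on the basis, the scalar-valued counterpart of
  \<open>lin_ext\<close>.\<close>

definition lin_eval :: "('x \<Rightarrow> complex) \<Rightarrow> ('x \<Rightarrow>\<^sub>0 complex) \<Rightarrow> complex" where
  "lin_eval h f = (\<Sum>x\<in>Poly_Mapping.keys f. Poly_Mapping.lookup f x * h x)"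

lemma lin_eval_superset:
  assumes "finite K" "Poly_Mapping.keys f \<subseteq> K"
  shows "lin_eval h f = (\<Sum>x\<in>K. Poly_Mapping.lookup f x * h x)"
  unfolding lin_eval_def by (rule sum.mono_neutral_left) (use assms in \<open>auto simp: in_keys_iff\<close>)

lemma lin_eval_0 [simp]: "lin_eval h 0 = 0"
  by (simp add: lin_eval_def)

lemma lin_eval_single [simp]: "lin_eval h (Poly_Mapping.single x a) = a * h x"
  by (simp add: lin_eval_def)

lemma lin_eval_add [simp]: "lin_eval h (f + g) = lin_eval h f + lin_eval h g"
proof -
  let ?K = "Poly_Mapping.keys f \<union> Poly_Mapping.keys g"
  have "Poly_Mapping.keys (f + g) \<subseteq> ?K" by (rule Poly_Mapping.keys_add)
  then show ?thesis
    by (simp add: lin_eval_superset[of ?K] lookup_add algebra_simps sum.distrib)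
qed

lemma lin_eval_scale [simp]: "lin_eval h (Poly_Mapping.map ((*) a) f) = a * lin_eval h f"
  using keys_scale[of a f]
  by (simp add: lin_eval_superset[of "Poly_Mapping.keys f"] sum_distrib_left mult.assoc)

lemma lin_eval_uminus [simp]: "lin_eval h (- f) = - lin_eval h f"
  using lin_eval_add[of h f "-f"] by (simp del: lin_eval_add add: add_eq_0_iff)

lemma lin_eval_diff [simp]: "lin_eval h (f - g) = lin_eval h f - lin_eval h g"
  using lin_eval_add[of h f "-g"] by (simp del: lin_eval_add)

text \<open>Each coordinate of \<open>lin_ext\<close> is a linear functional, so linearity of
  \<open>lin_ext\<close> is inherited from \<open>lin_eval\<close>.\<close>

lemma lookup_lin_ext:
  "Poly_Mapping.lookup (lin_ext h f) y = lin_eval (\<lambda>x. if h x = y then 1 else 0) f"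
  by (simp add: lin_ext_def lookup_sum lin_eval_def lookup_single when_def)
     (intro sum.cong, auto)

lemma lin_ext_0 [simp]: "lin_ext h 0 = 0"
  by (simp add: lin_ext_def)

lemma lin_ext_single [simp]: "lin_ext h (Poly_Mapping.single x a) = Poly_Mapping.single (h x) a"
  by (simp add: lin_ext_def)

lemma lin_ext_add [simp]: "lin_ext h (f + g) = lin_ext h f + lin_ext h g"
  by (rule poly_mapping_eqI) (simp add: lookup_lin_ext lookup_add)

lemma lin_ext_diff [simp]: "lin_ext h (f - g) = lin_ext h f - lin_ext h g"
  by (rule poly_mapping_eqI) (simp add: lookup_lin_ext lookup_minus)

lemma lin_ext_scale [simp]:
  "lin_ext h (Poly_Mapping.map ((*) a) f) = Poly_Mapping.map ((*) a) (lin_ext h f)"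
  by (rule poly_mapping_eqI) (simp add: lookup_lin_ext)

lemma keys_lin_ext: "Poly_Mapping.keys (lin_ext h f) \<subseteq> h ` Poly_Mapping.keys f"
  unfolding lin_ext_def using keys_sum[of "\<lambda>x. Poly_Mapping.single (h x) (Poly_Mapping.lookup f x)" "Poly_Mapping.keys f"]
  by (force simp: in_keys_iff)


section \<open>Lie algebras and modules\<close>

sublocale lie_algebra \<subseteq> L: cvectorspace L
  by unfold_locales

context lie_algebra
begin

text \<open>Polarization of the alternating law at \<open>x \<oplus> y\<close>.\<close>

lemma br_anti:
  assumes x: "x \<in> carrier L" and y: "y \<in> carrier L"
  shows "lie_br L y x = (-1) \<odot> lie_br L x y"
proof -
  have "lie_br L x x \<oplus> lie_br L y x \<oplus> (lie_br L x y \<oplus> lie_br L y y) = \<zero>"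
    using br_alternating[of "x \<oplus> y"] x y by (simp only: br_add_left br_add_right a_closed)
  then have *: "lie_br L y x \<oplus> lie_br L x y = \<zero>"
    using x y by (simp add: br_alternating br_closed)
  have "lie_br L y x \<oplus> (lie_br L x y \<oplus> (-1) \<odot> lie_br L x y)
      = (lie_br L y x \<oplus> lie_br L x y) \<oplus> (-1) \<odot> lie_br L x y"
    using x y by (simp only: a_assoc br_closed L.smult_cl)
  then show ?thesis unfolding * using x y by (simp add: br_closed)
qed

text \<open>The Jacobi identity in the form that makes \<open>lie_br L x\<close> a derivation, which
  is how it enters the calculus of \<open>der\<close> below.\<close>

lemma br_jacobi_derivation:
  assumes x: "x \<in> carrier L" and y: "y \<in> carrier L" and z: "z \<in> carrier L"
  shows "lie_br L (lie_br L x y) z \<oplus> lie_br L y (lie_br L x z) = lie_br L x (lie_br L y z)"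
proof -
  note br_closed [simp]
  let ?a = "lie_br L x (lie_br L y z)" and ?b = "lie_br L y (lie_br L x z)" and ?c = "lie_br L (lie_br L x y) z"
  have 1: "lie_br L y (lie_br L z x) = (-1) \<odot> ?b"
    using assms by (simp add: br_anti[of x z] br_smult_right)
  have 2: "lie_br L z (lie_br L x y) = (-1) \<odot> ?c"
    using assms by (simp add: br_anti[of "lie_br L x y" z])
  have "?a \<oplus> (-1) \<odot> (?c \<oplus> ?b) = ?a \<oplus> (-1) \<odot> ?b \<oplus> (-1) \<odot> ?c"
    using assms by (simp add: L.smult_add_right a_ac)
  also have "\<dots> = \<zero>" using br_jacobi[OF x y z] by (simp only: 1 2)
  finally show ?thesis using assms L.eq_iff_diff[of ?a "?c \<oplus> ?b"] by simp
qed

lemma br_zero_right [simp]: "x \<in> carrier L \<Longrightarrow> lie_br L x \<zero> = \<zero>"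
  using br_smult_right[of x \<zero> 0] by (simp add: br_closed)

end

sublocale lie_module \<subseteq> V: cvectorspace V
  by unfold_locales

context lie_module
begin

lemma act_zero_right [simp]: "x \<in> carrier L \<Longrightarrow> act x \<zero>\<^bsub>V\<^esub> = \<zero>\<^bsub>V\<^esub>"
  using act_smult_right[of x "\<zero>\<^bsub>V\<^esub>" 0] by (simp add: act_closed)

lemma act_zero_left [simp]: "v \<in> carrier V \<Longrightarrow> act \<zero> v = \<zero>\<^bsub>V\<^esub>"
  using act_smult_left[of \<zero> v 0] by (simp add: act_closed)

lemma act_swap:
  assumes "x \<in> carrier L" "y \<in> carrier L" "v \<in> carrier V"
  shows "act x (act y v) = act (lie_br L x y) v \<oplus>\<^bsub>V\<^esub> act y (act x v)"
proof -
  have "act (lie_br L x y) v \<oplus>\<^bsub>V\<^esub> act y (act x v)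
      = act x (act y v) \<oplus>\<^bsub>V\<^esub> ((-1) \<odot>\<^bsub>V\<^esub> act y (act x v) \<oplus>\<^bsub>V\<^esub> act y (act x v))"
    using assms by (simp only: act_br act_closed V.minus_smult V.a_assoc V.smult_cl)
  then show ?thesis using assms by (simp add: act_closed)
qed

lemma lie_submoduleI:
  assumes "N \<subseteq> carrier V" "\<zero>\<^bsub>V\<^esub> \<in> N"
    and "\<And>v w. \<lbrakk>v \<in> N; w \<in> N\<rbrakk> \<Longrightarrow> v \<oplus>\<^bsub>V\<^esub> w \<in> N"
    and "\<And>a v. v \<in> N \<Longrightarrow> a \<odot>\<^bsub>V\<^esub> v \<in> N"
    and "\<And>x v. \<lbrakk>x \<in> carrier L; v \<in> N\<rbrakk> \<Longrightarrow> act x v \<in> N"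
  shows "lie_submodule L V act N"
  unfolding lie_submodule_def using V.subspaceI[OF assms(1-4)] assms(5) by blast

context
  fixes N
  assumes N: "lie_submodule L V act N"
begin

lemma submodule_subspace: "subspace class_ring N V"
  using N unfolding lie_submodule_def by simp

lemma submodule_act: "\<lbrakk>x \<in> carrier L; v \<in> N\<rbrakk> \<Longrightarrow> act x v \<in> N"
  using N unfolding lie_submodule_def by simp

lemma quot_act: "\<lbrakk>x \<in> carrier L; v \<in> carrier V\<rbrakk> \<Longrightarrow>
  quot_map V N (act x) (N +>\<^bsub>V\<^esub> v) = N +>\<^bsub>V\<^esub> act x v"
  using V.quot_map_coset[OF submodule_subspace, of "act x" v] submodule_act
  by (simp add: act_add_right act_closed)

lemma quot_lie_module: "lie_module L (quot_module V N) (\<lambda>x. quot_map V N (act x))"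
proof -
  interpret Q: cvectorspace "quot_module V N"
    using V.quot_cvectorspace[OF submodule_subspace] .
  note S = submodule_subspace
  note q = V.quot_add[OF S] V.quot_smult[OF S] quot_act act_closed
  show ?thesis
  proof unfold_locales
    fix x y v assume x: "x \<in> carrier L" "y \<in> carrier L" and v: "v \<in> carrier (quot_module V N)"
    obtain w where w: "w \<in> carrier V" "v = N +>\<^bsub>V\<^esub> w" using V.quot_carrierE[OF S v] .
    show "quot_map V N (act (lie_br L x y)) v = quot_map V N (act x) (quot_map V N (act y) v)
       \<ominus>\<^bsub>quot_module V N\<^esub> quot_map V N (act y) (quot_map V N (act x) v)"
      using w x by (subst Q.minus_smult) (auto simp: q V.quot_carrierI[OF S] L.br_closed act_br V.minus_smult)
  qed (auto elim!: V.quot_carrierE[OF S] simp: q act_add_left act_smult_left act_add_right act_smult_right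
         V.quot_carrierI[OF S])
qed

end

end

section \<open>Modules induced from a character\<close>

text \<open>
  \<open>p\<close> projects \<open>L\<close> onto a subalgebra \<open>H\<close> along a complementary subalgebra, and \<open>\<psi>\<close> is a character
  of \<open>H\<close>, extended to \<open>L\<close> by zero on the complement.
\<close>

locale induced_character = lie_algebra L
  for L :: "('a, 'm) lie_alg_scheme" (structure) +
  fixes H :: "'a set" and p :: "'a \<Rightarrow> 'a" and \<psi> :: "'a \<Rightarrow> complex"
  assumes p_closed: "x \<in> carrier L \<Longrightarrow> p x \<in> carrier L"
    and p_add: "\<lbrakk>x \<in> carrier L; y \<in> carrier L\<rbrakk> \<Longrightarrow> p (x \<oplus> y) = p x \<oplus> p y"
    and p_smult: "x \<in> carrier L \<Longrightarrow> p (a \<odot> x) = a \<odot> p x"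
    and H_sub: "H \<subseteq> carrier L"
    and p_p: "x \<in> carrier L \<Longrightarrow> p (p x) = p x"
    and p_H: "h \<in> H \<Longrightarrow> p h = h"
    and \<psi>_add: "\<lbrakk>x \<in> carrier L; y \<in> carrier L\<rbrakk> \<Longrightarrow> \<psi> (x \<oplus> y) = \<psi> x + \<psi> y"
    and \<psi>_smult: "x \<in> carrier L \<Longrightarrow> \<psi> (a \<odot> x) = a * \<psi> x"
    and \<psi>_p: "x \<in> carrier L \<Longrightarrow> \<psi> (p x) = \<psi> x"
    and p_br: "\<lbrakk>x \<in> carrier L; y \<in> carrier L\<rbrakk> \<Longrightarrow> p (lie_br L (p x) (p y)) = lie_br L (p x) (p y)"
    and \<psi>_br: "\<lbrakk>x \<in> carrier L; y \<in> carrier L\<rbrakk> \<Longrightarrow> \<psi> (lie_br L (p x) (p y)) = 0"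
    and p_br_compl: "\<lbrakk>x \<in> carrier L; y \<in> carrier L; p x = \<zero>; p y = \<zero>\<rbrakk> \<Longrightarrow> p (lie_br L x y) = \<zero>"
begin

text \<open>
  The functional \<open>lam\<close> on words is the composition of \<open>\<psi>\<close> with the projection of \<open>U(L)\<close> onto \<open>U(H)\<close>
  along \<open>L\<^sub>- U(L)\<close>, where \<open>L\<^sub>-\<close> is the complement of \<open>H\<close>.
\<close>

function lam :: "'a list \<Rightarrow> complex" where
  "lam [] = 1"
| "lam (x # w) = (\<Sum>i<length w. lam (w[i := lie_br L (p x) (w ! i)])) + \<psi> x * lam w"
  by pat_completeness auto
termination by (relation "measure length") auto

declare lam.simps(2) [simp del]

text \<open>The derivation of the tensor algebra that extends \<open>lie_br L g\<close>, applied to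
  \<open>w\<close> and then evaluated by \<open>F\<close>.\<close>

definition der :: "'a \<Rightarrow> 'a list \<Rightarrow> ('a list \<Rightarrow> complex) \<Rightarrow> complex" where
  "der g w F = (\<Sum>i<length w. F (w[i := lie_br L g (w ! i)]))"

lemma lam_Cons: "lam (x # w) = der (p x) w lam + \<psi> x * lam w"
  by (simp add: der_def lam.simps(2))

lemma der_Nil [simp]: "der g [] F = 0"
  by (simp add: der_def)

lemma der_Cons [simp]: "der g (a # w) F = F (lie_br L g a # w) + der g w (\<lambda>u. F (a # u))"
  by (simp add: der_def sum.lessThan_Suc_shift del: sum.lessThan_Suc)

lemma der_append [simp]: "der g (u @ v) F = der g u (\<lambda>u'. F (u' @ v)) + der g v (\<lambda>v'. F (u @ v'))"
  by (induction u arbitrary: F) simp_all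

lemma der_plus: "der g w (\<lambda>u. F u + G u) = der g w F + der g w G"
  and der_minus: "der g w (\<lambda>u. F u - G u) = der g w F - der g w G"
  and der_times: "der g w (\<lambda>u. a * F u) = a * der g w F"
  by (simp_all add: der_def sum.distrib sum_subtractf sum_distrib_left)

text \<open>The words that occur inside \<open>der\<close> have the length of \<open>w\<close>, so
  an induction hypothesis on length can be used under \<open>der\<close>.\<close>

lemma der_cong:
  assumes "w \<in> lists (carrier L)" "g \<in> carrier L"
    and "\<And>u. \<lbrakk>u \<in> lists (carrier L); length u = length w\<rbrakk> \<Longrightarrow> F u = G u"
  shows "der g w F = der g w G"
proof -
  have "w[i := lie_br L g (w ! i)] \<in> lists (carrier L)" if "i < length w" for i
    using assms that set_update_subset_insert[of w i "lie_br L g (w ! i)"]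
    by (auto simp: in_lists_conv_set intro!: br_closed)
  then show ?thesis unfolding der_def by (intro sum.cong) (auto intro!: assms(3))
qed

text \<open>Exactly the condition that \<open>F\<close>, on words over \<open>carrier L\<close>,
  factors through the tensor algebra of the vector space \<open>L\<close>.\<close>

definition multilinear :: "('a list \<Rightarrow> complex) \<Rightarrow> bool" where
  "multilinear F \<longleftrightarrow> (\<forall>u\<in>lists (carrier L). \<forall>v\<in>lists (carrier L). \<forall>x\<in>carrier L. \<forall>y\<in>carrier L. \<forall>a b.
     F (u @ (a \<odot> x \<oplus> b \<odot> y) # v) = a * F (u @ x # v) + b * F (u @ y # v))"

lemma multilinearD:
  "\<lbrakk>multilinear F; u \<in> lists (carrier L); v \<in> lists (carrier L); x \<in> carrier L; y \<in> carrier L\<rbrakk> \<Longrightarrow>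
    F (u @ (a \<odot> x \<oplus> b \<odot> y) # v) = a * F (u @ x # v) + b * F (u @ y # v)"
  unfolding multilinear_def by blast

lemma multilinear_Cons:
  assumes "multilinear F" "a \<in> carrier L"
  shows "multilinear (\<lambda>u. F (a # u))"
  unfolding multilinear_def
proof (intro ballI allI)
  fix u v x y c b
  assume "u \<in> lists (carrier L)" "v \<in> lists (carrier L)" "x \<in> carrier L" "y \<in> carrier L"
  then show "F (a # u @ (c \<odot> x \<oplus> b \<odot> y) # v) = c * F (a # u @ x # v) + b * F (a # u @ y # v)"
    using multilinearD[OF assms(1), of "a # u" v x y c b] assms(2) by simp
qed

text \<open>Linearity of \<open>F\<close> is demanded only on words no longer than \<open>w\<close>:
  \<open>multilinear_lam\<close> applies this to \<open>lam\<close> in the middle of its own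
  induction on length.\<close>

lemma der_linear:
  assumes w: "w \<in> lists (carrier L)" and x: "x \<in> carrier L" "y \<in> carrier L"
    and F: "\<And>u v x y a b. \<lbrakk>u \<in> lists (carrier L); v \<in> lists (carrier L); length u + length v < length w;
       x \<in> carrier L; y \<in> carrier L\<rbrakk> \<Longrightarrow>
       F (u @ (a \<odot> x \<oplus> b \<odot> y) # v) = a * F (u @ x # v) + b * F (u @ y # v)"
  shows "der (a \<odot> x \<oplus> b \<odot> y) w F = a * der x w F + b * der y w F"
  using w F
proof (induction w arbitrary: F rule: list.induct)
  case (Cons z w)
  note F = Cons.prems(2)
  note w = Cons.prems(1)
  have z: "z \<in> carrier L" "w \<in> lists (carrier L)" using w by simp_all
  have 1: "der (a \<odot> x \<oplus> b \<odot> y) w (\<lambda>u. F (z # u)) = a * der x w (\<lambda>u. F (z # u)) + b * der y w (\<lambda>u. F (z # u))"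
  proof (rule Cons.IH[OF z(2)])
    fix u v x y a b
    assume "u \<in> lists (carrier L)" "v \<in> lists (carrier L)" "length u + length v < length w"
      "x \<in> carrier L" "y \<in> carrier L"
    then show "F (z # u @ (a \<odot> x \<oplus> b \<odot> y) # v) = a * F (z # u @ x # v) + b * F (z # u @ y # v)"
      using Cons.prems(2)[of "z # u" v x y a b] z by simp
  qed
  have 2: "lie_br L (a \<odot> x \<oplus> b \<odot> y) z = a \<odot> lie_br L x z \<oplus> b \<odot> lie_br L y z"
    using x z by (simp add: br_add_left br_smult_left)
  show ?case
    using Cons.prems(2)[of "[]" w "lie_br L x z" "lie_br L y z" a b] x z
    by (simp add: 1 2 br_closed algebra_simps)
qed simp

text \<open>A sum in the first letter enters the recursion through \<open>p\<close> and
  \<open>\<psi>\<close>, both linear. A sum further right is carried along by the derivation of the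
  first letter. In both cases \<open>lam\<close> is evaluated only on shorter words.\<close>

lemma multilinear_lam: "multilinear lam"
proof -
  have "lam (u @ (a \<odot> x \<oplus> b \<odot> y) # v) = a * lam (u @ x # v) + b * lam (u @ y # v)"
    if "u \<in> lists (carrier L)" "v \<in> lists (carrier L)" "x \<in> carrier L" "y \<in> carrier L"
    for u v x y a b
    using that
  proof (induction "length u + length v" arbitrary: u v x y a b rule: less_induct)
    case less
    show ?case
    proof (cases u)
      case Nil
      have "der (a \<odot> p x \<oplus> b \<odot> p y) v lam = a * der (p x) v lam + b * der (p y) v lam"
        by (rule der_linear) (use less Nil p_closed in auto)
      then show ?thesis
        using less.prems Nil
        by (simp add: lam_Cons p_add p_smult \<psi>_add \<psi>_smult algebra_simps)
    next
      case (Cons g u')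
      have g: "p g \<in> carrier L" "u' \<in> lists (carrier L)" using less.prems Cons p_closed by auto
      have 1: "der (p g) u' (\<lambda>u'. lam (u' @ (a \<odot> x \<oplus> b \<odot> y) # v))
         = der (p g) u' (\<lambda>u'. a * lam (u' @ x # v) + b * lam (u' @ y # v))"
        by (rule der_cong[OF g(2,1)], rule less.hyps) (use less.prems Cons in auto)
      have 2: "der (p g) v (\<lambda>v'. lam (u' @ (a \<odot> x \<oplus> b \<odot> y) # v'))
         = der (p g) v (\<lambda>v'. a * lam (u' @ x # v') + b * lam (u' @ y # v'))"
        by (rule der_cong[OF less.prems(2) g(1)], rule less.hyps) (use less.prems Cons in auto)
      have 3: "lie_br L (p g) (a \<odot> x \<oplus> b \<odot> y) = a \<odot> lie_br L (p g) x \<oplus> b \<odot> lie_br L (p g) y"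
        using g less.prems by (simp add: br_add_right br_smult_right)
      have 4: "lam (u' @ (a \<odot> lie_br L (p g) x \<oplus> b \<odot> lie_br L (p g) y) # v)
         = a * lam (u' @ lie_br L (p g) x # v) + b * lam (u' @ lie_br L (p g) y # v)"
        by (rule less.hyps) (use less.prems Cons g br_closed in auto)
      have 5: "lam (u' @ (a \<odot> x \<oplus> b \<odot> y) # v) = a * lam (u' @ x # v) + b * lam (u' @ y # v)"
        by (rule less.hyps) (use less.prems Cons g br_closed in auto)
      show ?thesis
        by (simp add: Cons lam_Cons 1 2 3 4 5 der_plus der_times algebra_simps)
    qed
  qed
  then show ?thesis unfolding multilinear_def by blast
qed

lemma multilinear_add:
  assumes "multilinear F" "u \<in> lists (carrier L)" "v \<in> lists (carrier L)" "x \<in> carrier L" "y \<in> carrier L"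
  shows "F (u @ (x \<oplus> y) # v) = F (u @ x # v) + F (u @ y # v)"
  using multilinearD[OF assms, of 1 1] assms by simp

lemma multilinear_smult:
  assumes "multilinear F" "u \<in> lists (carrier L)" "v \<in> lists (carrier L)" "x \<in> carrier L"
  shows "F (u @ (a \<odot> x) # v) = a * F (u @ x # v)"
  using multilinearD[OF assms(1-4,4), of a 0] assms by simp

text \<open>By the Jacobi identity, brackets go to commutators of derivations. The outer
  \<open>der\<close> acts on the word first, hence the reversed order in
  \<open>lie_br L y x\<close>.\<close>

lemma der_commutator:
  assumes "multilinear F" "w \<in> lists (carrier L)" and x: "x \<in> carrier L" "y \<in> carrier L"
  shows "der x w (\<lambda>w'. der y w' F) - der y w (\<lambda>w'. der x w' F) = der (lie_br L y x) w F"
  using assms(1,2)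
proof (induction w arbitrary: F rule: list.induct)
  case (Cons a w)
  have a: "a \<in> carrier L" "w \<in> lists (carrier L)" using Cons.prems(2) by auto
  have "lie_br L (lie_br L y x) a \<oplus> lie_br L x (lie_br L y a) = lie_br L y (lie_br L x a)"
    using br_jacobi_derivation[of y x a] x a by simp
  then have *: "F (lie_br L y (lie_br L x a) # w) = F (lie_br L (lie_br L y x) a # w) + F (lie_br L x (lie_br L y a) # w)"
    using multilinear_add[OF Cons.prems(1), of "[]" w "lie_br L (lie_br L y x) a" "lie_br L x (lie_br L y a)"] a x
    by (simp add: br_closed)
  show ?case
    using Cons.IH[OF multilinear_Cons[OF Cons.prems(1) a(1)] a(2)] *
    by (simp add: der_plus algebra_simps)
qed simp

lemma p_zero [simp]: "p \<zero> = \<zero>"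
  using p_smult[of \<zero> 0] p_closed[of \<zero>] by simp

lemma \<psi>_zero [simp]: "\<psi> \<zero> = 0"
  using \<psi>_smult[of \<zero> 0] by simp

lemma der_zero: "\<lbrakk>multilinear F; w \<in> lists (carrier L)\<rbrakk> \<Longrightarrow> der \<zero> w F = 0"
  using der_linear[of w \<zero> \<zero> F 0 0] multilinearD by auto

text \<open>The derivation is that of zero, and \<open>\<psi> x = \<psi> (p x) = 0\<close>. This is
  the vanishing on the right ideal \<open>L\<^sub>- U(L)\<close>.\<close>

lemma lam_compl:
  assumes "x \<in> carrier L" "p x = \<zero>" "w \<in> lists (carrier L)"
  shows "lam (x # w) = 0"
  using assms \<psi>_p[of x] der_zero[OF multilinear_lam assms(3)] by (simp add: lam_Cons)

lemma p_idem:
  assumes "x \<in> carrier L"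
  shows "p (x \<oplus> (-1) \<odot> p x) = \<zero>"
  using assms by (simp add: p_add p_smult p_p p_closed)

text \<open>With \<open>multilinear_lam\<close> this makes \<open>lam\<close> descend to the
  enveloping algebra. The computation sits in a swap at the front of the word; a swap behind a first
  letter is reduced to shorter words, the Jacobi identity matching the terms in which the derivation
  hits \<open>x\<close> or \<open>y\<close>.\<close>

lemma lam_br:
  assumes "u \<in> lists (carrier L)" "v \<in> lists (carrier L)" "x \<in> carrier L" "y \<in> carrier L"
  shows "lam (u @ x # y # v) - lam (u @ y # x # v) = lam (u @ lie_br L x y # v)"
  using assms
proof (induction "length u + length v" arbitrary: u v x y rule: less_induct)
  case less
  note m = multilinear_lam
  note v = less.prems(2) and x = less.prems(3) and y = less.prems(4)
  note cl = p_closed br_closed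
  show ?case
  proof (cases u)
    case Nil
    let ?px = "p x" and ?py = "p y"
    let ?x = "x \<oplus> (-1) \<odot> ?px" and ?y = "y \<oplus> (-1) \<odot> ?py"
    \<comment> \<open>The products of values of \<open>\<psi>\<close> cancel, and so do the mixed
      terms; the two iterated derivations on \<open>v\<close> combine by
      \<open>der_commutator\<close>.\<close>
    have "lam (x # y # v) - lam (y # x # v) =
      lam (lie_br L ?px y # v) - lam (lie_br L ?py x # v) + der (lie_br L ?py ?px) v lam"
      unfolding der_commutator[OF m v p_closed[OF x] p_closed[OF y], symmetric]
      by (simp add: lam_Cons der_plus der_times algebra_simps)
    \<comment> \<open>The bracket of two elements of \<open>H\<close> is fixed by \<open>p\<close>
      and killed by \<open>\<psi>\<close>, so the recursion can be read backwards.\<close>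
    also have "der (lie_br L ?py ?px) v lam = lam (lie_br L ?py ?px # v)"
      using x y by (simp add: lam_Cons p_br \<psi>_br)
    also have "lam (lie_br L ?py ?px # v) = - lam (lie_br L ?px ?py # v)"
      using multilinear_smult[OF m, of "[]" v "lie_br L ?px ?py" "-1"] x y v by (simp add: br_anti[of ?px ?py] cl)
    also have "lam (lie_br L ?py x # v) = - lam (lie_br L x ?py # v)"
      using multilinear_smult[OF m, of "[]" v "lie_br L x ?py" "-1"] x y v by (simp add: br_anti[of x ?py] cl)
    finally have 1: "lam (x # y # v) - lam (y # x # v) =
      lam (lie_br L ?px y # v) + lam (lie_br L x ?py # v) - lam (lie_br L ?px ?py # v)" by simp
    \<comment> \<open>\<open>?x\<close> and \<open>?y\<close> are the components in the complement,
      which is a subalgebra. Expanding their bracket turns this zero into the formula for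
      \<open>lam (lie_br L x y # v)\<close> that matches fact 1.\<close>
    have "lam (lie_br L ?x ?y # v) = 0"
      using x y v by (intro lam_compl p_br_compl p_idem) (simp_all add: cl)
    moreover have "lie_br L ?x ?y = lie_br L x y \<oplus> ((-1) \<odot> lie_br L x ?py \<oplus> 
        ((-1) \<odot> lie_br L ?px y \<oplus> lie_br L ?px ?py))"
      using x y by (simp add: br_add_left br_add_right br_smult_left br_smult_right cl a_ac L.smult_add_right)
    ultimately have "lam (lie_br L x y # v) - (lam (lie_br L ?px y # v) + lam (lie_br L x ?py # v) - lam (lie_br L ?px ?py # v)) = 0"
      using x y v multilinear_add[OF m, of "[]" v] multilinear_smult[OF m, of "[]" v _ "-1"]
      by (simp add: cl algebra_simps)
    then have "lam (x # y # v) - lam (y # x # v) = lam (lie_br L x y # v)" using 1 by simp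
    then show ?thesis using Nil by simp
  next
    case (Cons g u')
    let ?g = "p g"
    have g: "?g \<in> carrier L" "u' \<in> lists (carrier L)" using less.prems Cons p_closed by auto
    have 1: "der ?g u' (\<lambda>u'. lam (u' @ x # y # v)) - der ?g u' (\<lambda>u'. lam (u' @ y # x # v))
       = der ?g u' (\<lambda>u'. lam (u' @ lie_br L x y # v))"
      unfolding der_minus[symmetric]
      by (rule der_cong[OF g(2,1)], rule less.hyps) (use less.prems Cons in auto)
    have 2: "der ?g v (\<lambda>v. lam (u' @ x # y # v)) - der ?g v (\<lambda>v. lam (u' @ y # x # v))
       = der ?g v (\<lambda>v. lam (u' @ lie_br L x y # v))"
      unfolding der_minus[symmetric]
      by (rule der_cong[OF v g(1)], rule less.hyps) (use less.prems Cons g in auto)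
    have IH: "lam (u' @ x # y # v) - lam (u' @ y # x # v) = lam (u' @ lie_br L x y # v)" 
      if "x \<in> carrier L" "y \<in> carrier L" for x y
      by (rule less.hyps) (use less.prems Cons that g in auto)
    have "lam (u' @ lie_br L ?g (lie_br L x y) # v) = lam (u' @ lie_br L (lie_br L ?g x) y # v)
        + lam (u' @ lie_br L x (lie_br L ?g y) # v)"
      using multilinear_add[OF m g(2) v, of "lie_br L (lie_br L ?g x) y" "lie_br L x (lie_br L ?g y)"]
        br_jacobi_derivation[OF g(1) x y] g x y by (simp add: br_closed)
    then show ?thesis
      using 1 2 IH[of "lie_br L ?g x" y] IH[of x "lie_br L ?g y"] IH[OF x y] g x y
      by (simp add: Cons lam_Cons br_closed algebra_simps)
  qed
qed

text \<open>Right linearity over \<open>H\<close>, which is what the balancing relation of the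
  tensor product asks for. The derivation of an earlier letter also hits the last letter
  \<open>h\<close>, but yields there a bracket of two elements of \<open>H\<close>, where
  \<open>\<psi>\<close> vanishes.\<close>

lemma lam_snoc:
  assumes "u \<in> lists (carrier L)" "h \<in> carrier L" "p h = h"
  shows "lam (u @ [h]) = \<psi> h * lam u"
  using assms
proof (induction "length u" arbitrary: u h rule: less_induct)
  case less
  show ?case
  proof (cases u)
    case Nil
    then show ?thesis by (simp add: lam_Cons)
  next
    case (Cons g u')
    have g: "g \<in> carrier L" "u' \<in> lists (carrier L)" using less.prems Cons by auto
    have 1: "der (p g) u' (\<lambda>u. lam (u @ [h])) = der (p g) u' (\<lambda>u. \<psi> h * lam u)"
      by (rule der_cong[OF g(2) p_closed[OF g(1)]], rule less.hyps) (use less.prems Cons in auto)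
    have "lam (u' @ [lie_br L (p g) (p h)]) = \<psi> (lie_br L (p g) (p h)) * lam u'"
      by (rule less.hyps) (use Cons g less.prems(1,2) in \<open>auto intro!: br_closed p_closed simp: p_br\<close>)
    then have 2: "lam (u' @ [lie_br L (p g) h]) = 0"
      using less.prems(3) \<psi>_br[OF g(1) less.prems(2)] by simp
    have 3: "lam (u' @ [h]) = \<psi> h * lam u'"
      by (rule less.hyps) (use less.prems Cons in auto)
    show ?thesis by (simp add: Cons lam_Cons 1 2 3 der_times algebra_simps)
  qed
qed

end


subsection \<open>The enveloping algebra\<close>

lemma monoid_algebra_simps [simp]:
  "carrier (monoid_algebra X) = {f. Poly_Mapping.keys f \<subseteq> X}"
  "add (monoid_algebra X) = (+)" "zero (monoid_algebra X) = 0"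
  "mult (monoid_algebra X) = (*)" "one (monoid_algebra X) = 1"
  "smult (monoid_algebra X) = (\<lambda>a. Poly_Mapping.map ((*) a))"
  by (simp_all add: monoid_algebra_def free_space_def)

lemma cvectorspace_monoid_algebra: "cvectorspace (monoid_algebra X)"
  by (rule cvectorspace_free_like) auto

lemma ring_monoid_algebra:
  fixes X :: "'x::monoid_add set"
  assumes X: "0 \<in> X" "\<And>x y. \<lbrakk>x \<in> X; y \<in> X\<rbrakk> \<Longrightarrow> x + y \<in> X"
  shows "ring (monoid_algebra X)"
proof -
  interpret V: cvectorspace "monoid_algebra X" by (rule cvectorspace_monoid_algebra)
  have closed: "Poly_Mapping.keys (f * g) \<subseteq> X"
    if "Poly_Mapping.keys f \<subseteq> X" "Poly_Mapping.keys g \<subseteq> X" for f g :: "'x \<Rightarrow>\<^sub>0 complex"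
    using keys_mult[of f g] X(2) that by blast
  show ?thesis
    by (rule ringI[OF V.abelian_group_axioms monoidI])
       (auto simp: algebra_simps X(1) dest!: closed[THEN subsetD, rotated 2])
qed

lemma lin_eval_word [simp]: "lin_eval h (word w) = h w"
  by (simp add: word_def)

lemma word_append: "word (u @ v) = word u * word v"
  by (simp add: word_def mult_single plus_list_def)

lemma word_Nil: "word [] = 1"
  by (simp add: word_def flip: zero_list_def single_one)

lemma lin_eval_single_mult:
  "lin_eval h (Poly_Mapping.single w a * f) = a * lin_eval (\<lambda>z. h (w @ z)) f"
proof -
  have "Poly_Mapping.keys f \<subseteq> UNIV" by simp
  then show ?thesis
    by (induction f rule: free_space_induct) (simp_all add: distrib_left mult_single plus_list_def)
qed

lemma lin_eval_mult_single:
  "lin_eval h (f * Poly_Mapping.single w a) = a * lin_eval (\<lambda>z. h (z @ w)) f"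
proof -
  have "Poly_Mapping.keys f \<subseteq> UNIV" by simp
  then show ?thesis
    by (induction f rule: free_space_induct) (simp_all add: distrib_right distrib_left mult_single plus_list_def)
qed

context lie_algebra
begin

abbreviation free_alg :: "(complex, 'a list \<Rightarrow>\<^sub>0 complex) module" where
  "free_alg \<equiv> monoid_algebra (lists (carrier L))"

lemma ring_free_alg: "ring free_alg"
  by (rule ring_monoid_algebra) (auto simp: zero_list_def plus_list_def)

sublocale T: cvectorspace free_alg
  by (rule cvectorspace_monoid_algebra)

lemma T_mult: "\<lbrakk>f \<in> carrier free_alg; g \<in> carrier free_alg\<rbrakk> \<Longrightarrow> f * g \<in> carrier free_alg"
  using ring.ring_simprules(5)[OF ring_free_alg, of f g] by simp

lemma word_T: "w \<in> lists (carrier L) \<Longrightarrow> word w \<in> carrier free_alg"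
  by (auto simp: word_def)

lemma env_relations_T: "env_relations L \<subseteq> carrier free_alg"
proof -
  have d: "f \<in> carrier free_alg \<Longrightarrow> g \<in> carrier free_alg \<Longrightarrow> f - g \<in> carrier free_alg" for f g
    using keys_diff[of f g] by auto
  show ?thesis unfolding env_relations_def
    by (auto simp del: monoid_algebra_simps intro!: d word_T br_closed)
       (auto)
qed

lemma ideal_env_ideal: "ideal (env_ideal L) free_alg"
  unfolding env_ideal_def by (rule ring.genideal_ideal[OF ring_free_alg env_relations_T])

lemma env_relations_ideal: "env_relations L \<subseteq> env_ideal L"
  unfolding env_ideal_def by (rule ring.genideal_self[OF ring_free_alg env_relations_T])

text \<open>Scalars act as multiples of the empty word; therefore a two-sided ideal of the free
  algebra is a subspace.\<close>

lemma scale_conv_mult: "Poly_Mapping.map ((*) (a::complex)) f = Poly_Mapping.single ([]::'x list) a * f"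
  using mult_map_scale_conv_mult[of a f] by (simp add: zero_list_def)

lemma subspace_env_ideal: "subspace class_ring (env_ideal L) free_alg"
proof -
  interpret I: ideal "env_ideal L" free_alg by (rule ideal_env_ideal)
  show ?thesis
  proof (rule T.subspaceI)
    show "env_ideal L \<subseteq> carrier free_alg" by (rule I.a_subset)
    show "\<zero>\<^bsub>free_alg\<^esub> \<in> env_ideal L" by (rule I.zero_closed)
    show "\<And>v w. \<lbrakk>v \<in> env_ideal L; w \<in> env_ideal L\<rbrakk> \<Longrightarrow> v \<oplus>\<^bsub>free_alg\<^esub> w \<in> env_ideal L"
      by (rule I.a_closed)
    fix a v assume v: "v \<in> env_ideal L"
    have "Poly_Mapping.single [] a \<in> carrier free_alg" by auto
    from I.I_l_closed[OF v this] show "a \<odot>\<^bsub>free_alg\<^esub> v \<in> env_ideal L"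
      by (simp add: scale_conv_mult)
  qed
qed

abbreviation env_class :: "('a list \<Rightarrow>\<^sub>0 complex) \<Rightarrow> ('a list \<Rightarrow>\<^sub>0 complex) set" where
  "env_class f \<equiv> env_ideal L +>\<^bsub>free_alg\<^esub> f"

lemma env_class_eq_iff:
  "\<lbrakk>f \<in> carrier free_alg; g \<in> carrier free_alg\<rbrakk> \<Longrightarrow> env_class f = env_class g \<longleftrightarrow> f - g \<in> env_ideal L"
  using T.coset_eq_iff[OF subspace_env_ideal, of f g] by (simp add: scale_minus_1)

lemma env_carrierI: "f \<in> carrier free_alg \<Longrightarrow> env_class f \<in> carrier (env_algebra L)"
  unfolding env_algebra_def by (rule T.quot_carrierI[OF subspace_env_ideal])

lemma env_carrierE:
  assumes "u \<in> carrier (env_algebra L)"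
  obtains f where "f \<in> carrier free_alg" "u = env_class f"
  using T.quot_carrierE[OF subspace_env_ideal] assms unfolding env_algebra_def by blast

lemma env_add: "\<lbrakk>f \<in> carrier free_alg; g \<in> carrier free_alg\<rbrakk> \<Longrightarrow>
  env_class f \<oplus>\<^bsub>env_algebra L\<^esub> env_class g = env_class (f + g)"
  using T.quot_add[OF subspace_env_ideal, of f g] unfolding env_algebra_def by simp

lemma env_smult: "f \<in> carrier free_alg \<Longrightarrow>
  a \<odot>\<^bsub>env_algebra L\<^esub> env_class f = env_class (Poly_Mapping.map ((*) a) f)"
  using T.quot_smult[OF subspace_env_ideal, of f] unfolding env_algebra_def by simp

lemma env_mult: "\<lbrakk>f \<in> carrier free_alg; g \<in> carrier free_alg\<rbrakk> \<Longrightarrow>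
  env_class f \<otimes>\<^bsub>env_algebra L\<^esub> env_class g = env_class (f * g)"
  using ideal.rcoset_mult_add[OF ideal_env_ideal, of f g]
  unfolding env_algebra_def by (simp add: quot_module_def ring.defs module.defs FactRing_def)

lemma env_of_eq: "env_of L x = env_class (word [x])"
  by (simp add: env_of_def)

end

section \<open>Descent of the functional to the enveloping algebra\<close>

context induced_character
begin

text \<open>The kernel of the functional need not be an ideal, so it is replaced by
  \<open>J\<close>, the largest two-sided ideal inside it. The defining relations lie in
  \<open>J\<close> because multilinearity and \<open>lam_br\<close> hold between arbitrary words
  \<open>u\<close> and \<open>v\<close>.\<close>

lemma lin_eval_lam_ideal:
  assumes "f \<in> env_ideal L"
  shows "lin_eval lam f = 0"
proof -
  define J where "J = {f \<in> carrier free_alg. \<forall>u\<in>lists (carrier L). \<forall>v\<in>lists (carrier L).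
    lin_eval (\<lambda>w. lam (u @ w @ v)) f = 0}"
  interpret T: ring free_alg by (rule ring_free_alg)
  have l: "g * f \<in> J" if f: "f \<in> J" and g: "Poly_Mapping.keys g \<subseteq> lists (carrier L)" for f g
    using g
  proof (induction g rule: free_space_induct)
    case zero
    then show ?case by (simp add: J_def)
  next
    case (add g g')
    then show ?case using T.add.m_closed[of "g * f" "g' * f"] by (auto simp: J_def distrib_right)
  next
    case (single w a)
    have "Poly_Mapping.single w a \<in> carrier free_alg" using single by auto
    with f have "Poly_Mapping.single w a * f \<in> carrier free_alg" by (intro T_mult) (auto simp: J_def)
    moreover have "lin_eval (\<lambda>w. lam (u @ w @ v)) (Poly_Mapping.single w a * f) = 0"
      if "u \<in> lists (carrier L)" "v \<in> lists (carrier L)" for u v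
    proof -
      have "u @ w \<in> lists (carrier L)" using that single by auto
      then have "lin_eval (\<lambda>z. lam ((u @ w) @ z @ v)) f = 0" using f that unfolding J_def by blast
      then show ?thesis by (simp add: lin_eval_single_mult)
    qed
    ultimately show ?case unfolding J_def by blast
  qed
  have r: "f * g \<in> J" if f: "f \<in> J" and g: "Poly_Mapping.keys g \<subseteq> lists (carrier L)" for f g
    using g
  proof (induction g rule: free_space_induct)
    case zero
    then show ?case by (simp add: J_def)
  next
    case (add g g')
    then show ?case using T.add.m_closed[of "f * g" "f * g'"] by (auto simp: J_def distrib_left)
  next
    case (single w a)
    have "Poly_Mapping.single w a \<in> carrier free_alg" using single by auto
    with f have "f * Poly_Mapping.single w a \<in> carrier free_alg" by (intro T_mult) (auto simp: J_def)
    moreover have "lin_eval (\<lambda>w. lam (u @ w @ v)) (f * Poly_Mapping.single w a) = 0"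
      if "u \<in> lists (carrier L)" "v \<in> lists (carrier L)" for u v
    proof -
      have "w @ v \<in> lists (carrier L)" using that single by auto
      then have "lin_eval (\<lambda>z. lam (u @ z @ w @ v)) f = 0" using f that unfolding J_def by blast
      then show ?thesis by (simp add: lin_eval_mult_single)
    qed
    ultimately show ?case unfolding J_def by blast
  qed
  have "ideal J free_alg"
  proof (rule idealI[OF ring_free_alg])
    show "subgroup J (add_monoid free_alg)"
    proof (rule T.add.subgroupI)
      show "J \<noteq> {}" using l[of _ 0] by (auto simp: J_def intro: exI[of _ 0])
      fix f g assume f: "f \<in> J" and g: "g \<in> J"
      show "f \<oplus>\<^bsub>free_alg\<^esub> g \<in> J"
        using f g T.add.m_closed[of f g] by (auto simp: J_def)
      have "Poly_Mapping.single [] (-1::complex) * f \<in> J"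
        by (rule l[OF f]) auto
      then have "- f \<in> J" by (simp flip: scale_conv_mult add: scale_minus_1)
      then show "\<ominus>\<^bsub>free_alg\<^esub> f \<in> J"
        using f by (simp add: T.uminus_smult J_def scale_minus_1)
    qed (auto simp: J_def)
  qed (use l r in auto)
  moreover have "env_relations L \<subseteq> J"
  proof
    fix f assume f: "f \<in> env_relations L"
    note m = multilinear_add[OF multilinear_lam] multilinear_smult[OF multilinear_lam]
    have "lin_eval (\<lambda>w. lam (u @ w @ v)) f = 0"
      if uv: "u \<in> lists (carrier L)" "v \<in> lists (carrier L)" for u v
      using f lam_br[OF uv] unfolding env_relations_def
      by (auto simp: m[OF uv])
    then show "f \<in> J" using f env_relations_T unfolding J_def by blast
  qed
  ultimately have "env_ideal L \<subseteq> J"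
    unfolding env_ideal_def by (rule ring.genideal_minimal[OF ring_free_alg])
  then have "f \<in> J" using assms by blast
  then have "\<forall>u\<in>lists (carrier L). \<forall>v\<in>lists (carrier L). lin_eval (\<lambda>w. lam (u @ w @ v)) f = 0"
    unfolding J_def by blast
  then have "lin_eval (\<lambda>w. lam ([] @ w @ [])) f = 0" by blast
  then show ?thesis by simp
qed

end

subsection \<open>The induced module\<close>

lemma complex_space_simps [simp]:
  "carrier complex_space = UNIV" "add complex_space = (+)" "zero complex_space = 0"
  "smult complex_space = (*)"
  by (simp_all add: complex_space_def ring.defs module.defs)

lemma scale_zero [simp]: "Poly_Mapping.map ((*) (a::complex)) 0 = 0"
  by (rule poly_mapping_eqI) simp

context induced_character
begin

abbreviation "U \<equiv> env_algebra L"
abbreviation "hact \<equiv> (\<lambda>x z. \<psi> x * (z::complex))"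
abbreviation "Pre \<equiv> induced_pre_space L complex_space"
abbreviation "Rels \<equiv> induced_relations L H complex_space hact"
abbreviation "Ker \<equiv> induced_kernel L H complex_space hact"
abbreviation "Ind \<equiv> induced_space L H complex_space hact"
abbreviation "ind_act \<equiv> induced_act L H complex_space hact"

lemma env_of_U: "x \<in> carrier L \<Longrightarrow> env_of L x \<in> carrier U"
  unfolding env_of_eq by (intro env_carrierI word_T) auto

lemma U_closed:
  shows "\<lbrakk>u \<in> carrier U; u' \<in> carrier U\<rbrakk> \<Longrightarrow> u \<oplus>\<^bsub>U\<^esub> u' \<in> carrier U"
    and "\<lbrakk>u \<in> carrier U; u' \<in> carrier U\<rbrakk> \<Longrightarrow> u \<otimes>\<^bsub>U\<^esub> u' \<in> carrier U"
    and "u \<in> carrier U \<Longrightarrow> a \<odot>\<^bsub>U\<^esub> u \<in> carrier U"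
  using T.a_closed T_mult T.smult_cl
  by (auto elim!: env_carrierE simp del: monoid_algebra_simps(1) simp: env_add env_mult env_smult intro!: env_carrierI)

lemma carrier_Pre: "carrier Pre = {f. Poly_Mapping.keys f \<subseteq> carrier U \<times> UNIV}"
  by (simp add: induced_pre_space_def)

lemma Pre_simps [simp]:
  "add Pre = (+)" "zero Pre = 0" "smult Pre = (\<lambda>a. Poly_Mapping.map ((*) a))"
  by (simp_all add: induced_pre_space_def)

sublocale P: cvectorspace Pre
  unfolding induced_pre_space_def by (rule cvectorspace_free_space)

lemma single_Pre: "u \<in> carrier U \<Longrightarrow> Poly_Mapping.single (u, z) a \<in> carrier Pre"
  by (auto simp: carrier_Pre)

lemma pair_Pre: "u \<in> carrier U \<Longrightarrow> pair u z \<in> carrier Pre"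
  by (simp add: pair_def single_Pre)

lemma diff_Pre: "f \<in> carrier Pre \<Longrightarrow> g \<in> carrier Pre \<Longrightarrow> f - g \<in> carrier Pre"
  using keys_diff[of f g] by (auto simp: carrier_Pre)

lemma induced_relations_cases:
  assumes "r \<in> Rels"
    and "\<And>u u' z. \<lbrakk>u \<in> carrier U; u' \<in> carrier U\<rbrakk> \<Longrightarrow> Q (pair (u \<oplus>\<^bsub>U\<^esub> u') z - pair u z - pair u' z)"
    and "\<And>u z z'. u \<in> carrier U \<Longrightarrow> Q (pair u (z + z') - pair u z - pair u z')"
    and "\<And>a u z. u \<in> carrier U \<Longrightarrow> Q (pair (a \<odot>\<^bsub>U\<^esub> u) z - Poly_Mapping.single (u, z) a)"
    and "\<And>a u z. u \<in> carrier U \<Longrightarrow> Q (pair u (a * z) - Poly_Mapping.single (u, z) a)"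
    and "\<And>u h z. \<lbrakk>u \<in> carrier U; h \<in> H\<rbrakk> \<Longrightarrow> Q (pair (u \<otimes>\<^bsub>U\<^esub> env_of L h) z - pair u (\<psi> h * z))"
  shows "Q r"
  using assms(1) unfolding induced_relations_def Let_def by (auto intro: assms(2-))

lemma induced_relationsI:
  shows "\<lbrakk>u \<in> carrier U; u' \<in> carrier U\<rbrakk> \<Longrightarrow> pair (u \<oplus>\<^bsub>U\<^esub> u') z - pair u z - pair u' z \<in> Rels"
    and "u \<in> carrier U \<Longrightarrow> pair u (z + z') - pair u z - pair u z' \<in> Rels"
    and "u \<in> carrier U \<Longrightarrow> pair (a \<odot>\<^bsub>U\<^esub> u) z - Poly_Mapping.single (u, z) a \<in> Rels"
    and "u \<in> carrier U \<Longrightarrow> pair u (a * z) - Poly_Mapping.single (u, z) a \<in> Rels"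
    and "\<lbrakk>u \<in> carrier U; h \<in> H\<rbrakk> \<Longrightarrow> pair (u \<otimes>\<^bsub>U\<^esub> env_of L h) z - pair u (\<psi> h * z) \<in> Rels"
  unfolding induced_relations_def Let_def complex_space_simps by blast+

lemma relations_Pre: "Rels \<subseteq> carrier Pre"
proof
  fix r assume "r \<in> Rels"
  then show "r \<in> carrier Pre"
    by (rule induced_relations_cases)
       (use H_sub in \<open>auto intro!: diff_Pre pair_Pre single_Pre U_closed env_of_U\<close>)
qed

lemma subspace_Ker: "subspace class_ring Ker Pre"
  unfolding induced_kernel_def by (rule P.cspan_subspace[OF relations_Pre])

lemma relations_Ker: "r \<in> Rels \<Longrightarrow> r \<in> Ker"
  unfolding induced_kernel_def by (rule P.cspan_mem[OF relations_Pre])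

lemma Ker_least:
  assumes "\<And>r. r \<in> Rels \<Longrightarrow> r \<in> N" and "subspace class_ring N Pre"
  shows "Ker \<subseteq> N"
  unfolding induced_kernel_def using assms by (intro P.cspan_least) auto

abbreviation ind_class where "ind_class f \<equiv> Ker +>\<^bsub>Pre\<^esub> f"

lemma ind_class_eq: "\<lbrakk>f \<in> carrier Pre; g \<in> carrier Pre; f - g \<in> Ker\<rbrakk> \<Longrightarrow> ind_class f = ind_class g"
  using P.coset_eq_iff[OF subspace_Ker, of f g] by (simp add: scale_minus_1)

lemma ind_add: "\<lbrakk>f \<in> carrier Pre; g \<in> carrier Pre\<rbrakk> \<Longrightarrow> ind_class f \<oplus>\<^bsub>Ind\<^esub> ind_class g = ind_class (f + g)"
  using P.quot_add[OF subspace_Ker, of f g] by (simp add: induced_space_def)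

lemma ind_smult: "f \<in> carrier Pre \<Longrightarrow> a \<odot>\<^bsub>Ind\<^esub> ind_class f = ind_class (Poly_Mapping.map ((*) a) f)"
  using P.quot_smult[OF subspace_Ker, of f a] by (simp add: induced_space_def)

lemma cvectorspace_Ind: "cvectorspace Ind"
  unfolding induced_space_def by (rule P.quot_cvectorspace[OF subspace_Ker])

sublocale Ind: cvectorspace Ind
  by (rule cvectorspace_Ind)

lemma ind_classI: "f \<in> carrier Pre \<Longrightarrow> ind_class f \<in> carrier Ind"
  using P.quot_carrierI[OF subspace_Ker, of f] by (simp add: induced_space_def)

text \<open>The tensor of the class of \<open>f\<close> with the basis vector 1. As the inducing
  module is one-dimensional, these elements exhaust the induced module
  (\<open>tens_surj\<close>).\<close>

definition tens :: "('a list \<Rightarrow>\<^sub>0 complex) \<Rightarrow> ('a, complex) induced_pre set" where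
  "tens f = ind_class (pair (env_class f) 1)"

lemma tens_closed [simp, intro]: "f \<in> carrier free_alg \<Longrightarrow> tens f \<in> carrier Ind"
  unfolding tens_def by (intro ind_classI pair_Pre env_carrierI)

lemma tens_cong: "\<lbrakk>f \<in> carrier free_alg; g \<in> carrier free_alg; f - g \<in> env_ideal L\<rbrakk> \<Longrightarrow> tens f = tens g"
  unfolding tens_def by (simp only: env_class_eq_iff[THEN iffD2])

lemma tens_add:
  assumes "f \<in> carrier free_alg" "g \<in> carrier free_alg"
  shows "tens (f + g) = tens f \<oplus>\<^bsub>Ind\<^esub> tens g"
proof -
  let ?u = "env_class f" and ?v = "env_class g"
  have u: "?u \<in> carrier U" "?v \<in> carrier U" using assms by (auto intro!: env_carrierI)
  have "pair (?u \<oplus>\<^bsub>U\<^esub> ?v) 1 - pair ?u 1 - pair ?v 1 \<in> Ker"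
    by (intro relations_Ker induced_relationsI u)
  then have "ind_class (pair (?u \<oplus>\<^bsub>U\<^esub> ?v) 1) = ind_class (pair ?u 1 + pair ?v 1)"
    by (intro ind_class_eq pair_Pre P.a_closed[simplified] U_closed u) (simp add: algebra_simps)
  then show ?thesis
    by (simp add: tens_def ind_add pair_Pre u env_add assms[simplified])
qed

text \<open>Both the coefficient \<open>a\<close> and the vector \<open>z\<close> of the
  one-dimensional module are moved into the enveloping algebra factor.\<close>

lemma pair_1:
  assumes "f \<in> carrier free_alg"
  shows "ind_class (Poly_Mapping.single (env_class f, z) a) = tens (Poly_Mapping.map ((*) (a * z)) f)"
proof -
  let ?u = "env_class f"
  have u: "?u \<in> carrier U" using assms by (auto intro!: env_carrierI)
  have 1: "pair ?u (a * z * 1) - Poly_Mapping.single (?u, 1) (a * z) \<in> Ker"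
    by (intro relations_Ker induced_relationsI u)
  have 2: "pair ((a * z) \<odot>\<^bsub>U\<^esub> ?u) 1 - Poly_Mapping.single (?u, 1) (a * z) \<in> Ker"
    by (intro relations_Ker induced_relationsI u)
  have 3: "pair ?u (a * z) - Poly_Mapping.single (?u, z) a \<in> Ker"
    by (intro relations_Ker induced_relationsI u)
  have "ind_class (Poly_Mapping.single (?u, z) a) = ind_class (pair ?u (a * z))"
    using 3 by (intro ind_class_eq[symmetric] pair_Pre single_Pre u)
  also have "\<dots> = ind_class (Poly_Mapping.single (?u, 1) (a * z))"
    using 1 by (intro ind_class_eq pair_Pre single_Pre u) simp
  also have "\<dots> = ind_class (pair ((a * z) \<odot>\<^bsub>U\<^esub> ?u) 1)"
    using 2 by (intro ind_class_eq[symmetric] pair_Pre single_Pre u U_closed)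
  finally show ?thesis
    using assms by (simp add: tens_def env_smult)
qed

lemma tens_smult:
  assumes "f \<in> carrier free_alg"
  shows "tens (Poly_Mapping.map ((*) a) f) = a \<odot>\<^bsub>Ind\<^esub> tens f"
proof -
  have u: "env_class f \<in> carrier U" using assms by (auto intro!: env_carrierI)
  have "a \<odot>\<^bsub>Ind\<^esub> tens f = ind_class (Poly_Mapping.single (env_class f, 1) a)"
    unfolding tens_def using pair_Pre[OF u] by (simp add: ind_smult pair_def scale_single)
  then show ?thesis using pair_1[OF assms, of 1 a] by simp
qed

lemma tens_surj:
  assumes "v \<in> carrier Ind"
  obtains f where "f \<in> carrier free_alg" "v = tens f"
proof -
  obtain g where g: "g \<in> carrier Pre" "v = ind_class g"
    using P.quot_carrierE[OF subspace_Ker] assms unfolding induced_space_def by blast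
  have "\<exists>f\<in>carrier free_alg. ind_class g = tens f"
    using g(1) unfolding carrier_Pre mem_Collect_eq
  proof (induction g rule: free_space_induct)
    case zero
    have "ind_class 0 = ind_class (Poly_Mapping.single (env_class 0, 1) 0)" by simp
    also have "\<dots> = tens (Poly_Mapping.map ((*) (0 * 1)) 0)" by (rule pair_1) simp
    finally show ?case by (intro bexI[of _ 0]) simp_all
  next
    case (add f g)
    then obtain f' g' where "f' \<in> carrier free_alg" "g' \<in> carrier free_alg"
      "ind_class f = tens f'" "ind_class g = tens g'" by blast
    moreover have "ind_class (f + g) = ind_class f \<oplus>\<^bsub>Ind\<^esub> ind_class g"
      using add by (simp add: ind_add carrier_Pre)
    ultimately have "ind_class (f + g) = tens (f' + g')" "f' + g' \<in> carrier free_alg"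
      using tens_add T.a_closed[of f' g'] by simp_all
    then show ?case by blast
  next
    case (single x a)
    then obtain u z where x: "x = (u, z)" "u \<in> carrier U" by (cases x) auto
    obtain f where f: "f \<in> carrier free_alg" "u = env_class f" using env_carrierE[OF x(2)] .
    show ?case using pair_1[OF f(1), of z a] f x T.smult_cl[OF f(1), of "a * z"] by auto
  qed
  then show ?thesis using that g by blast
qed

lemma tens_H:
  assumes "f \<in> carrier free_alg" "h \<in> H"
  shows "tens (f * word [h]) = \<psi> h \<odot>\<^bsub>Ind\<^esub> tens f"
proof -
  let ?u = "env_class f"
  have u: "?u \<in> carrier U" using assms by (auto intro!: env_carrierI)
  have h: "h \<in> carrier L" "word [h] \<in> carrier free_alg" using assms(2) H_sub by (auto intro!: word_T simp del: monoid_algebra_simps)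
  have "pair (?u \<otimes>\<^bsub>U\<^esub> env_of L h) 1 - pair ?u (\<psi> h * 1) \<in> Ker"
    by (intro relations_Ker induced_relationsI u assms)
  then have "ind_class (pair (?u \<otimes>\<^bsub>U\<^esub> env_of L h) 1) = ind_class (pair ?u (\<psi> h * 1))"
    by (intro ind_class_eq pair_Pre U_closed u env_of_U h)
  also have "ind_class (pair (?u \<otimes>\<^bsub>U\<^esub> env_of L h) 1) = tens (f * word [h])"
    unfolding env_of_eq env_mult[OF assms(1) h(2)] tens_def ..
  also have "ind_class (pair ?u (\<psi> h * 1)) = \<psi> h \<odot>\<^bsub>Ind\<^esub> tens f"
    unfolding pair_def pair_1[OF assms(1)] using tens_smult[OF assms(1)] by simp
  finally show ?thesis .
qed

lemma U_distrib:
  assumes "u \<in> carrier U" "u' \<in> carrier U" "x \<in> carrier U"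
  shows "x \<otimes>\<^bsub>U\<^esub> (u \<oplus>\<^bsub>U\<^esub> u') = x \<otimes>\<^bsub>U\<^esub> u \<oplus>\<^bsub>U\<^esub> x \<otimes>\<^bsub>U\<^esub> u'"
    and "x \<otimes>\<^bsub>U\<^esub> (a \<odot>\<^bsub>U\<^esub> u) = a \<odot>\<^bsub>U\<^esub> (x \<otimes>\<^bsub>U\<^esub> u)"
    and "x \<otimes>\<^bsub>U\<^esub> (u \<otimes>\<^bsub>U\<^esub> u') = (x \<otimes>\<^bsub>U\<^esub> u) \<otimes>\<^bsub>U\<^esub> u'"
proof -
  obtain f where f: "f \<in> carrier free_alg" "u = env_class f" using env_carrierE[OF assms(1)] .
  obtain g where g: "g \<in> carrier free_alg" "u' = env_class g" using env_carrierE[OF assms(2)] .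
  obtain h where h: "h \<in> carrier free_alg" "x = env_class h" using env_carrierE[OF assms(3)] .
  note e = f g h
  note cl = T_mult[of f g] T_mult[of h f] T_mult[of h g] T.a_closed[of f g] T.smult_cl[of f a]
  show "x \<otimes>\<^bsub>U\<^esub> (u \<oplus>\<^bsub>U\<^esub> u') = x \<otimes>\<^bsub>U\<^esub> u \<oplus>\<^bsub>U\<^esub> x \<otimes>\<^bsub>U\<^esub> u'"
    using e cl by (simp add: env_add env_mult distrib_left)
  show "x \<otimes>\<^bsub>U\<^esub> (u \<otimes>\<^bsub>U\<^esub> u') = (x \<otimes>\<^bsub>U\<^esub> u) \<otimes>\<^bsub>U\<^esub> u'"
    using e cl by (simp add: env_mult mult.assoc)
  have "h * Poly_Mapping.map ((*) a) f = Poly_Mapping.map ((*) a) (h * f)"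
  proof -
    have "Poly_Mapping.keys h \<subseteq> UNIV" "Poly_Mapping.keys f \<subseteq> UNIV" by auto
    then show ?thesis
    proof (induction h rule: free_space_induct)
      case (single x b)
      from \<open>Poly_Mapping.keys f \<subseteq> UNIV\<close> show ?case
        by (induction f rule: free_space_induct) (simp_all add: scale_add distrib_left mult_single scale_single mult.left_commute)
    qed (simp_all add: distrib_right scale_add)
  qed
  then show "x \<otimes>\<^bsub>U\<^esub> (a \<odot>\<^bsub>U\<^esub> u) = a \<odot>\<^bsub>U\<^esub> (x \<otimes>\<^bsub>U\<^esub> u)"
    using e cl by (simp add: env_smult env_mult)
qed

text \<open>Left multiplication by \<open>env_of L x\<close> sends each defining relation of the
  tensor product to a relation of the same kind, so it preserves \<open>Ker\<close> and the induced
  action can be computed on representatives.\<close>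

lemma ind_act_tens:
  assumes x: "x \<in> carrier L" and f: "f \<in> carrier free_alg"
  shows "ind_act x (tens f) = tens (word [x] * f)"
proof -
  define m where "m = (\<lambda>(u, w::complex). (env_of L x \<otimes>\<^bsub>U\<^esub> u, w))"
  have mP: "lin_ext m g \<in> carrier Pre" if "g \<in> carrier Pre" for g
    using keys_lin_ext[of m g] that U_closed(2)[OF env_of_U[OF x]] by (fastforce simp: carrier_Pre m_def)
  have m: "m (u, w) = (env_of L x \<otimes>\<^bsub>U\<^esub> u, w)" for u w by (simp add: m_def)
  have lin_ext_pair: "lin_ext m (pair u w) = pair (env_of L x \<otimes>\<^bsub>U\<^esub> u) w" for u w by (simp add: m_def pair_def)
  note xU = env_of_U[OF x]
  have "Ker \<subseteq> {g \<in> carrier Pre. lin_ext m g \<in> Ker}"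
  proof (rule Ker_least)
    fix r assume r: "r \<in> Rels"
    then have "lin_ext m r \<in> Rels"
    proof (rule induced_relations_cases[where Q = "\<lambda>r. lin_ext m r \<in> Rels"])
      fix u u' z assume "u \<in> carrier U" "u' \<in> carrier U"
      then show "lin_ext m (pair (u \<oplus>\<^bsub>U\<^esub> u') z - pair u z - pair u' z) \<in> Rels"
        using U_closed(2)[OF xU] by (simp add: lin_ext_pair m U_distrib xU induced_relationsI)
    next
      fix u z z' assume "u \<in> carrier U"
      then show "lin_ext m (pair u (z + z') - pair u z - pair u z') \<in> Rels"
        using U_closed(2)[OF xU] by (simp add: lin_ext_pair m U_distrib xU induced_relationsI)
    next
      fix a u z assume "u \<in> carrier U"
      then show "lin_ext m (pair (a \<odot>\<^bsub>U\<^esub> u) z - Poly_Mapping.single (u, z) a) \<in> Rels"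
        using U_closed(2)[OF xU] by (simp add: lin_ext_pair m U_distrib(2)[OF _ _ xU] induced_relationsI)
    next
      fix a u z assume "u \<in> carrier U"
      then show "lin_ext m (pair u (a * z) - Poly_Mapping.single (u, z) a) \<in> Rels"
        using U_closed(2)[OF xU] by (simp add: lin_ext_pair m U_distrib xU induced_relationsI)
    next
      fix u h z assume u: "u \<in> carrier U" "h \<in> H"
      then have "h \<in> carrier L" using H_sub by blast
      then show "lin_ext m (pair (u \<otimes>\<^bsub>U\<^esub> env_of L h) z - pair u (\<psi> h * z)) \<in> Rels"
        using u U_closed(2)[OF xU] by (simp add: lin_ext_pair U_distrib(3) env_of_U xU induced_relationsI)
    qed
    then show "r \<in> {g \<in> carrier Pre. lin_ext m g \<in> Ker}"
      using relations_Ker relations_Pre r by blast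
  next
    note c = P.subspace_add[OF subspace_Ker] P.subspace_smult[OF subspace_Ker] P.a_closed P.smult_cl
    show "subspace class_ring {g \<in> carrier Pre. lin_ext m g \<in> Ker} Pre"
      by (rule P.subspaceI) (use c P.subspace_0[OF subspace_Ker] P.zero_closed in auto)
  qed
  moreover have fU: "env_class f \<in> carrier U" using f by (intro env_carrierI)
  ultimately have "ind_act x (tens f) = ind_class (lin_ext m (pair (env_class f) 1))"
    unfolding induced_act_def tens_def m_def[symmetric]
    by (intro P.quot_map_coset[OF subspace_Ker]) (auto intro!: mP pair_Pre)
  also have "lin_ext m (pair (env_class f) 1) = pair (env_class (word [x] * f)) 1"
    using f x word_T[of "[x]"] by (simp add: pair_def m env_of_eq env_mult)
  finally show ?thesis by (simp add: tens_def)
qed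

lemma env_relationsI:
  shows "\<lbrakk>x \<in> carrier L; y \<in> carrier L\<rbrakk> \<Longrightarrow> word [x \<oplus> y] - word [x] - word [y] \<in> env_relations L"
    and "x \<in> carrier L \<Longrightarrow> word [a \<odot> x] - Poly_Mapping.single [x] a \<in> env_relations L"
    and "\<lbrakk>x \<in> carrier L; y \<in> carrier L\<rbrakk> \<Longrightarrow> word [x, y] - word [y, x] - word [lie_br L x y] \<in> env_relations L"
  unfolding env_relations_def by blast+

lemma tens_rel:
  assumes "r \<in> env_relations L" and f: "f \<in> carrier free_alg"
  shows "r * f \<in> env_ideal L"
  using ideal.I_r_closed[OF ideal_env_ideal, of r f] env_relations_ideal assms by auto

text \<open>The laws in the Lie algebra argument are the three families of relations of the
  enveloping algebra, multiplied on the right by a representative \<open>f\<close> of the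
  vector.\<close>

lemma lie_module_Ind: "lie_module L Ind ind_act"
proof unfold_locales
  fix x y v a assume x: "x \<in> carrier L" and y: "y \<in> carrier L" and v: "v \<in> carrier Ind"
  obtain f where f: "f \<in> carrier free_alg" "v = tens f" using tens_surj[OF v] .
  have w: "word [x] \<in> carrier free_alg" "word [y] \<in> carrier free_alg" "word [x \<oplus> y] \<in> carrier free_alg"
    "word [a \<odot> x] \<in> carrier free_alg" "word [lie_br L x y] \<in> carrier free_alg"
    using x y by (auto intro!: word_T br_closed simp del: monoid_algebra_simps)
  note cl = T_mult[OF w(1) f(1)] T_mult[OF w(2) f(1)] T_mult[OF w(3) f(1)] T_mult[OF w(4) f(1)] T_mult[OF w(5) f(1)]
  show c: "ind_act x v \<in> carrier Ind"
    using f x cl by (simp add: ind_act_tens del: monoid_algebra_simps)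
  have "tens (word [x \<oplus> y] * f) = tens (word [x] * f + word [y] * f)"
  proof (rule tens_cong)
    have "(word [x \<oplus> y] - word [x] - word [y]) * f \<in> env_ideal L"
      by (rule tens_rel[OF _ f(1)], rule env_relationsI(1)[OF x y])
    then show "word [x \<oplus> y] * f - (word [x] * f + word [y] * f) \<in> env_ideal L" by (simp add: algebra_simps)
  qed (use cl T.a_closed[OF cl(1,2)] in auto)
  then show "ind_act (x \<oplus> y) v = ind_act x v \<oplus>\<^bsub>Ind\<^esub> ind_act y v"
    using f x y cl by (simp add: ind_act_tens tens_add)
  have "tens (word [a \<odot> x] * f) = tens (Poly_Mapping.map ((*) a) (word [x] * f))"
  proof (rule tens_cong)
    have "(word [a \<odot> x] - Poly_Mapping.single [x] a) * f \<in> env_ideal L"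
      by (rule tens_rel[OF _ f(1)], rule env_relationsI(2)[OF x])
    moreover have "Poly_Mapping.single [x] a = Poly_Mapping.single [] a * word [x]"
      by (simp add: word_def mult_single plus_list_def)
    ultimately show "word [a \<odot> x] * f - Poly_Mapping.map ((*) a) (word [x] * f) \<in> env_ideal L"
      by (simp add: algebra_simps scale_conv_mult mult.assoc)
  qed (use cl T.smult_cl[OF cl(1)] in auto)
  then show "ind_act (a \<odot> x) v = a \<odot>\<^bsub>Ind\<^esub> ind_act x v"
    using f x y cl by (simp add: ind_act_tens tens_smult)
  have xy: "word [x] * (word [y] * f) \<in> carrier free_alg" "word [y] * (word [x] * f) \<in> carrier free_alg"
    by (rule T_mult[OF w(1) cl(2)], rule T_mult[OF w(2) cl(1)])
  have "tens (word [lie_br L x y] * f) = tens (word [x] * (word [y] * f) + Poly_Mapping.map ((*) (-1)) (word [y] * (word [x] * f)))"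
  proof (rule tens_cong)
    have "(word [x, y] - word [y, x] - word [lie_br L x y]) * f \<in> env_ideal L"
      by (rule tens_rel[OF _ f(1)], rule env_relationsI(3)[OF x y])
    then have "Poly_Mapping.map ((*) (-1)) ((word [x, y] - word [y, x] - word [lie_br L x y]) * f) \<in> env_ideal L"
      using T.subspace_smult[OF subspace_env_ideal, of _ "-1"] by simp
    moreover have "word [x, y] = word [x] * word [y]" "word [y, x] = word [y] * word [x]"
      by (simp_all flip: word_append)
    ultimately show "word [lie_br L x y] * f - (word [x] * (word [y] * f) + Poly_Mapping.map ((*) (-1)) (word [y] * (word [x] * f))) \<in> env_ideal L"
      unfolding scale_minus_1 by (simp only: left_diff_distrib mult.assoc minus_diff_eq diff_diff_eq2 add_uminus_conv_diff)
  qed (use cl T.a_closed[OF xy(1) T.smult_cl[OF xy(2)]] in auto)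
  then have "ind_act (lie_br L x y) v = ind_act x (ind_act y v) \<oplus>\<^bsub>Ind\<^esub> (-1) \<odot>\<^bsub>Ind\<^esub> ind_act y (ind_act x v)"
    using f x y cl xy T.smult_cl[OF xy(2), of "-1"] by (simp add: ind_act_tens br_closed tens_add tens_smult)
  moreover have "ind_act x (ind_act y v) \<in> carrier Ind" "ind_act y (ind_act x v) \<in> carrier Ind"
    using f x y cl xy by (simp_all add: ind_act_tens)
  ultimately show "ind_act (lie_br L x y) v = ind_act x (ind_act y v) \<ominus>\<^bsub>Ind\<^esub> ind_act y (ind_act x v)"
    by (simp add: Ind.minus_smult)
next
  fix x v w a assume x: "x \<in> carrier L" and v: "v \<in> carrier Ind" and w: "w \<in> carrier Ind"
  obtain f where f: "f \<in> carrier free_alg" "v = tens f" using tens_surj[OF v] .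
  obtain g where g: "g \<in> carrier free_alg" "w = tens g" using tens_surj[OF w] .
  have "word [x] \<in> carrier free_alg" using x by (auto intro!: word_T simp del: monoid_algebra_simps)
  note cl = T_mult[OF this f(1)] T_mult[OF this g(1)]
  show "ind_act x (v \<oplus>\<^bsub>Ind\<^esub> w) = ind_act x v \<oplus>\<^bsub>Ind\<^esub> ind_act x w"
    using f g cl T.a_closed[OF f(1) g(1)] x by (simp flip: tens_add add: ind_act_tens distrib_left)
next
  fix x v a assume x: "x \<in> carrier L" and v: "v \<in> carrier Ind"
  obtain f where f: "f \<in> carrier free_alg" "v = tens f" using tens_surj[OF v] .
  have "word [x] \<in> carrier free_alg" using x by (auto intro!: word_T simp del: monoid_algebra_simps)
  note cl = T_mult[OF this f(1)]
  have "word [x] * Poly_Mapping.map ((*) a) f = Poly_Mapping.map ((*) a) (word [x] * f)"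
    by (simp add: scale_conv_mult word_def mult_single plus_list_def flip: mult.assoc)
  then show "ind_act x (a \<odot>\<^bsub>Ind\<^esub> v) = a \<odot>\<^bsub>Ind\<^esub> ind_act x v"
    using f cl T.smult_cl[OF f(1), of a] x by (simp flip: tens_smult add: ind_act_tens)
qed

lemma one_free_alg: "1 \<in> carrier free_alg"
  using word_T[of "[]"] by (simp add: word_Nil)

lemma ind_act_H: "h \<in> H \<Longrightarrow> ind_act h (tens 1) = \<psi> h \<odot>\<^bsub>Ind\<^esub> tens 1"
  using ind_act_tens[of h 1] tens_H[of 1 h] one_free_alg H_sub by auto

lemma ind_generated:
  assumes N: "lie_submodule L Ind ind_act N" and 1: "tens 1 \<in> N"
  shows "N = carrier Ind"
proof -
  interpret M: lie_module L Ind ind_act by (rule lie_module_Ind)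
  note S = M.submodule_subspace[OF N]
  have w: "tens (word w) \<in> N" if "w \<in> lists (carrier L)" for w
    using that
  proof (induction w rule: lists.induct)
    case Nil
    then show ?case using 1 by (simp add: word_Nil)
  next
    case (Cons x w)
    then have "tens (word (x # w)) = ind_act x (tens (word w))"
      using ind_act_tens[of x "word w"] word_T[of w] word_append[of "[x]" w] by simp
    then show ?case using M.submodule_act[OF N] Cons by simp
  qed
  have "tens f \<in> N" if "f \<in> carrier free_alg" for f
    using that unfolding monoid_algebra_simps mem_Collect_eq
  proof (induction f rule: free_space_induct)
    case zero
    have "tens 0 = 0 \<odot>\<^bsub>Ind\<^esub> tens 0" using tens_smult[of 0 0] by simp
    also have "\<dots> \<in> N" using Ind.subspace_0[OF S] tens_closed[of 0] by simp
    finally show ?case .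
  next
    case (add f g)
    then show ?case using Ind.subspace_add[OF S] by (simp add: tens_add)
  next
    case (single x a)
    have "tens (Poly_Mapping.single x a) = a \<odot>\<^bsub>Ind\<^esub> tens (word x)"
      using tens_smult[OF word_T[OF single], of a] by (simp add: word_def scale_single)
    then show ?case using Ind.subspace_smult[OF S w[OF single]] by simp
  qed
  then have "carrier Ind \<subseteq> N" by (auto elim!: tens_surj)
  then show ?thesis using Ind.subspace_sub[OF S] by auto
qed

text \<open>\<open>lam\<close> descends first to the enveloping algebra (\<open>lU\<close>), then to
  the tensor product (\<open>lP\<close>, \<open>l\<close>). The relation that balances over
  \<open>H\<close> is respected by \<open>lam_snoc\<close>, and the last property is
  \<open>lam_compl\<close>.\<close>

lemma ind_functional:
  obtains l where "\<And>v w. \<lbrakk>v \<in> carrier Ind; w \<in> carrier Ind\<rbrakk> \<Longrightarrow> l (v \<oplus>\<^bsub>Ind\<^esub> w) = l v + l w"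
    and "\<And>a v. v \<in> carrier Ind \<Longrightarrow> l (a \<odot>\<^bsub>Ind\<^esub> v) = a * l v"
    and "l (tens 1) = 1"
    and "\<And>x v. \<lbrakk>x \<in> carrier L; p x = \<zero>; v \<in> carrier Ind\<rbrakk> \<Longrightarrow> l (ind_act x v) = 0"
proof -
  \<comment> \<open>An arbitrary representative is chosen; \<open>lin_eval_lam_ideal\<close> makes
    the value independent of it.\<close>
  define lU where "lU u = lin_eval lam (SOME f. f \<in> carrier free_alg \<and> u = env_class f)" for u
  have lU: "lU (env_class f) = lin_eval lam f" if f: "f \<in> carrier free_alg" for f
  proof -
    let ?g = "SOME g. g \<in> carrier free_alg \<and> env_class f = env_class g"
    have g: "?g \<in> carrier free_alg \<and> env_class f = env_class ?g"
      by (rule someI[of _ f]) (use f in simp)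
    then have "f - ?g \<in> env_ideal L" using env_class_eq_iff[of f ?g] f by simp
    then have "lin_eval lam (f - ?g) = 0" by (rule lin_eval_lam_ideal)
    then show ?thesis by (simp add: lU_def)
  qed
  define lP where "lP = lin_eval (\<lambda>(u, z). z * lU u)"
  have lP0: "lP f = 0" if "f \<in> Ker" for f
  proof -
    have "Ker \<subseteq> {f \<in> carrier Pre. lP f = 0}"
    proof (rule Ker_least)
      fix r assume r: "r \<in> Rels"
      then have "lP r = 0"
      proof (rule induced_relations_cases[where Q = "\<lambda>r. lP r = 0"])
        fix u u' z assume "u \<in> carrier U" "u' \<in> carrier U"
        then show "lP (pair (u \<oplus>\<^bsub>U\<^esub> u') z - pair u z - pair u' z) = 0"
          using T.a_closed by (auto elim!: env_carrierE simp: lP_def pair_def env_add lU algebra_simps)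
      next
        fix a u z assume "u \<in> carrier U"
        then show "lP (pair (a \<odot>\<^bsub>U\<^esub> u) z - Poly_Mapping.single (u, z) a) = 0"
          using T.smult_cl by (auto elim!: env_carrierE simp: lP_def pair_def env_smult lU algebra_simps)
      next
        fix u h z assume u: "u \<in> carrier U" and h: "h \<in> H"
        obtain f where f: "f \<in> carrier free_alg" "u = env_class f" using env_carrierE[OF u] .
        have hL: "h \<in> carrier L" using h H_sub by auto
        have "lin_eval lam (f * word [h]) = \<psi> h * lin_eval lam f"
          using f(1) unfolding monoid_algebra_simps mem_Collect_eq
        proof (induction f rule: free_space_induct)
          case (single x a)
          then show ?case using lam_snoc[of x h] hL p_H[OF h]
            by (simp add: word_def lin_eval_mult_single)
        qed (simp_all add: algebra_simps)
        then show "lP (pair (u \<otimes>\<^bsub>U\<^esub> env_of L h) z - pair u (\<psi> h * z)) = 0"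
          using f hL T_mult[OF f(1) word_T[of "[h]"]] word_T[of "[h]"]
          by (simp add: lP_def pair_def env_of_eq env_mult lU)
      qed (simp_all add: lP_def pair_def algebra_simps)
      then show "r \<in> {f \<in> carrier Pre. lP f = 0}" using r relations_Pre by blast
    next
      show "subspace class_ring {f \<in> carrier Pre. lP f = 0} Pre"
        by (rule P.subspaceI) (use P.a_closed P.smult_cl P.zero_closed in \<open>auto simp: lP_def\<close>)
    qed
    then show ?thesis using that by blast
  qed
  define l where "l X = lP (SOME f. f \<in> carrier Pre \<and> X = ind_class f)" for X
  have l: "l (ind_class f) = lP f" if f: "f \<in> carrier Pre" for f
  proof -
    let ?g = "SOME g. g \<in> carrier Pre \<and> ind_class f = ind_class g"
    have g: "?g \<in> carrier Pre \<and> ind_class f = ind_class ?g"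
      by (rule someI[of _ f]) (use f in simp)
    then have "f - ?g \<in> Ker" using P.coset_eq_iff[OF subspace_Ker, of f ?g] f by (simp add: scale_minus_1)
    then have "lP (f - ?g) = 0" by (rule lP0)
    then show ?thesis by (simp add: l_def lP_def)
  qed
  have lt: "l (tens f) = lin_eval lam f" if f: "f \<in> carrier free_alg" for f
    using f pair_Pre[OF env_carrierI[OF f]] unfolding tens_def by (simp add: l lU) (simp add: lP_def pair_def lU)
  show ?thesis
  proof
    fix v w assume v: "v \<in> carrier Ind" and w: "w \<in> carrier Ind"
    obtain f where f: "f \<in> carrier free_alg" "v = tens f" using tens_surj[OF v] .
    obtain g where g: "g \<in> carrier free_alg" "w = tens g" using tens_surj[OF w] .
    show "l (v \<oplus>\<^bsub>Ind\<^esub> w) = l v + l w"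
      using f g T.a_closed[OF f(1) g(1)] by (simp add: lt flip: tens_add)
  next
    fix a v assume v: "v \<in> carrier Ind"
    obtain f where f: "f \<in> carrier free_alg" "v = tens f" using tens_surj[OF v] .
    show "l (a \<odot>\<^bsub>Ind\<^esub> v) = a * l v"
      using f T.smult_cl[OF f(1)] by (simp add: lt flip: tens_smult)
  next
    show "l (tens 1) = 1" using lt[OF one_free_alg] by (simp flip: word_Nil)
  next
    fix x v assume x: "x \<in> carrier L" "p x = \<zero>" and v: "v \<in> carrier Ind"
    obtain f where f: "f \<in> carrier free_alg" "v = tens f" using tens_surj[OF v] .
    have "lin_eval lam (word [x] * f) = 0"
      using f(1) unfolding monoid_algebra_simps mem_Collect_eq
    proof (induction f rule: free_space_induct)
      case (single w a)
      then show ?case using lam_compl[OF x, of w] by (simp add: word_def lin_eval_single_mult)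
    qed (simp_all add: distrib_left)
    then show "l (ind_act x v) = 0"
      using f x T_mult[OF word_T[of "[x]"] f(1)] by (simp add: ind_act_tens lt)
  qed
qed

end

section \<open>The loop-Virasoro Lie algebra\<close>

lemma scale_eq: "Poly_Mapping.map ((*) a) f = Poly_Mapping.single 0 (a::complex) * (f :: 'x::monoid_add \<Rightarrow>\<^sub>0 complex)"
  by (rule mult_map_scale_conv_mult)

text \<open>Scalars are written as constant Laurent polynomials, so that scalar identities become
  identities in a commutative ring.\<close>

abbreviation cst :: "complex \<Rightarrow> laurent" where
  "cst a \<equiv> Poly_Mapping.single 0 a"

lemma cst_mult: "cst a * cst b = cst (a * b)"
  by (simp add: mult_single)

lemma cst_add: "cst a + cst b = cst (a + b)"
  by (simp add: single_add)

lemma laurent_simps: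
  "carrier laurent_algebra = UNIV" "add laurent_algebra = (+)" "zero laurent_algebra = 0"
  "mult laurent_algebra = (*)" "one laurent_algebra = 1"
  "smult laurent_algebra = (\<lambda>a f. cst a * f)"
  by (simp_all add: laurent_algebra_def scale_eq fun_eq_iff)

lemma cvectorspace_laurent: "cvectorspace laurent_algebra"
  unfolding laurent_algebra_def by (rule cvectorspace_monoid_algebra)

lemma finsum_laurent: "finsum laurent_algebra f A = sum f A"
proof -
  interpret V: cvectorspace laurent_algebra by (rule cvectorspace_laurent)
  show ?thesis
    by (induction A rule: infinite_finite_induct)
       (simp_all add: laurent_simps V.finsum_infinite)
qed

lemma loop_simps:
  "carrier loop_vir = {x. finite {p. x p \<noteq> 0}}"
  "zero loop_vir = (\<lambda>p. 0)"
  "add loop_vir = (\<lambda>x y p. x p + y p)"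
  "smult loop_vir = (\<lambda>a x p. cst a * x p)"
  by (simp_all add: loop_vir_def vir_tensor_def laurent_simps)

text \<open>The supports may be enlarged to any finite sets, which gives a common index set when
  brackets of several elements are compared.\<close>

lemma loop_br:
  assumes "finite P" "{p. x p \<noteq> 0} \<subseteq> P" "finite Q" "{q. y q \<noteq> 0} \<subseteq> Q"
  shows "lie_br loop_vir x y r = (\<Sum>p\<in>P. \<Sum>q\<in>Q. cst (Poly_Mapping.lookup (vir_br p q) r) * (x p * y q))"
proof -
  have "lie_br loop_vir x y r
      = (\<Sum>p\<in>{p. x p \<noteq> 0}. \<Sum>q\<in>{q. y q \<noteq> 0}. cst (Poly_Mapping.lookup (vir_br p q) r) * (x p * y q))"
    by (simp add: loop_vir_def vir_tensor_def laurent_simps finsum_laurent)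
  also have "\<dots> = (\<Sum>p\<in>P. \<Sum>q\<in>{q. y q \<noteq> 0}. cst (Poly_Mapping.lookup (vir_br p q) r) * (x p * y q))"
    by (rule sum.mono_neutral_left) (use assms in auto)
  also have "\<dots> = (\<Sum>p\<in>P. \<Sum>q\<in>Q. cst (Poly_Mapping.lookup (vir_br p q) r) * (x p * y q))"
    by (intro sum.cong refl sum.mono_neutral_left) (use assms in auto)
  finally show ?thesis .
qed

lemma loop_br_nonzero:
  assumes "lie_br loop_vir x y r \<noteq> 0" "x \<in> carrier loop_vir" "y \<in> carrier loop_vir"
  obtains p q where "x p \<noteq> 0" "y q \<noteq> 0" "Poly_Mapping.lookup (vir_br p q) r \<noteq> 0"
proof (rule ccontr)
  assume *: "\<not> thesis"
  have "lie_br loop_vir x y r = (\<Sum>p\<in>{p. x p \<noteq> 0}. \<Sum>q\<in>{q. y q \<noteq> 0}. cst (Poly_Mapping.lookup (vir_br p q) r) * (x p * y q))"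
    using assms by (intro loop_br) (auto simp: loop_simps)
  also have "\<dots> = 0"
    by (intro sum.neutral ballI) (use * that in \<open>metis (mono_tags, lifting) mem_Collect_eq mult_zero_left single_zero\<close>)
  finally show False using assms by simp
qed

lemma cvectorspace_loop: "cvectorspace loop_vir"
  unfolding cvectorspace_def
proof (rule cvectorspaceI, unfold loop_simps mem_Collect_eq)
  fix v w :: loop_elt assume "finite {p. v p \<noteq> 0}" "finite {p. w p \<noteq> 0}"
  then show "finite {p. v p + w p \<noteq> 0}"
    by (rule finite_subset[rotated, OF finite_UnI]) auto
next
  fix a and v :: loop_elt assume "finite {p. v p \<noteq> 0}"
  then show "finite {p. cst a * v p \<noteq> 0}"
    by (rule finite_subset[rotated]) auto
next
  fix v :: loop_elt
  have "v p + cst (- 1) * v p = 0" for p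
    using cst_add[of 1 "-1"] distrib_right[of 1 "cst (- 1)" "v p"] by simp
  then show "(\<lambda>p. v p + cst (- 1) * v p) = (\<lambda>p. 0)" by simp
qed (auto simp: algebra_simps fun_eq_iff simp flip: cst_mult cst_add)

lemma ptensor_carrier [simp]: "ptensor p f \<in> carrier loop_vir"
  using finite_subset[of "{q. ptensor p f q \<noteq> 0}" "{p}"] by (auto simp: loop_simps ptensor_def)

interpretation LV: cvectorspace loop_vir by (rule cvectorspace_loop)

lemma ptensor_add: "ptensor p (f + g) = ptensor p f \<oplus>\<^bsub>loop_vir\<^esub> ptensor p g"
  by (auto simp: ptensor_def loop_simps)

lemma ptensor_smult: "ptensor p (cst a * f) = a \<odot>\<^bsub>loop_vir\<^esub> ptensor p f"
  by (auto simp: ptensor_def loop_simps)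

lemma ptensor_0: "ptensor p 0 = \<zero>\<^bsub>loop_vir\<^esub>"
  by (auto simp: ptensor_def loop_simps)

text \<open>In the last case the coefficient is that of the given \<open>x\<close>, so that
  knowledge of the support of \<open>x\<close>, such as its degree, remains available.\<close>

lemma loop_induct [consumes 1, case_names zero add ptensor]:
  assumes "x \<in> carrier loop_vir"
    and "P \<zero>\<^bsub>loop_vir\<^esub>"
    and "\<And>x y. \<lbrakk>x \<in> carrier loop_vir; y \<in> carrier loop_vir; P x; P y\<rbrakk> \<Longrightarrow> P (x \<oplus>\<^bsub>loop_vir\<^esub> y)"
    and "\<And>p. x p \<noteq> 0 \<Longrightarrow> P (ptensor p (x p))"
  shows "P x"
proof -
  \<comment> \<open>\<open>y\<close> ranges over the truncations of \<open>x\<close>, from which one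
    basis element at a time is removed.\<close>
  have "P y" if "finite S" "{p. y p \<noteq> 0} = S" "\<And>p. y p \<noteq> 0 \<Longrightarrow> y p = x p" for S and y :: loop_elt
    using that
  proof (induction S arbitrary: y rule: finite_induct)
    case empty
    then have "y = \<zero>\<^bsub>loop_vir\<^esub>" by (auto simp: loop_simps)
    then show ?case using assms(2) by simp
  next
    case (insert p S)
    have y: "y p \<noteq> 0" using insert by auto
    have S: "{q. (y(p := 0)) q \<noteq> 0} = S"
      using insert by (auto simp: fun_upd_def split: if_splits)
    have "P (y(p := 0))"
      by (rule insert.IH[OF S]) (use insert.prems(2) in \<open>auto split: if_splits\<close>)
    moreover have "P (ptensor p (y p))" using assms(4)[of p] insert.prems(2) y by auto
    moreover have "y = (y(p := 0)) \<oplus>\<^bsub>loop_vir\<^esub> ptensor p (y p)"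
      by (auto simp: ptensor_def loop_simps)
    moreover have "y(p := 0) \<in> carrier loop_vir" using S insert.hyps by (simp add: loop_simps)
    ultimately show ?case using assms(3) ptensor_carrier by metis
  qed
  then show ?thesis using assms(1) by (simp add: loop_simps)
qed

lemma loop_br_closed: 
  assumes x: "x \<in> carrier loop_vir" and y: "y \<in> carrier loop_vir"
  shows "lie_br loop_vir x y \<in> carrier loop_vir"
proof -
  have "{r. lie_br loop_vir x y r \<noteq> 0} \<subseteq> (\<Union>p\<in>{p. x p \<noteq> 0}. \<Union>q\<in>{q. y q \<noteq> 0}. Poly_Mapping.keys (vir_br p q))"
  proof
    fix r assume "r \<in> {r. lie_br loop_vir x y r \<noteq> 0}"
    then have "lie_br loop_vir x y r \<noteq> 0" by simp
    then obtain p q where "x p \<noteq> 0" "y q \<noteq> 0" "Poly_Mapping.lookup (vir_br p q) r \<noteq> 0"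
      by (rule loop_br_nonzero[OF _ x y])
    then show "r \<in> (\<Union>p\<in>{p. x p \<noteq> 0}. \<Union>q\<in>{q. y q \<noteq> 0}. Poly_Mapping.keys (vir_br p q))"
      by (intro UN_I[of p] UN_I[of q]) (simp_all add: in_keys_iff)
  qed
  then show ?thesis
    using assms by (auto simp: loop_simps intro: finite_subset)
qed

lemma loop_br_add_left:
  assumes "x \<in> carrier loop_vir" "y \<in> carrier loop_vir" "z \<in> carrier loop_vir"
  shows "lie_br loop_vir (x \<oplus>\<^bsub>loop_vir\<^esub> y) z = lie_br loop_vir x z \<oplus>\<^bsub>loop_vir\<^esub> lie_br loop_vir y z"
proof
  fix r
  let ?P = "{p. x p \<noteq> 0} \<union> {p. y p \<noteq> 0}" and ?Q = "{p. z p \<noteq> 0}"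
  have *: "finite ?P" "finite ?Q" "{p. x p \<noteq> 0} \<subseteq> ?P" "{p. y p \<noteq> 0} \<subseteq> ?P" "{p. (x \<oplus>\<^bsub>loop_vir\<^esub> y) p \<noteq> 0} \<subseteq> ?P"
    using assms by (auto simp: loop_simps)
  show "lie_br loop_vir (x \<oplus>\<^bsub>loop_vir\<^esub> y) z r = (lie_br loop_vir x z \<oplus>\<^bsub>loop_vir\<^esub> lie_br loop_vir y z) r"
    by (subst loop_br[OF *(1,5,2) order_refl])
       (simp add: loop_simps(3) loop_br[OF *(1,3,2) order_refl] loop_br[OF *(1,4,2) order_refl] algebra_simps sum.distrib)
qed

lemma loop_br_add_right:
  assumes "x \<in> carrier loop_vir" "y \<in> carrier loop_vir" "z \<in> carrier loop_vir"
  shows "lie_br loop_vir z (x \<oplus>\<^bsub>loop_vir\<^esub> y) = lie_br loop_vir z x \<oplus>\<^bsub>loop_vir\<^esub> lie_br loop_vir z y"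
proof
  fix r
  let ?P = "{p. x p \<noteq> 0} \<union> {p. y p \<noteq> 0}" and ?Q = "{p. z p \<noteq> 0}"
  have *: "finite ?P" "finite ?Q" "{p. x p \<noteq> 0} \<subseteq> ?P" "{p. y p \<noteq> 0} \<subseteq> ?P" "{p. (x \<oplus>\<^bsub>loop_vir\<^esub> y) p \<noteq> 0} \<subseteq> ?P"
    using assms by (auto simp: loop_simps)
  show "lie_br loop_vir z (x \<oplus>\<^bsub>loop_vir\<^esub> y) r = (lie_br loop_vir z x \<oplus>\<^bsub>loop_vir\<^esub> lie_br loop_vir z y) r"
    by (subst loop_br[OF *(2) order_refl *(1,5)])
       (simp add: loop_simps(3) loop_br[OF *(2) order_refl *(1,3)] loop_br[OF *(2) order_refl *(1,4)] algebra_simps sum.distrib)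
qed

lemma loop_br_smult:
  assumes "x \<in> carrier loop_vir" "y \<in> carrier loop_vir"
  shows "lie_br loop_vir (a \<odot>\<^bsub>loop_vir\<^esub> x) y = a \<odot>\<^bsub>loop_vir\<^esub> lie_br loop_vir x y"
    and "lie_br loop_vir x (a \<odot>\<^bsub>loop_vir\<^esub> y) = a \<odot>\<^bsub>loop_vir\<^esub> lie_br loop_vir x y"
proof -
  let ?P = "{p. x p \<noteq> 0}" and ?Q = "{p. y p \<noteq> 0}"
  have *: "finite ?P" "finite ?Q" "{p. (a \<odot>\<^bsub>loop_vir\<^esub> x) p \<noteq> 0} \<subseteq> ?P" "{p. (a \<odot>\<^bsub>loop_vir\<^esub> y) p \<noteq> 0} \<subseteq> ?Q"
    using assms by (auto simp: loop_simps)
  show "lie_br loop_vir (a \<odot>\<^bsub>loop_vir\<^esub> x) y = a \<odot>\<^bsub>loop_vir\<^esub> lie_br loop_vir x y"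
    by (rule ext, subst loop_simps(4), subst loop_br[OF *(1,3,2) order_refl], subst loop_br[OF *(1) order_refl *(2) order_refl])
       (simp add: loop_simps sum_distrib_left mult.left_commute mult.assoc)
  show "lie_br loop_vir x (a \<odot>\<^bsub>loop_vir\<^esub> y) = a \<odot>\<^bsub>loop_vir\<^esub> lie_br loop_vir x y"
    by (rule ext, subst loop_simps(4), subst loop_br[OF *(1) order_refl *(2,4)], subst loop_br[OF *(1) order_refl *(2) order_refl])
       (simp add: loop_simps sum_distrib_left mult.left_commute mult.assoc)
qed

lemma loop_br_ptensor_aux:
  "lie_br loop_vir (ptensor p f) (ptensor q g) = (\<lambda>r. cst (Poly_Mapping.lookup (vir_br p q) r) * (f * g))"
  by (rule ext, subst loop_br[of "{p}" _ "{q}"]) (auto simp: ptensor_def)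

lemma loop_br_ptensor:
  "lie_br loop_vir (ptensor (VD m) f) (ptensor (VD n) g) =
     ptensor (VD (m + n)) (cst (of_int (n - m)) * (f * g)) \<oplus>\<^bsub>loop_vir\<^esub>
     ptensor VC (cst (if m + n = 0 then of_int (m ^ 3 - m) / 12 else 0) * (f * g))"
  unfolding loop_br_ptensor_aux
  by (auto simp: loop_simps ptensor_def fun_eq_iff lookup_add lookup_single when_def eq_neg_iff_add_eq_0)

lemma loop_br_VC [simp]:
  assumes y: "y \<in> carrier loop_vir"
  shows "lie_br loop_vir (ptensor VC f) y = \<zero>\<^bsub>loop_vir\<^esub>"
    and "lie_br loop_vir y (ptensor VC f) = \<zero>\<^bsub>loop_vir\<^esub>"
proof -
  have 0: "vir_br x VC = 0" for x by (cases x) auto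
  have fin: "finite {p. y p \<noteq> 0}" using y by (simp add: loop_simps)
  have VC: "{p. ptensor VC f p \<noteq> 0} \<subseteq> {VC}" by (auto simp: ptensor_def)
  show "lie_br loop_vir (ptensor VC f) y = \<zero>\<^bsub>loop_vir\<^esub>"
    by (rule ext, subst loop_br[of "{VC}" _ "{p. y p \<noteq> 0}"]) (simp_all add: fin VC loop_simps)
  show "lie_br loop_vir y (ptensor VC f) = \<zero>\<^bsub>loop_vir\<^esub>"
    by (rule ext, subst loop_br[of "{p. y p \<noteq> 0}" _ "{VC}"]) (simp_all add: fin VC loop_simps 0)
qed

lemma ptensor_cst_add:
  "ptensor p (cst a * f) \<oplus>\<^bsub>loop_vir\<^esub> ptensor p (cst b * f) = ptensor p (cst (a + b) * f)"
  by (simp add: distrib_right flip: ptensor_add cst_add)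

text \<open>The central term of the inner bracket is killed by the outer one, so only one cocycle
  value, that of the outer bracket, remains.\<close>

lemma loop_br_VD_VD_VD:
  "lie_br loop_vir (ptensor (VD i) f) (lie_br loop_vir (ptensor (VD j) g) (ptensor (VD k) h)) =
     ptensor (VD (i + j + k)) (cst (of_int ((k - j) * (j + k - i))) * (f * g * h)) \<oplus>\<^bsub>loop_vir\<^esub>
     ptensor VC (cst (if i + j + k = 0 then of_int ((k - j) * (i ^ 3 - i)) / 12 else 0) * (f * g * h))"
proof -
  have 1: "cst a * (f * (cst b * (g * h))) = cst (b * a) * (f * g * h)" for a b
    by (simp add: mult.assoc mult.left_commute flip: cst_mult)
  have 2: "of_int (k - j) * (if i + (j + k) = 0 then of_int (i ^ 3 - i) / 12 else 0)
    = (if i + j + k = 0 then of_int ((k - j) * (i ^ 3 - i)) / 12 else (0::complex))"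
    by (simp add: add.assoc)
  have "lie_br loop_vir (ptensor (VD i) f) (lie_br loop_vir (ptensor (VD j) g) (ptensor (VD k) h)) =
     lie_br loop_vir (ptensor (VD i) f) (ptensor (VD (j + k)) (cst (of_int (k - j)) * (g * h)))"
    by (simp add: loop_br_ptensor[of j] loop_br_add_right loop_br_closed)
  then show ?thesis
    by (simp only: loop_br_ptensor 1 2 add.assoc of_int_mult)
qed

lemma loop_br_anti:
  assumes "x \<in> carrier loop_vir" "y \<in> carrier loop_vir"
  shows "lie_br loop_vir x y \<oplus>\<^bsub>loop_vir\<^esub> lie_br loop_vir y x = \<zero>\<^bsub>loop_vir\<^esub>"
  using assms
proof (induction x rule: loop_induct)
  case zero
  have "lie_br loop_vir \<zero>\<^bsub>loop_vir\<^esub> y = \<zero>\<^bsub>loop_vir\<^esub>" "lie_br loop_vir y \<zero>\<^bsub>loop_vir\<^esub> = \<zero>\<^bsub>loop_vir\<^esub>"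
    using loop_br_VC[OF zero, where f = 0] by (simp_all add: ptensor_0)
  then show ?case by simp
next
  case (add x x')
  then have "lie_br loop_vir x y \<oplus>\<^bsub>loop_vir\<^esub> lie_br loop_vir y x \<oplus>\<^bsub>loop_vir\<^esub>
     (lie_br loop_vir x' y \<oplus>\<^bsub>loop_vir\<^esub> lie_br loop_vir y x') = \<zero>\<^bsub>loop_vir\<^esub>" by simp
  then show ?case using add.hyps add.prems by (simp add: loop_br_add_left loop_br_add_right loop_br_closed LV.a_ac)
next
  case (ptensor p)
  define f where "f = x p"
  have "lie_br loop_vir (ptensor p f) y \<oplus>\<^bsub>loop_vir\<^esub> lie_br loop_vir y (ptensor p f) = \<zero>\<^bsub>loop_vir\<^esub>"
    using ptensor.prems
  proof (induction y rule: loop_induct)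
    case zero
    have "lie_br loop_vir \<zero>\<^bsub>loop_vir\<^esub> (ptensor p f) = \<zero>\<^bsub>loop_vir\<^esub>" "lie_br loop_vir (ptensor p f) \<zero>\<^bsub>loop_vir\<^esub> = \<zero>\<^bsub>loop_vir\<^esub>"
      using loop_br_VC[OF ptensor_carrier, where f = 0] by (simp_all add: ptensor_0)
    then show ?case by simp
  next
    case (add y y')
    then have "lie_br loop_vir (ptensor p f) y \<oplus>\<^bsub>loop_vir\<^esub> lie_br loop_vir y (ptensor p f) \<oplus>\<^bsub>loop_vir\<^esub>
     (lie_br loop_vir (ptensor p f) y' \<oplus>\<^bsub>loop_vir\<^esub> lie_br loop_vir y' (ptensor p f)) = \<zero>\<^bsub>loop_vir\<^esub>" by simp
    then show ?case using add.hyps by (simp add: loop_br_add_left loop_br_add_right loop_br_closed LV.a_ac)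
  next
    case (ptensor q)
    define g where "g = y q"
    have "lie_br loop_vir (ptensor p f) (ptensor q g) \<oplus>\<^bsub>loop_vir\<^esub> lie_br loop_vir (ptensor q g) (ptensor p f) = \<zero>\<^bsub>loop_vir\<^esub>"
    proof (cases p)
      case p: (VD m)
      show ?thesis
      proof (cases q)
        case q: (VD n)
        have "ptensor (VD (m + n)) (cst (of_int (n - m)) * (f * g)) \<oplus>\<^bsub>loop_vir\<^esub> ptensor (VD (m + n)) (cst (of_int (m - n)) * (f * g)) = \<zero>\<^bsub>loop_vir\<^esub>"
          unfolding ptensor_cst_add by (simp add: ptensor_0)
        \<comment> \<open>The cocycle \<open>m^3 - m\<close> is an odd function of
          \<open>m\<close>.\<close>
        moreover have "(if m + n = 0 then of_int (m ^ 3 - m) / 12 else 0) + (if n + m = 0 then of_int (n ^ 3 - n) / 12 else (0::complex)) = 0"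
        proof (cases "m + n = 0")
          case True
          then have n: "n = - m" by simp
          show ?thesis unfolding n by (simp flip: add_divide_distrib)
        qed auto
        then have "ptensor VC (cst (if m + n = 0 then of_int (m ^ 3 - m) / 12 else 0) * (f * g)) \<oplus>\<^bsub>loop_vir\<^esub> ptensor VC (cst (if n + m = 0 then of_int (n ^ 3 - n) / 12 else 0) * (f * g)) = \<zero>\<^bsub>loop_vir\<^esub>"
          unfolding ptensor_cst_add by (simp add: ptensor_0)
        moreover have ac: "a \<oplus>\<^bsub>loop_vir\<^esub> b \<oplus>\<^bsub>loop_vir\<^esub> (a' \<oplus>\<^bsub>loop_vir\<^esub> b')
            = (a \<oplus>\<^bsub>loop_vir\<^esub> a') \<oplus>\<^bsub>loop_vir\<^esub> (b \<oplus>\<^bsub>loop_vir\<^esub> b')" for a b a' b'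
          by (simp add: loop_simps algebra_simps)
        ultimately show ?thesis
          unfolding p q loop_br_ptensor add.commute[of n m] mult.commute[of g f] ac by simp
      qed simp
    qed simp
    then show ?case by (simp add: g_def)
  qed
  then show ?case by (simp add: f_def)
qed

text \<open>Two integer identities: the cyclic sum of \<open>(k - j) * (j + k - i)\<close> vanishes
  identically, and that of \<open>(k - j) * (i^3 - i)\<close> vanishes when
  \<open>i + j + k = 0\<close>.\<close>

lemma loop_jacobi_ptensor:
  "lie_br loop_vir (ptensor p f) (lie_br loop_vir (ptensor q g) (ptensor s h)) \<oplus>\<^bsub>loop_vir\<^esub>
   lie_br loop_vir (ptensor q g) (lie_br loop_vir (ptensor s h) (ptensor p f)) \<oplus>\<^bsub>loop_vir\<^esub>
   lie_br loop_vir (ptensor s h) (lie_br loop_vir (ptensor p f) (ptensor q g)) = \<zero>\<^bsub>loop_vir\<^esub>"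
proof -
  have z: "lie_br loop_vir (ptensor p f) \<zero>\<^bsub>loop_vir\<^esub> = \<zero>\<^bsub>loop_vir\<^esub>" for p f
    using loop_br_VC(2)[OF ptensor_carrier, where f = 0] by (simp add: ptensor_0)
  consider "p = VC" | "q = VC" | "s = VC" | i j k where "p = VD i" "q = VD j" "s = VD k"
    by (metis vir_gen.exhaust)
  then show ?thesis
  proof cases
    case (4 i j k)
    have fgh: "g * h * f = f * g * h" "h * f * g = f * g * h" by (simp_all add: mult_ac)
    have ijk: "j + k + i = i + j + k" "k + i + j = i + j + k" by simp_all
    let ?c = "\<lambda>i j k::int. if i + j + k = 0 then of_int ((k - j) * (i ^ 3 - i)) / 12 else (0::complex)"
    have c: "?c i j k + ?c j k i + ?c k i j = 0"
    proof (cases "i + j + k = 0")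
      case True
      then have k: "k = - i - j" by simp
      have "(k - j) * (i ^ 3 - i) + (i - k) * (j ^ 3 - j) + (j - i) * (k ^ 3 - k) = 0"
        unfolding k by (simp add: algebra_simps power3_eq_cube)
      then have "(of_int ((k - j) * (i ^ 3 - i) + (i - k) * (j ^ 3 - j) + (j - i) * (k ^ 3 - k)) :: complex) = 0" by (simp only: of_int_0)
      then show ?thesis using True ijk
        by (simp only: of_int_add if_True ijk flip: add_divide_distrib) simp
    qed (use ijk in simp)
    have d: "of_int ((k - j) * (j + k - i)) + of_int ((i - k) * (k + i - j)) + of_int ((j - i) * (i + j - k)) = (0::complex)"
      by (simp flip: of_int_add of_int_mult of_int_diff add: algebra_simps)
    have ac: "a \<oplus>\<^bsub>loop_vir\<^esub> b \<oplus>\<^bsub>loop_vir\<^esub> (a' \<oplus>\<^bsub>loop_vir\<^esub> b') \<oplus>\<^bsub>loop_vir\<^esub> (a'' \<oplus>\<^bsub>loop_vir\<^esub> b'')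
      = (a \<oplus>\<^bsub>loop_vir\<^esub> a' \<oplus>\<^bsub>loop_vir\<^esub> a'') \<oplus>\<^bsub>loop_vir\<^esub> (b \<oplus>\<^bsub>loop_vir\<^esub> b' \<oplus>\<^bsub>loop_vir\<^esub> b'')" for a b a' b' a'' b''
      by (simp add: loop_simps algebra_simps)
    show ?thesis unfolding 4 loop_br_VD_VD_VD fgh ijk ac ptensor_cst_add
      using c d by (simp only: ijk) (simp add: ptensor_0)
  qed (simp_all add: loop_br_closed z)
qed

text \<open>The Jacobi expression \<open>J\<close> is invariant under cyclic rotation, so additivity
  in its first argument gives additivity in each, and three inductions reduce the claim to pure
  tensors.\<close>

lemma loop_jacobi:
  assumes "x \<in> carrier loop_vir" "y \<in> carrier loop_vir" "z \<in> carrier loop_vir"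
  shows "lie_br loop_vir x (lie_br loop_vir y z) \<oplus>\<^bsub>loop_vir\<^esub> lie_br loop_vir y (lie_br loop_vir z x) \<oplus>\<^bsub>loop_vir\<^esub>
    lie_br loop_vir z (lie_br loop_vir x y) = \<zero>\<^bsub>loop_vir\<^esub>"
proof -
  define J where "J x y z = lie_br loop_vir x (lie_br loop_vir y z) \<oplus>\<^bsub>loop_vir\<^esub> lie_br loop_vir y (lie_br loop_vir z x) \<oplus>\<^bsub>loop_vir\<^esub>
    lie_br loop_vir z (lie_br loop_vir x y)" for x y z
  have rot: "J x y z = J y z x" for x y z
    by (simp add: J_def loop_simps algebra_simps)
  have add: "J (x \<oplus>\<^bsub>loop_vir\<^esub> x') y z = J x y z \<oplus>\<^bsub>loop_vir\<^esub> J x' y z"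
    if "x \<in> carrier loop_vir" "x' \<in> carrier loop_vir" "y \<in> carrier loop_vir" "z \<in> carrier loop_vir" for x x' y z
    using that by (simp add: J_def loop_br_add_left loop_br_add_right loop_br_closed LV.a_ac)
  have z0: "lie_br loop_vir x \<zero>\<^bsub>loop_vir\<^esub> = \<zero>\<^bsub>loop_vir\<^esub>" "lie_br loop_vir \<zero>\<^bsub>loop_vir\<^esub> x = \<zero>\<^bsub>loop_vir\<^esub>"
    if "x \<in> carrier loop_vir" for x
    using loop_br_VC[OF that, where f = 0] by (simp_all add: ptensor_0)
  have zero: "J \<zero>\<^bsub>loop_vir\<^esub> y z = \<zero>\<^bsub>loop_vir\<^esub>" if "y \<in> carrier loop_vir" "z \<in> carrier loop_vir" for y z
    using that by (simp add: J_def z0 loop_br_closed)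
  have 1: "J (ptensor p f) (ptensor q g) z = \<zero>\<^bsub>loop_vir\<^esub>" if "z \<in> carrier loop_vir" for p f q g z
  proof -
    have "J z (ptensor p f) (ptensor q g) = \<zero>\<^bsub>loop_vir\<^esub>"
      using that
      by (induction z rule: loop_induct) (simp_all add: zero add, simp add: J_def loop_jacobi_ptensor)
    then show ?thesis using rot by metis
  qed
  have 2: "J (ptensor p f) y z = \<zero>\<^bsub>loop_vir\<^esub>" if "y \<in> carrier loop_vir" "z \<in> carrier loop_vir" for p f y z
  proof -
    have "J y z (ptensor p f) = \<zero>\<^bsub>loop_vir\<^esub>"
      using that
      by (induction y rule: loop_induct) (simp_all add: zero add, metis 1 rot)
    then show ?thesis using rot by metis
  qed
  have "J x y z = \<zero>\<^bsub>loop_vir\<^esub>"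
    using assms by (induction x rule: loop_induct) (simp_all add: zero add 2)
  then show ?thesis by (simp add: J_def)
qed

lemma lie_algebra_loop: "lie_algebra loop_vir"
proof unfold_locales
  fix x assume "x \<in> carrier loop_vir"
  \<comment> \<open>Antisymmetry gives the alternating law because 2 is invertible.\<close>
  then have "lie_br loop_vir x x \<oplus>\<^bsub>loop_vir\<^esub> lie_br loop_vir x x = \<zero>\<^bsub>loop_vir\<^esub>" by (intro loop_br_anti)
  then have "lie_br loop_vir x x p + lie_br loop_vir x x p = 0" for p
    by (auto simp: loop_simps dest: fun_cong)
  then have "lie_br loop_vir x x p = 0" for p
    by (simp flip: mult_2)
  then show "lie_br loop_vir x x = \<zero>\<^bsub>loop_vir\<^esub>" by (auto simp: loop_simps)
qed (simp_all add: loop_br_closed loop_br_add_left loop_br_add_right loop_br_smult loop_jacobi)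

interpretation LV: lie_algebra loop_vir by (rule lie_algebra_loop)


subsection \<open>The grading and the character\<close>

lemma loop_part_carrier: "x \<in> loop_part S \<Longrightarrow> x \<in> carrier loop_vir"
  by (simp add: loop_part_def)

lemma loop_part_mono: "\<lbrakk>x \<in> loop_part S; S \<subseteq> T\<rbrakk> \<Longrightarrow> x \<in> loop_part T"
  by (auto simp: loop_part_def)

lemma loop_part_0 [simp]: "\<zero>\<^bsub>loop_vir\<^esub> \<in> loop_part S"
  unfolding loop_part_def using LV.zero_closed by (auto simp: loop_simps)

lemma loop_part_add: "\<lbrakk>x \<in> loop_part S; y \<in> loop_part S\<rbrakk> \<Longrightarrow> x \<oplus>\<^bsub>loop_vir\<^esub> y \<in> loop_part S"
  using LV.a_closed[of x y] unfolding loop_part_def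
  by (auto simp: loop_simps) (metis add_0)

lemma loop_part_smult: "x \<in> loop_part S \<Longrightarrow> a \<odot>\<^bsub>loop_vir\<^esub> x \<in> loop_part S"
  using LV.smult_cl[of x a] unfolding loop_part_def by (auto simp: loop_simps)

lemma ptensor_part: "vir_deg p \<in> S \<Longrightarrow> ptensor p f \<in> loop_part S"
  unfolding loop_part_def using ptensor_carrier[of p f] by (auto simp: ptensor_def simp del: ptensor_carrier)

lemma vir_br_deg: "Poly_Mapping.lookup (vir_br p q) r \<noteq> 0 \<Longrightarrow> vir_deg r = vir_deg p + vir_deg q"
  by (cases "(p, q)" rule: vir_br.cases) (auto simp: lookup_add lookup_single when_def split: if_splits)

lemma loop_part_br:
  assumes x: "x \<in> loop_part S" and y: "y \<in> loop_part T" and ST: "\<And>i j. \<lbrakk>i \<in> S; j \<in> T\<rbrakk> \<Longrightarrow> i + j \<in> R"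
  shows "lie_br loop_vir x y \<in> loop_part R"
  unfolding loop_part_def mem_Collect_eq
proof (intro conjI allI impI)
  note c = loop_part_carrier[OF x] loop_part_carrier[OF y]
  show "lie_br loop_vir x y \<in> carrier loop_vir" using c by (rule loop_br_closed)
  fix r assume "lie_br loop_vir x y r \<noteq> 0"
  then obtain p q where "x p \<noteq> 0" "y q \<noteq> 0" "Poly_Mapping.lookup (vir_br p q) r \<noteq> 0"
    by (rule loop_br_nonzero[OF _ c])
  then show "vir_deg r \<in> R" using x y ST by (auto simp: loop_part_def vir_br_deg)
qed

definition restrict_deg :: "int set \<Rightarrow> loop_elt \<Rightarrow> loop_elt" where
  "restrict_deg S x = (\<lambda>p. if vir_deg p \<in> S then x p else 0)"

lemma degree_zero_part_eq: "degree_zero_part = restrict_deg {0}"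
  by (simp add: degree_zero_part_def restrict_deg_def fun_eq_iff)

lemma restrict_deg_part: "x \<in> carrier loop_vir \<Longrightarrow> restrict_deg S x \<in> loop_part S"
proof -
  assume "x \<in> carrier loop_vir"
  then have "finite {p. restrict_deg S x p \<noteq> 0}"
    by (auto simp: loop_simps restrict_deg_def elim: finite_subset[rotated])
  then show ?thesis by (auto simp: loop_part_def loop_simps restrict_deg_def)
qed

lemma restrict_deg_add: "restrict_deg S (x \<oplus>\<^bsub>loop_vir\<^esub> y) = restrict_deg S x \<oplus>\<^bsub>loop_vir\<^esub> restrict_deg S y"
  by (auto simp: restrict_deg_def loop_simps)

lemma restrict_deg_smult: "restrict_deg S (a \<odot>\<^bsub>loop_vir\<^esub> x) = a \<odot>\<^bsub>loop_vir\<^esub> restrict_deg S x"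
  by (auto simp: restrict_deg_def loop_simps)

lemma restrict_deg_restrict: "restrict_deg S (restrict_deg T x) = restrict_deg (S \<inter> T) x"
  by (auto simp: restrict_deg_def)

lemma restrict_deg_id: "x \<in> loop_part S \<Longrightarrow> restrict_deg S x = x"
  by (auto simp: restrict_deg_def loop_part_def fun_eq_iff)

lemma restrict_deg_eq_0: "restrict_deg S x = \<zero>\<^bsub>loop_vir\<^esub> \<longleftrightarrow> (\<forall>p. x p \<noteq> 0 \<longrightarrow> vir_deg p \<notin> S)"
  by (auto simp: restrict_deg_def loop_simps fun_eq_iff)

lemma loop_nonneg: "loop_zero <+>\<^bsub>loop_vir\<^esub> loop_plus = loop_part {0..}"
proof
  show "loop_zero <+>\<^bsub>loop_vir\<^esub> loop_plus \<subseteq> loop_part {0..}"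
    by (auto simp: set_add_def' intro!: loop_part_add elim: loop_part_mono)
  show "loop_part {0..} \<subseteq> loop_zero <+>\<^bsub>loop_vir\<^esub> loop_plus"
  proof
    fix x assume x: "x \<in> loop_part {0..}"
    have "x = restrict_deg {0} x \<oplus>\<^bsub>loop_vir\<^esub> restrict_deg {0<..} x"
      using x by (fastforce simp: restrict_deg_def loop_simps loop_part_def)
    moreover have "restrict_deg {0} x \<in> loop_zero" "restrict_deg {0<..} x \<in> loop_plus"
      using x by (auto intro!: restrict_deg_part loop_part_carrier)
    ultimately show "x \<in> loop_zero <+>\<^bsub>loop_vir\<^esub> loop_plus"
      unfolding set_add_def' by blast
  qed
qed

text \<open>With nonnegative degrees only the two degree zero components can contribute, and these
  commute, as \<open>n - m\<close> and \<open>m^3 - m\<close> vanish at \<open>m = n = 0\<close>.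
  Hence any linear \<open>\<phi>\<close> on \<open>loop_zero\<close> gives a character of the
  nonnegative part.\<close>

lemma degree_zero_br:
  assumes x: "x \<in> loop_part {0..}" and y: "y \<in> loop_part {0..}"
  shows "restrict_deg {0} (lie_br loop_vir x y) = \<zero>\<^bsub>loop_vir\<^esub>"
  unfolding restrict_deg_eq_0
proof (intro allI impI notI)
  note c = loop_part_carrier[OF x] loop_part_carrier[OF y]
  fix r assume "lie_br loop_vir x y r \<noteq> 0" and r: "vir_deg r \<in> {0}"
  then obtain p q where pq: "x p \<noteq> 0" "y q \<noteq> 0" "Poly_Mapping.lookup (vir_br p q) r \<noteq> 0"
    by (auto elim: loop_br_nonzero[OF _ c])
  then have "vir_deg p \<ge> 0" "vir_deg q \<ge> 0" using x y by (auto simp: loop_part_def)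
  then have "vir_deg p = 0" "vir_deg q = 0" using vir_br_deg[OF pq(3)] r by auto
  then show False using pq(3) by (cases "(p, q)" rule: vir_br.cases) (auto simp: lookup_add lookup_single)
qed

lemma br_d0:
  assumes "x \<in> loop_part {k}"
  shows "lie_br loop_vir (ptensor (VD 0) 1) x = of_int k \<odot>\<^bsub>loop_vir\<^esub> x"
proof -
  have "lie_br loop_vir (ptensor (VD 0) 1) (ptensor p f) = of_int (vir_deg p) \<odot>\<^bsub>loop_vir\<^esub> ptensor p f" for p f
  proof (cases p)
    case (VD n)
    have "(if 0 + n = 0 then of_int (0 ^ 3 - 0) / 12 else 0) = (0::complex)" by simp
    then show ?thesis unfolding VD loop_br_ptensor by (simp add: ptensor_0 ptensor_smult del: single_of_int)
  qed (simp flip: ptensor_smult add: ptensor_0)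
  moreover have "x p \<noteq> 0 \<Longrightarrow> vir_deg p = k" for p using assms by (auto simp: loop_part_def)
  ultimately show ?thesis
    by (intro loop_induct[OF loop_part_carrier[OF assms], where
        P = "\<lambda>x. lie_br loop_vir (ptensor (VD 0) 1) x = of_int k \<odot>\<^bsub>loop_vir\<^esub> x"])
      (simp_all add: loop_br_add_right LV.smult_add_right)
qed

locale loop_character =
  fixes \<phi> :: "loop_elt \<Rightarrow> complex"
  assumes \<phi>_hom: "\<phi> \<in> LinearCombinations.module_hom class_ring (loop_vir\<lparr>carrier := loop_zero\<rparr>) complex_space"
begin

lemma \<phi>_add: "\<lbrakk>x \<in> loop_zero; y \<in> loop_zero\<rbrakk> \<Longrightarrow> \<phi> (x \<oplus>\<^bsub>loop_vir\<^esub> y) = \<phi> x + \<phi> y"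
  using LinearCombinations.module_hom_add[OF \<phi>_hom, of x y] by simp

lemma \<phi>_smult: "x \<in> loop_zero \<Longrightarrow> \<phi> (a \<odot>\<^bsub>loop_vir\<^esub> x) = a * \<phi> x"
  using LinearCombinations.module_hom_smult[OF \<phi>_hom, of a x] by simp

lemma \<phi>_0 [simp]: "\<phi> \<zero>\<^bsub>loop_vir\<^esub> = 0"
  using \<phi>_smult[of "\<zero>\<^bsub>loop_vir\<^esub>" 0] by simp

text \<open>The extension of \<open>\<phi>\<close> by zero in the other degrees. The values of
  \<open>\<phi>\<close> outside \<open>loop_zero\<close> are arbitrary, whereas
  \<open>\<psi>\<close> is linear on all of \<open>loop_vir\<close>.\<close>

definition \<psi> where "\<psi> x = \<phi> (restrict_deg {0} x)"

lemma \<psi>_linear: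
  shows "\<lbrakk>x \<in> carrier loop_vir; y \<in> carrier loop_vir\<rbrakk> \<Longrightarrow> \<psi> (x \<oplus>\<^bsub>loop_vir\<^esub> y) = \<psi> x + \<psi> y"
    and "x \<in> carrier loop_vir \<Longrightarrow> \<psi> (a \<odot>\<^bsub>loop_vir\<^esub> x) = a * \<psi> x"
  by (simp_all add: \<psi>_def restrict_deg_add restrict_deg_smult restrict_deg_part \<phi>_add \<phi>_smult)

lemma \<psi>_plus: "x \<in> loop_plus \<Longrightarrow> \<psi> x = 0"
  unfolding \<psi>_def by (subst restrict_deg_eq_0[THEN iffD2]) (auto simp: loop_part_def)

lemma \<psi>_zero: "x \<in> loop_zero \<Longrightarrow> \<psi> x = \<phi> x"
  by (simp add: \<psi>_def restrict_deg_id)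

sublocale IC: induced_character loop_vir "loop_part {0..}" "restrict_deg {0..}" \<psi>
proof unfold_locales
  fix x y assume x: "x \<in> carrier loop_vir" and y: "y \<in> carrier loop_vir"
  show xc: "restrict_deg {0..} x \<in> carrier loop_vir" using x by (blast intro: restrict_deg_part loop_part_carrier)
  have b: "restrict_deg {0..} x \<in> loop_part {0..}" "restrict_deg {0..} y \<in> loop_part {0..}"
    using x y by (auto intro: restrict_deg_part)
  show "restrict_deg {0..} (lie_br loop_vir (restrict_deg {0..} x) (restrict_deg {0..} y)) =
     lie_br loop_vir (restrict_deg {0..} x) (restrict_deg {0..} y)"
    by (rule restrict_deg_id, rule loop_part_br[OF b]) auto
  show "\<psi> (lie_br loop_vir (restrict_deg {0..} x) (restrict_deg {0..} y)) = 0"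
    by (simp add: \<psi>_def degree_zero_br[OF b])
  \<comment> \<open>Being killed by the projection means living in negative degrees, and these are
    closed under the bracket.\<close>
  assume "restrict_deg {0..} x = \<zero>\<^bsub>loop_vir\<^esub>" "restrict_deg {0..} y = \<zero>\<^bsub>loop_vir\<^esub>"
  then have "x \<in> loop_part {..<0}" "y \<in> loop_part {..<0}"
    using x y by (auto simp: restrict_deg_eq_0 loop_part_def not_le)
  then have "lie_br loop_vir x y \<in> loop_part {..<0}"
    by (rule loop_part_br) auto
  then show "restrict_deg {0..} (lie_br loop_vir x y) = \<zero>\<^bsub>loop_vir\<^esub>"
    by (auto simp: restrict_deg_eq_0 loop_part_def)
qed (auto simp: restrict_deg_add restrict_deg_smult restrict_deg_restrict restrict_deg_id \<psi>_linear loop_part_carrier,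
     auto simp: \<psi>_def restrict_deg_restrict)

lemma verma_eq: "verma_space \<phi> = IC.Ind" "verma_act \<phi> = IC.ind_act"
proof -
  have "hw_line_act \<phi> = (\<lambda>x z. \<psi> x * z)"
    by (simp add: hw_line_act_def \<psi>_def fun_eq_iff degree_zero_part_eq)
  then show "verma_space \<phi> = IC.Ind" "verma_act \<phi> = IC.ind_act"
    by (simp_all add: verma_space_def verma_act_def loop_nonneg)
qed

end

section \<open>Highest weight modules\<close>


lemma loop_part_single: "\<lbrakk>x \<in> loop_part {k}; k \<in> S\<rbrakk> \<Longrightarrow> x \<in> loop_part S"
  by (rule loop_part_mono) auto

abbreviation "d0 \<equiv> ptensor (VD 0) 1"

text \<open>Abstracts from the tensor construction so that both the Verma module and its irreducible
  quotient are instances.\<close>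

locale hw_module = loop_character \<phi> + lie_module loop_vir V act
  for \<phi> and V :: "(complex, 'v, 'n) module_scheme" (structure) and act +
  fixes v0 :: 'v and l :: "'v \<Rightarrow> complex"
  assumes v0 [simp]: "v0 \<in> carrier V"
    and act_v0: "x \<in> loop_part {0..} \<Longrightarrow> act x v0 = \<psi> x \<odot> v0"
    and generated: "\<lbrakk>lie_submodule loop_vir V act N; v0 \<in> N\<rbrakk> \<Longrightarrow> N = carrier V"
    and l_add: "\<lbrakk>v \<in> carrier V; w \<in> carrier V\<rbrakk> \<Longrightarrow> l (v \<oplus> w) = l v + l w"
    and l_smult: "v \<in> carrier V \<Longrightarrow> l (a \<odot> v) = a * l v"
    and l_v0: "l v0 = 1"
    and l_act_neg: "\<lbrakk>x \<in> loop_part {..<0}; v \<in> carrier V\<rbrakk> \<Longrightarrow> l (act x v) = 0"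
begin

section \<open>Decomposition into weight spaces\<close>

lemma l_0 [simp]: "l \<zero> = 0"
  using l_smult[of \<zero> 0] by simp

text \<open>\<open>wt n\<close> turns out to be the weight space of weight \<open>\<psi> d0 - n\<close>.\<close>

inductive wt :: "nat \<Rightarrow> 'v \<Rightarrow> bool" where
  top: "wt 0 v0"
| zero: "wt n \<zero>"
| lower: "\<lbrakk>wt n v; k > 0; x \<in> loop_part {- int k}\<rbrakk> \<Longrightarrow> wt (n + k) (act x v)"
| add: "\<lbrakk>wt n v; wt n w\<rbrakk> \<Longrightarrow> wt n (v \<oplus> w)"
| smult: "wt n v \<Longrightarrow> wt n (a \<odot> v)"

lemma wt_carrier: "wt n v \<Longrightarrow> v \<in> carrier V"
  by (induction rule: wt.induct) (auto intro: act_closed loop_part_carrier)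

text \<open>The operator \<open>x\<close> is commuted through the lowering operators towards
  \<open>v0\<close>. Each commutator has degree \<open>j - k\<close> and is covered by the induction
  hypothesis if that is nonnegative and by \<open>wt.lower\<close> otherwise. Beyond depth
  \<open>n\<close> nothing is left, which the truncated \<open>n - j\<close> could not
  express.\<close>

lemma wt_act_nonneg:
  assumes "wt n v" "x \<in> loop_part {int j}"
  shows "if j \<le> n then wt (n - j) (act x v) else act x v = \<zero>"
  using assms
proof (induction arbitrary: j x rule: wt.induct)
  case (top j x)
  have x: "act x v0 = \<psi> x \<odot> v0" by (intro act_v0 loop_part_single[OF top]) simp
  show ?case
  proof (cases "j = 0")
    case True
    then show ?thesis using x wt.smult[OF wt.top] by simp
  next
    case False
    then have "\<psi> x = 0" by (intro \<psi>_plus loop_part_single[OF top]) simp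
    then show ?thesis using x False by simp
  qed
next
  case (zero n j x)
  then have "x \<in> carrier loop_vir" by (rule loop_part_carrier)
  then show ?case by (simp add: wt.zero)
next
  case (lower n v k y j x)
  note c = loop_part_carrier[OF lower.hyps(3)] loop_part_carrier[OF lower.prems] wt_carrier[OF lower.hyps(1)]
  have eq: "act x (act y v) = act (lie_br loop_vir x y) v \<oplus> act y (act x v)"
    by (rule act_swap[OF c(2,1,3)])
  have b: "lie_br loop_vir x y \<in> loop_part {int j - int k}"
    by (rule loop_part_br[OF lower.prems lower.hyps(3)]) simp
  show ?case
  proof (cases "j \<le> n + k")
    case True
    have "wt (n + k - j) (act (lie_br loop_vir x y) v)"
    proof (cases "k \<le> j")
      case True
      then have "lie_br loop_vir x y \<in> loop_part {int (j - k)}" using b by (simp add: of_nat_diff)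
      from lower.IH[OF this] have "wt (n - (j - k)) (act (lie_br loop_vir x y) v)"
        using \<open>j \<le> n + k\<close> by (simp split: if_splits)
      moreover have "n - (j - k) = n + k - j" using True by simp
      ultimately show ?thesis by simp
    next
      case False
      then have "lie_br loop_vir x y \<in> loop_part {- int (k - j)}" using b by (simp add: of_nat_diff)
      from wt.lower[OF lower.hyps(1) _ this] show ?thesis using False by (simp add: algebra_simps)
    qed
    moreover have "wt (n + k - j) (act y (act x v))"
    proof (cases "j \<le> n")
      case True
      then have "wt (n - j) (act x v)" using lower.IH[OF lower.prems] by simp
      from wt.lower[OF this lower.hyps(2,3)] show ?thesis using True by (simp add: algebra_simps)
    next
      case False
      then have "act x v = \<zero>" using lower.IH[OF lower.prems] by simp
      then show ?thesis using c by (simp add: wt.zero)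
    qed
    ultimately show ?thesis using True eq by (simp add: wt.add)
  next
    case False
    then have "lie_br loop_vir x y \<in> loop_part {int (j - k)}" using b by (simp add: of_nat_diff)
    from lower.IH[OF this] have "act (lie_br loop_vir x y) v = \<zero>" using False by (auto split: if_splits)
    moreover have "act x v = \<zero>" using lower.IH[OF lower.prems] False by simp
    ultimately show ?thesis using False eq c by simp
  qed
next
  case (add n v w j x)
  then have "x \<in> carrier loop_vir" by (auto dest: loop_part_carrier)
  then show ?case using add.IH[OF add.prems] add.hyps
    by (auto simp: act_add_right wt_carrier wt.add split: if_splits)
next
  case (smult n v a j x)
  then have "x \<in> carrier loop_vir" by (auto dest: loop_part_carrier)
  then show ?case using smult.IH[OF smult.prems] smult.hyps
    by (auto simp: act_smult_right wt_carrier wt.smult split: if_splits)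
qed

inductive wt_sum :: "'v \<Rightarrow> bool" where
  base: "wt n v \<Longrightarrow> wt_sum v"
| add: "\<lbrakk>wt_sum v; wt_sum w\<rbrakk> \<Longrightarrow> wt_sum (v \<oplus> w)"

lemma wt_sum_carrier: "wt_sum v \<Longrightarrow> v \<in> carrier V"
  by (induction rule: wt_sum.induct) (auto intro: wt_carrier)

text \<open>The sums of vectors of pure depth form a submodule that contains \<open>v0\<close>,
  hence are everything; the conclusion is packaged as an induction rule.\<close>

lemma wt_sum_induct [consumes 1, case_names wt add]:
  assumes "v \<in> carrier V"
    and P: "\<And>n v. wt n v \<Longrightarrow> P v"
    and P_add: "\<And>v w. \<lbrakk>v \<in> carrier V; w \<in> carrier V; P v; P w\<rbrakk> \<Longrightarrow> P (v \<oplus> w)"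
  shows "P v"
proof -
  define S where "S = {v. wt_sum v}"
  have wt: "v \<in> S" if "wt n v" for n v using wt_sum.base[OF that] by (simp add: S_def)
  have add: "v \<oplus> w \<in> S" if "v \<in> S" "w \<in> S" for v w
    using wt_sum.add that by (simp add: S_def)
  have S_carrier: "v \<in> carrier V" if "v \<in> S" for v
    using that by (simp add: S_def wt_sum_carrier)
  have S_induct: "Q v" if v: "v \<in> S" and b: "\<And>n v. wt n v \<Longrightarrow> Q v"
     and a: "\<And>v w. \<lbrakk>v \<in> carrier V; w \<in> carrier V; Q v; Q w\<rbrakk> \<Longrightarrow> Q (v \<oplus> w)" for v Q
    using v unfolding S_def mem_Collect_eq
    by (induction rule: wt_sum.induct) (simp_all add: a b wt_sum_carrier)
  have smult: "a \<odot> v \<in> S" if "v \<in> S" for a v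
  proof -
    show ?thesis using that
      by (rule S_induct) (auto intro: wt wt.smult add simp: V.smult_add_right)
  qed
  have act: "act x v \<in> S" if x: "x \<in> carrier loop_vir" and v: "v \<in> S" for x v
  proof -
    have pt: "act (ptensor p f) v \<in> S" for p f
      using v
    proof (rule S_induct)
      fix n v assume v: "wt n v"
      show "act (ptensor p f) v \<in> S"
      proof (cases "vir_deg p \<ge> 0")
        case True
        then have "ptensor p f \<in> loop_part {int (nat (vir_deg p))}" by (intro ptensor_part) simp
        from wt_act_nonneg[OF v this] show ?thesis using wt[OF wt.zero] wt by (auto split: if_splits)
      next
        case False
        then have "ptensor p f \<in> loop_part {- int (nat (- vir_deg p))}" "nat (- vir_deg p) > 0" by (auto intro!: ptensor_part)
        then show ?thesis using wt[OF wt.lower[OF v]] by blast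
      qed
    qed (auto intro: add simp: act_add_right)
    have vV: "v \<in> carrier V" using v by (rule S_carrier)
    show ?thesis
      by (rule loop_induct[OF x, where P = "\<lambda>x. act x v \<in> S"])
         (auto intro: pt wt[OF wt.zero] add simp: vV act_add_left)
  qed
  have "lie_submodule loop_vir V act S"
    by (rule lie_submoduleI) (auto intro: act add smult wt[OF wt.zero] S_carrier)
  then have "S = carrier V" using wt[OF wt.top] by (rule generated)
  then have "v \<in> S" using assms(1) by simp
  then show ?thesis by (rule S_induct) (simp_all add: P P_add)
qed

definition hw :: complex where "hw = \<psi> d0"

lemma d0_part: "d0 \<in> loop_part {0}"
  by (rule ptensor_part) simp

lemma d0_carrier [simp]: "d0 \<in> carrier loop_vir"
  by simp

lemma wt_d0: "wt n v \<Longrightarrow> act d0 v = (hw - of_nat n) \<odot> v"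
proof (induction rule: wt.induct)
  case top
  then show ?case using act_v0[OF loop_part_single[OF d0_part]] by (simp add: hw_def)
next
  case (lower n v k x)
  note c = loop_part_carrier[OF lower.hyps(3)] wt_carrier[OF lower.hyps(1)]
  have "act d0 (act x v) = of_int (- int k) \<odot> act x v \<oplus> (hw - of_nat n) \<odot> act x v"
    using act_swap[OF d0_carrier c] c by (simp add: br_d0[OF lower.hyps(3)] act_smult_left lower.IH act_smult_right)
  also have "\<dots> = (of_int (- int k) + (hw - of_nat n)) \<odot> act x v"
    using c by (simp only: V.smult_add_left act_closed)
  finally show ?case by (simp add: algebra_simps)
qed (simp_all add: act_add_right act_smult_right wt_carrier V.smult_add_right mult.commute)

text \<open>Lowering steps have \<open>k > 0\<close>, so depth 0 is the line through
  \<open>v0\<close>, and every generator of a deeper level is the image of a negative operator,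
  which \<open>l\<close> kills.\<close>

lemma wt_l: "wt n v \<Longrightarrow> (n > 0 \<longrightarrow> l v = 0) \<and> (n = 0 \<longrightarrow> v = l v \<odot> v0)"
proof (induction rule: wt.induct)
  case (lower n v k x)
  then show ?case using l_act_neg[OF loop_part_single, of x "- int k" v] by (simp add: wt_carrier)
next
  case (add n v w)
  show ?case
  proof (cases "n = 0")
    case True
    then have "v \<oplus> w = l v \<odot> v0 \<oplus> l w \<odot> v0" using add by simp
    then show ?thesis using True add by (simp add: l_add wt_carrier V.smult_add_left)
  qed (use add in \<open>simp add: l_add wt_carrier\<close>)
next
  case (smult n v a)
  show ?case
  proof (cases "n = 0")
    case True
    then have "a \<odot> v = a \<odot> (l v \<odot> v0)" using smult by simp
    also have "\<dots> = l (a \<odot> v) \<odot> v0" using smult by (simp add: l_smult wt_carrier)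
    finally show ?thesis using True by simp
  qed (use smult in \<open>simp add: l_smult wt_carrier\<close>)
qed (auto simp: l_v0)

lemma l_d0: "v \<in> carrier V \<Longrightarrow> l (act d0 v) = hw * l v"
proof (induction v rule: wt_sum_induct)
  case (wt n v)
  then show ?case using wt_l[OF wt] by (cases "n = 0") (simp_all add: wt_d0 l_smult wt_carrier)
qed (simp add: act_add_right act_closed l_add algebra_simps)

text \<open>The filtration by depth at most \<open>m\<close>. Induction on \<open>m\<close> takes
  the place of a direct sum decomposition.\<close>

primrec flt :: "nat \<Rightarrow> 'v set" where
  "flt 0 = {v. wt 0 v}"
| "flt (Suc m) = {a \<oplus> b | a b. a \<in> flt m \<and> wt (Suc m) b}"

lemma flt_carrier: "v \<in> flt m \<Longrightarrow> v \<in> carrier V"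
  by (induction m arbitrary: v) (auto simp: wt_carrier)

lemma flt_add: "\<lbrakk>v \<in> flt m; w \<in> flt m\<rbrakk> \<Longrightarrow> v \<oplus> w \<in> flt m"
proof (induction m arbitrary: v w)
  case (Suc m)
  then obtain a b a' b' where *: "a \<in> flt m" "wt (Suc m) b" "a' \<in> flt m" "wt (Suc m) b'" "v = a \<oplus> b" "w = a' \<oplus> b'"
    by auto
  then have "v \<oplus> w = (a \<oplus> a') \<oplus> (b \<oplus> b')"
    by (simp add: flt_carrier wt_carrier V.a_ac)
  then show ?case using * Suc.IH[of a a'] wt.add[of "Suc m" b b'] by auto
qed (simp add: wt.add)

lemma flt_smult: "v \<in> flt m \<Longrightarrow> a \<odot> v \<in> flt m"
proof (induction m arbitrary: v)
  case (Suc m)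
  then obtain b c where *: "b \<in> flt m" "wt (Suc m) c" "v = b \<oplus> c" by auto
  then have "a \<odot> v = a \<odot> b \<oplus> a \<odot> c" by (simp add: flt_carrier wt_carrier V.smult_add_right)
  then show ?case using * Suc.IH[of b] wt.smult[of "Suc m" c] by auto
qed (simp add: wt.smult)

lemma flt_d0: "v \<in> flt m \<Longrightarrow> act d0 v \<in> flt m"
proof (induction m arbitrary: v)
  case (Suc m)
  then obtain b c where *: "b \<in> flt m" "wt (Suc m) c" "v = b \<oplus> c" by auto
  then have "act d0 v = act d0 b \<oplus> act d0 c" by (simp add: flt_carrier wt_carrier act_add_right)
  then show ?case using * Suc.IH[of b] wt.smult[of "Suc m" c] by (auto simp: wt_d0)
qed (simp add: wt.smult wt_d0)

lemma flt_Suc: "v \<in> flt m \<Longrightarrow> v \<in> flt (Suc m)"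
  using wt.zero[of "Suc m"] flt_carrier[of v m] by force

lemma flt_mono: "\<lbrakk>v \<in> flt m; m \<le> k\<rbrakk> \<Longrightarrow> v \<in> flt k"
  by (induction k) (auto simp: le_Suc_eq simp del: flt.simps intro: flt_Suc)

lemma flt_zero: "\<zero> \<in> flt m"
  by (induction m) (auto intro: wt.zero intro!: exI[of _ \<zero>])

lemma wt_flt: "wt n v \<Longrightarrow> v \<in> flt n"
proof (cases n)
  case (Suc m)
  assume "wt n v"
  then have "v = \<zero> \<oplus> v" by (simp add: wt_carrier)
  then show ?thesis using \<open>wt n v\<close> flt_zero[of m] unfolding Suc by auto
qed simp

lemma flt_exists:
  assumes "v \<in> carrier V"
  obtains m where "v \<in> flt m"
proof -
  have "\<exists>m. v \<in> flt m" using assms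
  proof (induction v rule: wt_sum_induct)
    case (wt n v)
    then show ?case using wt_flt by blast
  next
    case (add v w)
    then obtain m k where "v \<in> flt m" "w \<in> flt k" by blast
    then have "v \<oplus> w \<in> flt (max m k)" by (intro flt_add) (auto elim: flt_mono)
    then show ?case by blast
  qed
  then show ?thesis using that by blast
qed

text \<open>The operator \<open>d0\<close> minus the weight of depth \<open>Suc m\<close> deletes
  the component of that depth.\<close>

lemma flt_shift:
  assumes a: "a \<in> carrier V" and b: "wt (Suc m) b"
  shows "act d0 (a \<oplus> b) \<oplus> (- (hw - of_nat (Suc m))) \<odot> (a \<oplus> b) = act d0 a \<oplus> (- (hw - of_nat (Suc m))) \<odot> a"
proof -
  let ?c = "hw - of_nat (Suc m)"
  note bV = wt_carrier[OF b]
  have "act d0 (a \<oplus> b) \<oplus> (- ?c) \<odot> (a \<oplus> b) = (act d0 a \<oplus> (- ?c) \<odot> a) \<oplus> (?c \<odot> b \<oplus> (- ?c) \<odot> b)"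
    using a bV by (simp add: act_add_right V.smult_add_right wt_d0[OF b] act_closed V.a_ac del: of_nat_Suc)
  also have "?c \<odot> b \<oplus> (- ?c) \<odot> b = \<zero>"
    using V.smult_add_left[OF bV, of ?c "- ?c"] bV by simp
  finally show ?thesis using a by (simp add: act_closed)
qed

text \<open>The operator of \<open>flt_shift\<close> keeps the vector in \<open>N\<close>, lowers
  its filtration degree and multiplies \<open>l\<close> by \<open>Suc m\<close>, which is nonzero;
  repeated, it leaves a vector of depth 0.\<close>

lemma top_component:
  assumes N: "subspace class_ring N V" and D: "\<And>v. v \<in> N \<Longrightarrow> act d0 v \<in> N"
    and "v \<in> flt m" "v \<in> N"
  shows "l v \<odot> v0 \<in> N"
  using assms(3,4)
proof (induction m arbitrary: v)
  case 0
  then show ?case using wt_l[of 0 v] by simp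
next
  case (Suc m)
  then obtain a b where ab: "a \<in> flt m" "wt (Suc m) b" "v = a \<oplus> b" by auto
  note c = flt_carrier[OF ab(1)] wt_carrier[OF ab(2)]
  let ?c = "- (hw - of_nat (Suc m))"
  let ?w = "act d0 a \<oplus> ?c \<odot> a"
  have "?w \<in> N"
    unfolding flt_shift[OF c(1) ab(2), symmetric] ab(3)[symmetric]
    using Suc.prems D by (intro V.subspace_add[OF N] V.subspace_smult[OF N]) auto
  moreover have "?w \<in> flt m" using ab(1) by (intro flt_add flt_smult flt_d0)
  ultimately have "l ?w \<odot> v0 \<in> N" by (intro Suc.IH)
  moreover have "l ?w = of_nat (Suc m) * l a"
    using c by (simp add: l_add act_closed l_smult l_d0 algebra_simps)
  ultimately have "of_nat (Suc m) \<odot> (l a \<odot> v0) \<in> N" by simp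
  then have "l a \<odot> v0 \<in> N"
    by (rule V.subspace_smult_cancel[OF N, rotated]) (simp_all del: of_nat_Suc)
  moreover have "l v = l a" using ab c wt_l[OF ab(2)] by (simp add: l_add)
  ultimately show ?case by simp
qed

text \<open>The operator of \<open>flt_shift\<close> acts on an eigenvector as a scalar. If that
  scalar is nonzero, the vector already lies in the smaller filtration step; if it is zero, the
  shallower part \<open>a\<close> is itself an eigenvector.\<close>

lemma eigenvector:
  assumes "v \<in> flt m" "act d0 v = \<mu> \<odot> v"
  shows "v = \<zero> \<or> (\<exists>n. \<mu> = hw - of_nat n \<and> n \<le> m \<and> wt n v)"
  using assms
proof (induction m arbitrary: v)
  case 0
  then have v: "wt 0 v" "v \<in> carrier V" by (auto simp: wt_carrier)
  have "(\<mu> - hw) \<odot> v = \<mu> \<odot> v \<oplus> (- hw) \<odot> v" using V.smult_add_left[OF v(2), of \<mu> "- hw"] by simp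
  also have "\<dots> = hw \<odot> v \<oplus> (- hw) \<odot> v" using 0(2) wt_d0[OF v(1)] by simp
  also have "\<dots> = \<zero>" using V.smult_add_left[OF v(2), of hw "- hw"] v by simp
  finally show ?case using V.smult_eq_0[OF v(2)] v(1) by (cases "\<mu> = hw") auto
next
  case (Suc m)
  then obtain a b where ab: "a \<in> flt m" "wt (Suc m) b" "v = a \<oplus> b" by auto
  note c = flt_carrier[OF ab(1)] wt_carrier[OF ab(2)]
  have vV: "v \<in> carrier V" using ab c by simp
  let ?c = "- (hw - of_nat (Suc m))"
  have eq: "(\<mu> + ?c) \<odot> v = act d0 a \<oplus> ?c \<odot> a"
    using flt_shift[OF c(1) ab(2)] Suc.prems(2) vV by (simp only: ab(3)[symmetric] V.smult_add_left)
  show ?case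
  proof (cases "\<mu> = hw - of_nat (Suc m)")
    case False
    then have "\<mu> + ?c \<noteq> 0" by (simp add: algebra_simps)
    then have "v = inverse (\<mu> + ?c) \<odot> ((\<mu> + ?c) \<odot> v)" using vV by simp
    also have "\<dots> \<in> flt m" unfolding eq using ab(1) by (intro flt_smult flt_add flt_d0)
    finally show ?thesis using Suc.IH Suc.prems(2) by (meson le_SucI)
  next
    case True
    then have "act d0 a \<oplus> (- \<mu>) \<odot> a = \<zero>" using eq vV by simp
    then have "act d0 a \<oplus> (- 1) \<odot> (\<mu> \<odot> a) = \<zero>" using c by simp
    then have "act d0 a = \<mu> \<odot> a" using c by (subst V.eq_iff_diff) (auto intro: act_closed)
    \<comment> \<open>The bound \<open>n \<le> m\<close> in the induction hypothesis enters here: a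
      nonzero \<open>a\<close> would have weight \<open>hw - n\<close> with
      \<open>n \<le> m\<close>, but \<open>\<mu>\<close> is \<open>hw - Suc m\<close>.\<close>
    then have "a = \<zero>" using Suc.IH[OF ab(1)] True by (auto simp del: of_nat_Suc)
    then show ?thesis using ab c True by auto
  qed
qed

lemma weight_space_cases:
  assumes "v \<in> weight_space V act \<mu>"
  shows "v = \<zero> \<or> (\<exists>n. \<mu> = hw - of_nat n \<and> wt n v)"
proof -
  have "v \<in> carrier V" "act d0 v = \<mu> \<odot> v" using assms by (auto simp: weight_space_def)
  then show ?thesis using eigenvector by (metis flt_exists)
qed

lemma wt_weight_space: "wt n v \<Longrightarrow> v \<in> weight_space V act (hw - of_nat n)"
  by (simp add: weight_space_def wt_carrier wt_d0)

section \<open>The maximal proper submodule\<close>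

lemma foldr_act_linear:
  assumes "us \<in> lists (carrier loop_vir)"
  shows "v \<in> carrier V \<Longrightarrow> foldr act us v \<in> carrier V"
    and "\<lbrakk>v \<in> carrier V; w \<in> carrier V\<rbrakk> \<Longrightarrow> foldr act us (v \<oplus> w) = foldr act us v \<oplus> foldr act us w"
    and "v \<in> carrier V \<Longrightarrow> foldr act us (a \<odot> v) = a \<odot> foldr act us v"
proof -
  show cl: "v \<in> carrier V \<Longrightarrow> foldr act us v \<in> carrier V" for v
    using assms by (induction us rule: list.induct) (auto intro: act_closed)
  have cl': "set us \<subseteq> carrier loop_vir \<Longrightarrow> v \<in> carrier V \<Longrightarrow> foldr act us v \<in> carrier V" for us v
    by (induction us) (auto intro: act_closed)
  show "\<lbrakk>v \<in> carrier V; w \<in> carrier V\<rbrakk> \<Longrightarrow> foldr act us (v \<oplus> w) = foldr act us v \<oplus> foldr act us w"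
    using assms by (induction us rule: list.induct) (auto simp: act_add_right cl' subset_eq)
  show "v \<in> carrier V \<Longrightarrow> foldr act us (a \<odot> v) = a \<odot> foldr act us v"
    using assms by (induction us rule: list.induct) (auto simp: act_smult_right cl' subset_eq)
qed

text \<open>The words \<open>us\<close> stand for a spanning set of the enveloping algebra, so
  closure under the action amounts to appending a letter.\<close>

definition rad :: "'v set" where
  "rad = {v \<in> carrier V. \<forall>us\<in>lists (carrier loop_vir). l (foldr act us v) = 0}"

lemma rad_l: "v \<in> rad \<Longrightarrow> l v = 0"
proof -
  assume "v \<in> rad"
  then have "l (foldr act [] v) = 0" unfolding rad_def by blast
  then show ?thesis by simp
qed

lemma rad_submodule: "lie_submodule loop_vir V act rad"
proof (rule lie_submoduleI)
  have "foldr act us \<zero> = \<zero>" if "us \<in> lists (carrier loop_vir)" for us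
    using foldr_act_linear(3)[OF that, of \<zero> 0] foldr_act_linear(1)[OF that, of \<zero>] by simp
  then show "\<zero> \<in> rad" by (simp add: rad_def)
  show "act x v \<in> rad" if "x \<in> carrier loop_vir" "v \<in> rad" for x v
  proof -
    have "l (foldr act us (act x v)) = 0" if "us \<in> lists (carrier loop_vir)" for us
    proof -
      have "us @ [x] \<in> lists (carrier loop_vir)" using that \<open>x \<in> carrier loop_vir\<close> by simp
      then have "l (foldr act (us @ [x]) v) = 0" using \<open>v \<in> rad\<close> unfolding rad_def by blast
      then show ?thesis by simp
    qed
    then show ?thesis using that by (simp add: rad_def act_closed)
  qed
qed (auto simp: rad_def foldr_act_linear l_add l_smult)

text \<open>By \<open>top_component\<close>, a submodule on which \<open>l\<close> does not vanish
  contains \<open>v0\<close> and is the whole module.\<close>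

lemma proper_submodule_rad:
  assumes N: "lie_submodule loop_vir V act N" and "N \<noteq> carrier V"
  shows "N \<subseteq> rad"
proof
  note S = submodule_subspace[OF N]
  fix v assume v: "v \<in> N"
  have l0: "l w = 0" if w: "w \<in> N" for w
  proof (rule ccontr)
    assume "l w \<noteq> 0"
    obtain m where "w \<in> flt m" using flt_exists V.subspace_mem[OF S w] by blast
    then have "l w \<odot> v0 \<in> N" using top_component[OF S] submodule_act[OF N d0_carrier] w by blast
    then have "v0 \<in> N" using V.subspace_smult_cancel[OF S v0] \<open>l w \<noteq> 0\<close> by blast
    then show False using generated[OF N] assms(2) by blast
  qed
  have "foldr act us v \<in> N" if "us \<in> lists (carrier loop_vir)" for us
    using that v by (induction us rule: list.induct) (auto intro: submodule_act[OF N])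
  then show "v \<in> rad" using l0 V.subspace_mem[OF S v] by (simp add: rad_def)
qed

lemma rad_proper: "rad \<noteq> carrier V"
  using rad_l[of v0] l_v0 v0 by (metis zero_neq_one)

text \<open>Provides existence and uniqueness for the definite description in
  \<open>verma_radical\<close>.\<close>

lemma maximal_proper_submodule_iff: "maximal_proper_submodule loop_vir V act N \<longleftrightarrow> N = rad"
  unfolding maximal_proper_submodule_def
  using rad_submodule rad_proper proper_submodule_rad by blast

end

locale irreducible_hw_module = hw_module +
  assumes irreducible: "lie_submodule loop_vir V act N \<Longrightarrow> N \<noteq> carrier V \<Longrightarrow> N = {\<zero>}"
begin

lemma rad_eq: "rad = {\<zero>}"
  using irreducible[OF rad_submodule rad_proper] .

end

section \<open>The irreducible quotient\<close>

context hw_module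
begin

text \<open>The functional descends because \<open>l\<close> vanishes on \<open>rad\<close>.
  Submodules of the quotient are handled through their preimages: that of a proper one lies in
  \<open>rad\<close>, so the submodule is zero.\<close>

lemma quot_hw_module:
  "\<exists>l'. irreducible_hw_module \<phi> (quot_module V rad) (\<lambda>x. quot_map V rad (act x)) (rad +> v0) l'"
proof -
  let ?Q = "quot_module V rad" and ?act = "\<lambda>x. quot_map V rad (act x)"
  note S = submodule_subspace[OF rad_submodule]
  note qact = quot_act[OF rad_submodule]
  interpret Q: lie_module loop_vir ?Q ?act by (rule quot_lie_module[OF rad_submodule])
  define l' where "l' X = l (SOME v. v \<in> carrier V \<and> X = rad +> v)" for X
  have l': "l' (rad +> v) = l v" if v: "v \<in> carrier V" for v
  proof -
    let ?w = "SOME w. w \<in> carrier V \<and> rad +> v = rad +> w"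
    have w: "?w \<in> carrier V \<and> rad +> v = rad +> ?w" by (rule someI[of _ v]) (use v in simp)
    then have "l (v \<oplus> (-1) \<odot> ?w) = 0" using V.coset_eq_iff[OF S v, of ?w] by (intro rad_l) simp
    then show ?thesis using v w by (simp add: l'_def l_add l_smult)
  qed
  have pre: "lie_submodule loop_vir V act {v \<in> carrier V. rad +> v \<in> N}" if N: "lie_submodule loop_vir ?Q ?act N" for N
  proof (rule lie_submoduleI)
    note SN = Q.submodule_subspace[OF N]
    have z: "rad +> \<zero> = rad" using V.coset_eq_self_iff[OF S] V.subspace_0[OF S] by simp
    show "\<zero> \<in> {v \<in> carrier V. rad +> v \<in> N}" using Q.V.subspace_0[OF SN] by (simp add: V.quot_zero[OF S] z)
    show "\<And>v w. \<lbrakk>v \<in> {v \<in> carrier V. rad +> v \<in> N}; w \<in> {v \<in> carrier V. rad +> v \<in> N}\<rbrakk> \<Longrightarrow> v \<oplus> w \<in> {v \<in> carrier V. rad +> v \<in> N}"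
      using Q.V.subspace_add[OF SN] by (auto simp flip: V.quot_add[OF S])
    show "\<And>a v. v \<in> {v \<in> carrier V. rad +> v \<in> N} \<Longrightarrow> a \<odot> v \<in> {v \<in> carrier V. rad +> v \<in> N}"
      using Q.V.subspace_smult[OF SN] by (auto simp flip: V.quot_smult[OF S])
    show "\<And>x v. \<lbrakk>x \<in> carrier loop_vir; v \<in> {v \<in> carrier V. rad +> v \<in> N}\<rbrakk> \<Longrightarrow> act x v \<in> {v \<in> carrier V. rad +> v \<in> N}"
      using Q.submodule_act[OF N] by (auto simp flip: qact intro: act_closed)
  qed auto
  have "irreducible_hw_module \<phi> ?Q ?act (rad +> v0) l'"
  proof unfold_locales
    show "rad +> v0 \<in> carrier ?Q" by (rule V.quot_carrierI[OF S v0])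
    show "?act x (rad +> v0) = \<psi> x \<odot>\<^bsub>?Q\<^esub> (rad +> v0)" if "x \<in> loop_part {0..}" for x
      using that by (simp add: qact loop_part_carrier act_v0 V.quot_smult[OF S])
    show "N = carrier ?Q" if N: "lie_submodule loop_vir ?Q ?act N" and "rad +> v0 \<in> N" for N
    proof -
      have "{v \<in> carrier V. rad +> v \<in> N} = carrier V"
        by (rule generated[OF pre[OF N]]) (use that in simp)
      then show ?thesis using Q.V.subspace_sub[OF Q.submodule_subspace[OF N]]
        by (auto simp: V.quot_carrier[OF S])
    qed
    show "\<And>v w. \<lbrakk>v \<in> carrier ?Q; w \<in> carrier ?Q\<rbrakk> \<Longrightarrow> l' (v \<oplus>\<^bsub>?Q\<^esub> w) = l' v + l' w"
      by (auto elim!: V.quot_carrierE[OF S] simp: V.quot_add[OF S] l' l_add)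
    show "\<And>v a. v \<in> carrier ?Q \<Longrightarrow> l' (a \<odot>\<^bsub>?Q\<^esub> v) = a * l' v"
      by (auto elim!: V.quot_carrierE[OF S] simp: V.quot_smult[OF S] l' l_smult)
    show "l' (rad +> v0) = 1" by (simp add: l' l_v0)
    show "\<And>x v. \<lbrakk>x \<in> loop_part {..<0}; v \<in> carrier ?Q\<rbrakk> \<Longrightarrow> l' (?act x v) = 0"
      by (auto elim!: V.quot_carrierE[OF S] simp: qact l' l_act_neg loop_part_carrier act_closed)
    show "N = {\<zero>\<^bsub>?Q\<^esub>}" if N: "lie_submodule loop_vir ?Q ?act N" and ne: "N \<noteq> carrier ?Q" for N
    proof -
      have "{v \<in> carrier V. rad +> v \<in> N} \<noteq> carrier V"
      proof
        assume *: "{v \<in> carrier V. rad +> v \<in> N} = carrier V"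
        have "carrier ?Q \<subseteq> N" using * by (auto simp: V.quot_carrier[OF S])
        then show False using ne Q.V.subspace_sub[OF Q.submodule_subspace[OF N]] by blast
      qed
      then have "{v \<in> carrier V. rad +> v \<in> N} \<subseteq> rad" by (rule proper_submodule_rad[OF pre[OF N]])
      then have "X = \<zero>\<^bsub>?Q\<^esub>" if "X \<in> N" for X
      proof -
        obtain v where v: "v \<in> carrier V" "X = rad +> v"
          using V.quot_carrierE[OF S] Q.V.subspace_mem[OF Q.submodule_subspace[OF N] \<open>X \<in> N\<close>] by blast
        then have "v \<in> rad" using \<open>X \<in> N\<close> \<open>_ \<subseteq> rad\<close> by blast
        then show ?thesis using v V.coset_eq_self_iff[OF S v(1)] by (simp add: V.quot_zero[OF S])
      qed
      then show ?thesis using Q.V.subspace_0[OF Q.submodule_subspace[OF N]] by blast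
    qed
  qed
  then show ?thesis by blast
qed

end

section \<open>The module of the theorem as an irreducible highest weight module\<close>

context loop_character
begin

lemma hw_irreducible: "\<exists>v0 l. irreducible_hw_module \<phi> (hw_space \<phi>) (hw_act \<phi>) v0 l"
proof -
  have neg: "x \<in> loop_part {..<0} \<Longrightarrow> restrict_deg {0..} x = \<zero>\<^bsub>loop_vir\<^esub>" for x
    by (auto simp: restrict_deg_eq_0 loop_part_def)
  obtain l where l: "\<And>v w. \<lbrakk>v \<in> carrier IC.Ind; w \<in> carrier IC.Ind\<rbrakk> \<Longrightarrow> l (v \<oplus>\<^bsub>IC.Ind\<^esub> w) = l v + l w"
    "\<And>a v. v \<in> carrier IC.Ind \<Longrightarrow> l (a \<odot>\<^bsub>IC.Ind\<^esub> v) = a * l v" "l (IC.tens 1) = 1"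
    "\<And>x v. \<lbrakk>x \<in> carrier loop_vir; restrict_deg {0..} x = \<zero>\<^bsub>loop_vir\<^esub>; v \<in> carrier IC.Ind\<rbrakk> \<Longrightarrow> l (IC.ind_act x v) = 0"
    using IC.ind_functional by blast
  interpret I: lie_module loop_vir IC.Ind IC.ind_act by (rule IC.lie_module_Ind)
  interpret M: hw_module \<phi> IC.Ind IC.ind_act "IC.tens 1" l
    by unfold_locales (use IC.one_free_alg l IC.ind_act_H IC.ind_generated neg loop_part_carrier in auto)
  have "verma_radical \<phi> = M.rad"
    unfolding verma_radical_def verma_eq M.maximal_proper_submodule_iff by simp
  then have "hw_space \<phi> = quot_module IC.Ind M.rad" "hw_act \<phi> = (\<lambda>x. quot_map IC.Ind M.rad (IC.ind_act x))"
    by (simp_all add: hw_space_def hw_act_def verma_eq fun_eq_iff)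
  then show ?thesis using M.quot_hw_module by metis
qed

end

section \<open>Laurent polynomials\<close>

lemma cring_laurent: "cring laurent_algebra"
proof (rule cring.intro)
  show "ring laurent_algebra" unfolding laurent_algebra_def by (rule ring_monoid_algebra) auto
  then interpret ring laurent_algebra .
  show "comm_monoid laurent_algebra"
    by (rule monoid_comm_monoidI) (simp_all add: laurent_simps mult.commute)
qed

interpretation LA: cvectorspace laurent_algebra by (rule cvectorspace_laurent)
interpretation LA: cring laurent_algebra by (rule cring_laurent)

lemma laurent_ideal_eq: "laurent_ideal P = {f. laurent_of_poly P dvd f}"
  using LA.cgenideal_eq_genideal[of "laurent_of_poly P"]
  by (auto simp: laurent_ideal_def cgenideal_def laurent_simps dvd_def mult.commute)

lemma ideal_laurent_ideal: "ideal (laurent_ideal P) laurent_algebra"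
  unfolding laurent_ideal_def by (rule LA.genideal_ideal) (simp add: laurent_simps)

lemma subspace_laurent_ideal: "subspace class_ring (laurent_ideal P) laurent_algebra"
  by (rule LA.subspaceI) (auto simp: laurent_ideal_eq laurent_simps)

lemma laurent_induct [case_names add monom]:
  assumes "\<And>f g. P f \<Longrightarrow> P g \<Longrightarrow> P (f + g)" and "\<And>k a. P (cst a * Poly_Mapping.single k 1)"
  shows "P (f :: laurent)"
proof -
  have "Poly_Mapping.keys f \<subseteq> UNIV" by simp
  then show ?thesis
  proof (induction f rule: free_space_induct)
    case zero
    show ?case using assms(2)[of 0 0] by simp
  next
    case (single x a)
    show ?case using assms(2)[of a x] by (simp add: mult_single)
  qed (simp add: assms(1))
qed

lemma lookup_laurent_of_poly:
  "Poly_Mapping.lookup (laurent_of_poly P) k = (if k < 0 then 0 else coeff P (nat k))"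
proof -
  have "Poly_Mapping.lookup (laurent_of_poly P) k = (\<Sum>n\<le>degree P. if int n = k then coeff P n else 0)"
    by (simp add: laurent_of_poly_def lookup_sum lookup_single when_def)
  also have "\<dots> = (if k < 0 then 0 else coeff P (nat k))"
  proof (cases "k < 0")
    case False
    then have "(\<Sum>n\<le>degree P. if int n = k then coeff P n else 0) = (\<Sum>n\<le>degree P. if n = nat k then coeff P n else 0)"
      by (intro sum.cong) auto
    also have "\<dots> = coeff P (nat k)" using coeff_eq_0[of P "nat k"] by (auto simp: sum.delta)
    finally show ?thesis using False by simp
  qed (auto intro: sum.neutral)
  finally show ?thesis .
qed

lemma lookup_monom_mult:
  "Poly_Mapping.lookup (Poly_Mapping.single m 1 * f) k = Poly_Mapping.lookup (f :: laurent) (k - m)"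
  by (induction f rule: laurent_induct)
     (auto simp: distrib_left lookup_add mult_single lookup_single when_def)

lemma laurent_eq_monom_poly:
  assumes "f \<noteq> (0 :: laurent)"
  obtains m P where "f = Poly_Mapping.single m 1 * laurent_of_poly P" "coeff P 0 \<noteq> 0"
proof -
  \<comment> \<open>The lowest exponent of \<open>f\<close>; its coefficient becomes the constant
    term of \<open>P\<close>.\<close>
  define m where "m = Min (Poly_Mapping.keys f)"
  have ne: "Poly_Mapping.keys f \<noteq> {}" using assms by simp
  define P where "P = Abs_poly (\<lambda>n. Poly_Mapping.lookup f (m + int n))"
  have "finite {n. Poly_Mapping.lookup f (m + int n) \<noteq> 0}"
  proof (rule finite_imageD)
    show "finite ((\<lambda>n. m + int n) ` {n. Poly_Mapping.lookup f (m + int n) \<noteq> 0})"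
      by (rule finite_subset[of _ "Poly_Mapping.keys f"]) (auto simp: in_keys_iff)
  qed (auto simp: inj_on_def)
  then have P: "coeff P n = Poly_Mapping.lookup f (m + int n)" for n
    unfolding P_def by (subst Abs_poly_inverse) (auto simp: eventually_cofinite MOST_iff_cofinite)
  have "f = Poly_Mapping.single m 1 * laurent_of_poly P"
  proof (rule poly_mapping_eqI)
    fix k
    have "k \<notin> Poly_Mapping.keys f" if "k < m" using that by (metis Min_le finite_keys m_def not_le)
    then show "Poly_Mapping.lookup f k = Poly_Mapping.lookup (Poly_Mapping.single m 1 * laurent_of_poly P) k"
      by (auto simp: lookup_monom_mult lookup_laurent_of_poly P in_keys_iff)
  qed
  moreover have "coeff P 0 \<noteq> 0"
    using Min_in[OF _ ne] by (simp add: P m_def in_keys_iff)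
  ultimately show ?thesis using that by blast
qed

text \<open>Division with remainder, phrased as membership in a subspace \<open>M\<close>. Multiples
  of \<open>P\<close> lower high powers of \<open>t\<close> through the leading coefficient and
  raise negative powers through the constant term.\<close>

lemma laurent_division:
  assumes P: "coeff P 0 \<noteq> 0"
    and add: "\<And>f g. \<lbrakk>f \<in> M; g \<in> M\<rbrakk> \<Longrightarrow> f + g \<in> M" and smult: "\<And>a f. f \<in> M \<Longrightarrow> cst a * f \<in> M"
    and low: "\<And>j. j < degree P \<Longrightarrow> Poly_Mapping.single (int j) 1 \<in> M"
    and ideal: "\<And>f. laurent_of_poly P dvd f \<Longrightarrow> f \<in> M"
  shows "f \<in> M"
proof -
  let ?t = "\<lambda>k. Poly_Mapping.single k (1::complex)"
  have sum: "(\<Sum>n\<in>S. cst (c n) * h n) \<in> M" if "\<And>n. n \<in> S \<Longrightarrow> h n \<in> M" for S :: "nat set" and c h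
    using that by (induction S rule: infinite_finite_induct) (auto intro: add smult ideal)
  have exp: "?t k * laurent_of_poly P = (\<Sum>n\<le>degree P. cst (coeff P n) * ?t (k + int n))" for k
    by (simp add: laurent_of_poly_def sum_distrib_left mult_single)
  \<comment> \<open>The multiple \<open>t^k P\<close> expresses one of its monomials through the
    others. The two uses are \<open>e = degree P\<close> for nonnegative powers and
    \<open>e = 0\<close> for negative ones.\<close>
  have solve: "?t (k + int e) \<in> M" if e: "e \<le> degree P" "coeff P e \<noteq> 0"
    and others: "\<And>n. n \<le> degree P \<Longrightarrow> n \<noteq> e \<Longrightarrow> ?t (k + int n) \<in> M" for k e
  proof -
    have "?t k * laurent_of_poly P = cst (coeff P e) * ?t (k + int e) +
      (\<Sum>n\<in>{..degree P} - {e}. cst (coeff P n) * ?t (k + int n))"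
      unfolding exp using e by (subst sum.remove[of _ e]) auto
    then have "cst (coeff P e) * ?t (k + int e) = ?t k * laurent_of_poly P +
      cst (-1) * (\<Sum>n\<in>{..degree P} - {e}. cst (coeff P n) * ?t (k + int n))"
      using cst_add[of 1 "-1"] by (simp add: single_uminus)
    also have "\<dots> \<in> M" using others by (intro add[OF ideal smult[OF sum]]) auto
    finally have "cst (inverse (coeff P e)) * (cst (coeff P e) * ?t (k + int e)) \<in> M" by (rule smult)
    then show ?thesis using e by (simp add: mult_single)
  qed
  have nonneg: "?t (int k) \<in> M" for k
  proof (induction k rule: less_induct)
    case (less k)
    show ?case
    proof (cases "k < degree P")
      case False
      have "?t (int (k - degree P) + int (degree P)) \<in> M"
      proof (rule solve)
        show "coeff P (degree P) \<noteq> 0" using P by auto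
        fix n assume "n \<le> degree P" "n \<noteq> degree P"
        then have "?t (int (k - degree P + n)) \<in> M" using False by (intro less) auto
        then show "?t (int (k - degree P) + int n) \<in> M" by simp
      qed simp
      then show ?thesis using False by (simp add: of_nat_diff)
    qed (rule low)
  qed
  have neg: "?t (- int k) \<in> M" for k
  proof (induction k rule: less_induct)
    case (less k)
    have "?t (- int k + int 0) \<in> M"
    proof (rule solve)
      fix n :: nat assume "n \<noteq> 0"
      show "?t (- int k + int n) \<in> M"
      proof (cases "n \<le> k")
        case True
        then have "?t (- int (k - n)) \<in> M" using \<open>n \<noteq> 0\<close> by (intro less) simp
        then show ?thesis using True by (simp add: of_nat_diff)
      next
        case False
        then show ?thesis using nonneg[of "n - k"] by (simp add: of_nat_diff)
      qed
    qed (use P in auto)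
    then show ?case by simp
  qed
  have t: "?t k \<in> M" for k
    by (cases k rule: int_cases2) (use nonneg neg in auto)
  show ?thesis
    by (induction f rule: laurent_induct) (auto intro: add smult t)
qed

section \<open>The annihilator\<close>

text \<open>The ideal \<open>Vir \<otimes> (Q)\<close> of the loop algebra, where \<open>(Q)\<close>
  consists of the multiples of \<open>Q\<close>.\<close>

definition coeffs_in :: "laurent \<Rightarrow> loop_elt set" where
  "coeffs_in Q = {x \<in> carrier loop_vir. \<forall>p. Q dvd x p}"

lemma coeffs_in_br:
  assumes x: "x \<in> coeffs_in Q" and y: "y \<in> carrier loop_vir"
  shows "lie_br loop_vir x y \<in> coeffs_in Q" "lie_br loop_vir y x \<in> coeffs_in Q"
proof -
  have fin: "finite {p. x p \<noteq> 0}" "finite {p. y p \<noteq> 0}" using x y by (auto simp: coeffs_in_def loop_simps)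
  have "Q dvd a * (x p * b)" "Q dvd a * (b * x p)" for a b p
    using x by (simp_all add: coeffs_in_def)
  then show "lie_br loop_vir x y \<in> coeffs_in Q" "lie_br loop_vir y x \<in> coeffs_in Q"
    using x y loop_br[OF fin(1) order_refl fin(2) order_refl] loop_br[OF fin(2) order_refl fin(1) order_refl]
    by (auto simp: coeffs_in_def loop_br_closed intro!: dvd_sum)
qed

context loop_character
begin

lemma annihilating_laurent:
  assumes P: "annihilating_poly \<phi> P"
  shows "\<phi> (ptensor (VD 0) (laurent_of_poly P * f)) = 0" "\<phi> (ptensor VC (laurent_of_poly P * f)) = 0"
proof -
  have *: "\<phi> (ptensor p (laurent_of_poly P * f)) = 0" if p: "vir_deg p = 0"
    and 0: "\<And>k. \<phi> (ptensor p (Poly_Mapping.single k 1 * laurent_of_poly P)) = 0" for p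
  proof (induction f rule: laurent_induct)
    case (add f g)
    then show ?case using p by (simp add: distrib_left ptensor_add \<phi>_add ptensor_part)
  next
    case (monom k a)
    have "laurent_of_poly P * (cst a * Poly_Mapping.single k 1) = cst a * (Poly_Mapping.single k 1 * laurent_of_poly P)"
      by (simp only: mult_ac)
    then show ?case using p 0 by (simp only: ptensor_smult) (simp add: \<phi>_smult ptensor_part)
  qed
  show "\<phi> (ptensor (VD 0) (laurent_of_poly P * f)) = 0" "\<phi> (ptensor VC (laurent_of_poly P * f)) = 0"
    using P by (auto simp: annihilating_poly_def intro!: *)
qed

lemma annihilating_\<psi>:
  assumes P: "annihilating_poly \<phi> P" and x: "x \<in> coeffs_in (laurent_of_poly P)"
  shows "\<psi> x = 0"
proof -
  obtain f g where fg: "x (VD 0) = laurent_of_poly P * f" "x VC = laurent_of_poly P * g"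
    using x unfolding coeffs_in_def dvd_def by blast
  have "restrict_deg {0} x = ptensor (VD 0) (x (VD 0)) \<oplus>\<^bsub>loop_vir\<^esub> ptensor VC (x VC)"
  proof
    fix p show "restrict_deg {0} x p = (ptensor (VD 0) (x (VD 0)) \<oplus>\<^bsub>loop_vir\<^esub> ptensor VC (x VC)) p"
      by (cases p) (auto simp: restrict_deg_def ptensor_def loop_simps)
  qed
  then show ?thesis
    using annihilating_laurent[OF P] by (simp add: \<psi>_def \<phi>_add ptensor_part fg)
qed

end

context irreducible_hw_module
begin

lemma eq_zeroI:
  "\<lbrakk>v \<in> carrier V; \<And>us. us \<in> lists (carrier loop_vir) \<Longrightarrow> l (foldr act us v) = 0\<rbrakk> \<Longrightarrow> v = \<zero>"
  using rad_eq unfolding rad_def by blast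

text \<open>To see that \<open>l\<close> kills \<open>act x v\<close>, commute \<open>x\<close> to
  the right until it meets \<open>v0\<close>, where \<open>annihilating_\<psi>\<close> applies; the
  terms headed by a lowering operator vanish under \<open>l\<close>. An arbitrary word in front is
  then handled by moving \<open>x\<close> leftwards through it, and irreducibility turns vanishing
  of \<open>l\<close> on all words into vanishing of the vector.\<close>

lemma annihilating_act:
  assumes P: "annihilating_poly \<phi> P" and x: "x \<in> coeffs_in (laurent_of_poly P)" and v: "v \<in> carrier V"
  shows "act x v = \<zero>"
proof -
  let ?K = "coeffs_in (laurent_of_poly P)"
  have K: "x \<in> carrier loop_vir" if "x \<in> ?K" for x using that by (simp add: coeffs_in_def)
  have wt: "wt n v \<Longrightarrow> x \<in> ?K \<Longrightarrow> l (act x v) = 0" for n v x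
  proof (induction arbitrary: x rule: wt.induct)
    case (top x)
    let ?y = "restrict_deg {0..} x" and ?z = "restrict_deg {..<0} x"
    have y: "?y \<in> loop_part {0..}" "?z \<in> loop_part {..<0}" using K[OF top] by (auto intro: restrict_deg_part)
    have "x = ?y \<oplus>\<^bsub>loop_vir\<^esub> ?z" by (auto simp: restrict_deg_def loop_simps)
    then have "l (act x v0) = l (act (?y \<oplus>\<^bsub>loop_vir\<^esub> ?z) v0)" by simp
    also have "\<dots> = \<psi> ?y"
      using y by (simp add: act_add_left loop_part_carrier l_add act_closed act_v0 l_smult l_v0 l_act_neg)
    also have "\<psi> ?y = \<psi> x" by (simp add: \<psi>_def restrict_deg_restrict)
    finally show ?case using annihilating_\<psi>[OF P top] by simp
  next
    case (zero n x)
    then show ?case using K by simp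
  next
    case (lower n v k y x)
    note c = K[OF lower.prems] loop_part_carrier[OF lower.hyps(3)] wt_carrier[OF lower.hyps(1)]
    have "l (act (lie_br loop_vir x y) v) = 0"
      by (rule lower.IH, rule coeffs_in_br(1)[OF lower.prems c(2)])
    moreover have "l (act y (act x v)) = 0"
      using lower.hyps(2) c by (intro l_act_neg loop_part_single[OF lower.hyps(3)] act_closed) auto
    ultimately show ?case using act_swap[OF c] c by (simp add: l_add act_closed loop_br_closed)
  qed (simp_all add: act_add_right act_smult_right K wt_carrier l_add l_smult act_closed)
  have l0: "l (act x v) = 0" if "x \<in> ?K" "v \<in> carrier V" for x v
    using that(2) by (induction v rule: wt_sum_induct) (use that(1) in \<open>simp_all add: wt act_add_right K l_add act_closed\<close>)
  \<comment> \<open>The induction removes the letter next to \<open>x\<close>. Its commutator with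
    \<open>x\<close> stays in the ideal, so the hypothesis must be general in both \<open>x\<close>
    and \<open>v\<close>.\<close>
  have "l (foldr act us (act x v)) = 0" if "us \<in> lists (carrier loop_vir)" "x \<in> ?K" "v \<in> carrier V" for us x v
    using that
  proof (induction us arbitrary: x v rule: rev_induct)
    case Nil
    then show ?case by (simp add: l0)
  next
    case (snoc y us)
    then have c: "y \<in> carrier loop_vir" "x \<in> carrier loop_vir" "us \<in> lists (carrier loop_vir)" using K by auto
    have "lie_br loop_vir y x \<in> ?K" using coeffs_in_br[OF snoc.prems(2) c(1)] by simp
    then have "l (foldr act us (act (lie_br loop_vir y x) v)) = 0" "l (foldr act us (act x (act y v))) = 0"
      using snoc.IH[OF c(3)] snoc.prems act_closed[OF c(1)] by auto
    then show ?case
      using c snoc.prems by (simp add: act_swap[OF c(1,2)] foldr_act_linear(1,2)[OF c(3)] l_add act_closed loop_br_closed)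
  qed
  then show ?thesis using x v K by (intro eq_zeroI act_closed) auto
qed

section \<open>Finite-dimensionality of the weight spaces\<close>

text \<open>A vector of depth \<open>n > 0\<close> is a combination of vectors obtained by one
  lowering step of some degree \<open>-k\<close>. Modulo the annihilator only the coefficients
  \<open>t^j\<close> with \<open>j < degree P\<close> matter, and depth \<open>n - k\<close> is
  finitely spanned by induction.\<close>

lemma wt_finite_span:
  assumes P: "annihilating_poly \<phi> P"
  shows "\<exists>B. finite B \<and> (\<forall>b\<in>B. wt n b) \<and> (\<forall>v. wt n v \<longrightarrow> v \<in> cspan V B)"
proof (induction n rule: less_induct)
  case (less n)
  show ?case
  proof (cases "n = 0")
    case True
    have "v \<in> cspan V {v0}" if "wt 0 v" for v
      using wt_l[OF that] v0
      by (metis V.cspan_mem V.cspan_subspace V.subspace_smult empty_subsetI insert_subset singletonI)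
    then show ?thesis using True wt.top by (intro exI[of _ "{v0}"]) auto
  next
    case False
    obtain Bf where Bf: "\<And>m. m < n \<Longrightarrow> finite (Bf m)" "\<And>m b. \<lbrakk>m < n; b \<in> Bf m\<rbrakk> \<Longrightarrow> wt m b"
      "\<And>m v. \<lbrakk>m < n; wt m v\<rbrakk> \<Longrightarrow> v \<in> cspan V (Bf m)"
      using less.IH by metis
    let ?d = "\<lambda>k f. ptensor (VD (- int k)) f"
    define B where "B = (\<Union>k\<in>{1..n}. \<Union>j<degree P. act (?d k (Poly_Mapping.single (int j) 1)) ` Bf (n - k))"
    have fin: "finite B" unfolding B_def using Bf(1) by auto
    have Bwt: "wt n b" if "b \<in> B" for b
    proof -
      obtain k j b' where *: "k \<in> {1..n}" "b' \<in> Bf (n - k)" "b = act (?d k (Poly_Mapping.single (int j) 1)) b'"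
        using \<open>b \<in> B\<close> unfolding B_def by blast
      then have "wt (n - k) b'" by (intro Bf(2)) auto
      then have "wt (n - k + k) b" unfolding *(3) using *(1) by (intro wt.lower ptensor_part) auto
      then show ?thesis using *(1) by simp
    qed
    then have BV: "B \<subseteq> carrier V" using wt_carrier by blast
    note S = V.cspan_subspace[OF BV]
    \<comment> \<open>The depth is made a variable tied to \<open>n\<close> by an equation, as rule
      induction on \<open>wt\<close> changes it.\<close>
    have "wt m v \<Longrightarrow> m = n \<Longrightarrow> v \<in> cspan V B" for m v
    proof (induction rule: wt.induct)
      case (lower m v k x)
      then have k: "k \<in> {1..n}" "m = n - k" "m < n" by auto
      have vV: "v \<in> carrier V" using wt_carrier[OF lower.hyps(1)] .
      \<comment> \<open>Since \<open>k > 0\<close>, the component of degree \<open>-k\<close>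
        involves only \<open>VD (- int k)\<close>; the central generator has degree 0.\<close>
      have x: "x = ?d k (x (VD (- int k)))"
      proof
        fix p
        show "x p = ?d k (x (VD (- int k))) p"
          using lower.hyps(2,3) by (cases p) (auto simp: ptensor_def loop_part_def)
      qed
      let ?M = "{f. act (?d k f) v \<in> cspan V B}"
      have "f \<in> ?M" for f
      proof (rule laurent_division[of P])
        show "coeff P 0 \<noteq> 0" using P by (simp add: annihilating_poly_def)
        show "\<And>f g. \<lbrakk>f \<in> ?M; g \<in> ?M\<rbrakk> \<Longrightarrow> f + g \<in> ?M"
          using V.subspace_add[OF S] vV by (simp add: ptensor_add act_add_left)
        show "\<And>a f. f \<in> ?M \<Longrightarrow> cst a * f \<in> ?M"
          using V.subspace_smult[OF S] vV by (simp add: ptensor_smult act_smult_left)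
        show "f \<in> ?M" if "laurent_of_poly P dvd f" for f
        proof -
          have "act (?d k f) v = \<zero>"
            using that ptensor_carrier by (intro annihilating_act[OF P _ vV]) (simp add: coeffs_in_def ptensor_def)
          then show ?thesis using V.subspace_0[OF S] by simp
        qed
        fix j assume j: "j < degree P"
        let ?y = "?d k (Poly_Mapping.single (int j) 1)"
        have sub: "subspace class_ring {w \<in> carrier V. act ?y w \<in> cspan V B} V"
          by (rule V.subspaceI) (auto simp: act_add_right act_smult_right V.subspace_0[OF S] V.subspace_add[OF S] V.subspace_smult[OF S])
        have "act ?y b \<in> B" if "b \<in> Bf m" for b using that j k unfolding B_def by blast
        then have "Bf m \<subseteq> {w \<in> carrier V. act ?y w \<in> cspan V B}"
          using Bf(2)[OF k(3)] wt_carrier V.cspan_mem[OF BV] by blast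
        then have "cspan V (Bf m) \<subseteq> {w \<in> carrier V. act ?y w \<in> cspan V B}" by (rule V.cspan_least[OF sub])
        then show "Poly_Mapping.single (int j) 1 \<in> ?M" using Bf(3)[OF k(3) lower.hyps(1)] by blast
      qed
      then show ?case using x by (metis mem_Collect_eq)
    qed (use False in \<open>auto intro: V.subspace_0[OF S] V.subspace_add[OF S] V.subspace_smult[OF S]\<close>)
    then show ?thesis using fin Bwt by blast
  qed
qed

lemma subspace_weight_space: "subspace class_ring (weight_space V act \<mu>) V"
  by (rule V.subspaceI) (auto simp: weight_space_def act_add_right act_smult_right V.smult_add_right mult.commute)

text \<open>Finite dimension is stated for the restricted record, while the spanning sets are found
  in the ambient module.\<close>

lemma cspan_weight_space:
  assumes "B \<subseteq> weight_space V act \<mu>"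
  shows "cspan (V\<lparr>carrier := weight_space V act \<mu>\<rparr>) B = cspan V B"
  using V.span_li_not_depend(1)[OF assms] subspace_weight_space unfolding VectorSpace.subspace_def by blast

lemma vectorspace_weight_space: "vectorspace class_ring (V\<lparr>carrier := weight_space V act \<mu>\<rparr>)"
  by (rule V.subspace_is_vs[OF subspace_weight_space])

lemma annihilating_harish_chandra:
  assumes P: "annihilating_poly \<phi> P"
  shows "harish_chandra V act"
  unfolding harish_chandra_def
proof (intro conjI allI)
  show "lie_module loop_vir V act" by (rule lie_module_axioms)
  let ?W = "\<Union>\<mu>. weight_space V act \<mu>"
  have W: "?W \<subseteq> carrier V" by (auto simp: weight_space_def)
  note S = V.cspan_subspace[OF W]
  show "cspan V ?W = carrier V"
  proof
    show "cspan V ?W \<subseteq> carrier V" by (rule V.subspace_sub[OF S])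
    show "carrier V \<subseteq> cspan V ?W"
    proof
      fix v assume "v \<in> carrier V"
      then show "v \<in> cspan V ?W"
      proof (induction v rule: wt_sum_induct)
        case (wt n v)
        then have "v \<in> ?W" using wt_weight_space by blast
        then show ?case by (rule V.cspan_mem[OF W])
      qed (rule V.subspace_add[OF S])
    qed
  qed
  fix \<mu>
  interpret W: vectorspace class_ring "V\<lparr>carrier := weight_space V act \<mu>\<rparr>" by (rule vectorspace_weight_space)
  have "\<exists>B. finite B \<and> B \<subseteq> weight_space V act \<mu> \<and> weight_space V act \<mu> \<subseteq> cspan V B"
  proof (cases "\<exists>n. \<mu> = hw - of_nat n")
    case True
    then obtain n where n: "\<mu> = hw - of_nat n" by blast
    obtain B where B: "finite B" "\<forall>b\<in>B. wt n b" "\<forall>v. wt n v \<longrightarrow> v \<in> cspan V B"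
      using wt_finite_span[OF P] by blast
    have "B \<subseteq> weight_space V act \<mu>" using B(2) wt_weight_space n by blast
    moreover have "v \<in> cspan V B" if "v \<in> weight_space V act \<mu>" for v
      using weight_space_cases[OF that] n B(3) wt.zero by auto
    ultimately show ?thesis using B(1) by blast
  next
    case False
    have "v \<in> cspan V {}" if "v \<in> weight_space V act \<mu>" for v
      using weight_space_cases[OF that] False V.subspace_0[OF V.cspan_subspace, of "{}"] by auto
    then show ?thesis by (intro exI[of _ "{}"]) auto
  qed
  then obtain B where B: "finite B" "B \<subseteq> weight_space V act \<mu>" "weight_space V act \<mu> \<subseteq> cspan V B" by blast
  have "cspan V B \<subseteq> weight_space V act \<mu>" by (rule V.cspan_least[OF subspace_weight_space B(2)])
  then have "cspan (V\<lparr>carrier := weight_space V act \<mu>\<rparr>) B = weight_space V act \<mu>"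
    using B by (simp add: cspan_weight_space)
  then show "W.fin_dim" unfolding W.fin_dim_def using B by auto
qed

section \<open>An annihilating polynomial from a finite-dimensional weight space\<close>

lemma act_VD_pos_v0: "m > 0 \<Longrightarrow> act (ptensor (VD m) f) v0 = \<zero>"
proof -
  assume "m > 0"
  then have p: "ptensor (VD m) f \<in> loop_plus" by (intro ptensor_part) simp
  then have "act (ptensor (VD m) f) v0 = \<psi> (ptensor (VD m) f) \<odot> v0" by (intro act_v0) (auto elim: loop_part_mono)
  then show ?thesis using \<psi>_plus[OF p] by simp
qed

text \<open>One half of the commutator vanishes because \<open>VD m\<close> with
  \<open>m > 0\<close> kills \<open>v0\<close>, the other by hypothesis.\<close>

lemma act_raise:
  assumes "m > 0" "act (ptensor (VD n) f) v0 = \<zero>"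
  shows "act (lie_br loop_vir (ptensor (VD m) g) (ptensor (VD n) f)) v0 = \<zero>"
  using act_swap[of "ptensor (VD m) g" "ptensor (VD n) f" v0] assms act_VD_pos_v0[of m g]
  by (simp add: act_closed loop_br_closed)

lemma singular_\<phi>:
  assumes R: "act (ptensor (VD (-2)) R) v0 = \<zero>"
  shows "\<phi> (ptensor (VD 0) (f * R)) = 0" "\<phi> (ptensor VC (f * R)) = 0"
proof -
  \<comment> \<open>A degree zero element acts on \<open>v0\<close> by its value under
    \<open>\<phi>\<close>, and \<open>l v0 = 1\<close> shows that \<open>v0\<close> is not
    zero.\<close>
  have zero: "\<phi> (ptensor (VD 0) (cst a * f) \<oplus>\<^bsub>loop_vir\<^esub> ptensor VC (cst b * f)) = 0"
    if "act (ptensor (VD 0) (cst a * f) \<oplus>\<^bsub>loop_vir\<^esub> ptensor VC (cst b * f)) v0 = \<zero>" for a b f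
  proof -
    let ?x = "ptensor (VD 0) (cst a * f) \<oplus>\<^bsub>loop_vir\<^esub> ptensor VC (cst b * f)"
    have x: "?x \<in> loop_zero" by (intro loop_part_add ptensor_part) auto
    then have "?x \<in> loop_part {0..}" by (rule loop_part_single) simp
    then have "\<phi> ?x \<odot> v0 = \<zero>" using that act_v0 \<psi>_zero[OF x] by simp
    then have "l (\<phi> ?x \<odot> v0) = 0" by simp
    then show ?thesis by (simp add: l_smult l_v0)
  qed
  have 1: "act (ptensor (VD (-1)) (g * R)) v0 = \<zero>" for g
  proof -
    \<comment> \<open>The factor \<open>-3\<close> is \<open>-2 - 1\<close>; the free coefficient
      \<open>g\<close> brings in all multiples of \<open>R\<close> at once.\<close>
    have "lie_br loop_vir (ptensor (VD 1) g) (ptensor (VD (-2)) R) = (-3) \<odot>\<^bsub>loop_vir\<^esub> ptensor (VD (-1)) (g * R)"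
      by (simp add: loop_br_ptensor ptensor_0 flip: ptensor_smult single_numeral single_uminus)
    then have "(-3) \<odot> act (ptensor (VD (-1)) (g * R)) v0 = \<zero>"
      using act_raise[OF _ R, of 1 g] by (simp add: act_smult_left)
    then show ?thesis by (rule V.smult_eq_0[rotated]) (simp_all add: act_closed)
  qed
  have 2: "\<phi> (ptensor (VD 0) (g * R)) = 0" for g
  proof -
    \<comment> \<open>The cocycle vanishes at 1, so this bracket isolates the multiple of
      \<open>VD 0\<close>.\<close>
    have "lie_br loop_vir (ptensor (VD 1) 1) (ptensor (VD (-1)) (g * R))
       = ptensor (VD 0) (cst (-2) * (g * R)) \<oplus>\<^bsub>loop_vir\<^esub> ptensor VC (cst 0 * (g * R))"
      unfolding loop_br_ptensor by simp
    then have "\<phi> (ptensor (VD 0) (cst (-2) * (g * R)) \<oplus>\<^bsub>loop_vir\<^esub> ptensor VC (cst 0 * (g * R))) = 0"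
      using act_raise[OF _ 1, of 1 1 g] by (intro zero) simp
    then have "\<phi> ((-2) \<odot>\<^bsub>loop_vir\<^esub> ptensor (VD 0) (g * R)) = 0"
      by (simp only: ptensor_smult) (simp add: ptensor_0)
    then show ?thesis by (simp add: \<phi>_smult ptensor_part)
  qed
  show "\<phi> (ptensor (VD 0) (f * R)) = 0" by (rule 2)
  \<comment> \<open>Here the central coefficient is \<open>(2^3 - 2) / 12 = 1/2\<close>; with the
    \<open>VD 0\<close> part already known to vanish, the value on \<open>VC\<close>
    follows.\<close>
  have "lie_br loop_vir (ptensor (VD 2) f) (ptensor (VD (-2)) R)
     = ptensor (VD 0) (cst (-4) * (f * R)) \<oplus>\<^bsub>loop_vir\<^esub> ptensor VC (cst (1/2) * (f * R))"
    unfolding loop_br_ptensor by simp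
  then have "\<phi> (ptensor (VD 0) (cst (-4) * (f * R)) \<oplus>\<^bsub>loop_vir\<^esub> ptensor VC (cst (1/2) * (f * R))) = 0"
    using act_raise[OF _ R, of 2 f] by (intro zero) simp
  then show "\<phi> (ptensor VC (f * R)) = 0"
    using 2[of f] by (simp only: ptensor_smult) (simp add: \<phi>_add \<phi>_smult ptensor_part loop_part_smult)
qed

lemma harish_chandra_annihilating:
  assumes HC: "harish_chandra V act"
  shows "\<exists>P. annihilating_poly \<phi> P"
proof -
  let ?\<mu> = "hw - of_nat 2"
  let ?W = "V\<lparr>carrier := weight_space V act ?\<mu>\<rparr>"
  interpret W: vectorspace class_ring ?W by (rule vectorspace_weight_space)
  have fd: "W.fin_dim" using HC by (simp add: harish_chandra_def)
  define x where "x k = act (ptensor (VD (-2)) (Poly_Mapping.single (int k) 1)) v0" for k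
  have xW: "x k \<in> carrier ?W" for k
  proof -
    have "wt (0 + 2) (x k)" unfolding x_def by (rule wt.lower[OF wt.top]) (auto intro: ptensor_part)
    then show ?thesis using wt_weight_space[of 2 "x k"] by (simp add: numeral_2_eq_2)
  qed
  \<comment> \<open>Otherwise the vectors would form independent sets of every size, against the
    finite dimension of the weight space.\<close>
  have "\<exists>k. x k \<in> W.span (x ` {..<k})"
  proof (rule ccontr)
    assume *: "\<nexists>k. x k \<in> W.span (x ` {..<k})"
    have "\<not> W.lin_dep (x ` {..<k}) \<and> card (x ` {..<k}) = k" for k
    proof (induction k)
      case 0
      show ?case unfolding W.lin_dep_def by simp
    next
      case (Suc k)
      have sub: "x ` {..<k} \<subseteq> carrier ?W" using xW by blast
      have nin: "x k \<notin> x ` {..<k}" using W.in_own_span[OF sub] * by blast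
      have eq: "x ` {..<Suc k} = x ` {..<k} \<union> {x k}" by (auto simp: lessThan_Suc)
      have "\<not> W.lin_dep (x ` {..<k} \<union> {x k})"
        using W.lin_dep_iff_in_span[OF sub _ xW nin] Suc * by blast
      then show ?case using Suc nin unfolding eq by simp
    qed
    then have "Suc W.dim \<le> W.dim"
      using W.li_le_dim(2)[OF fd, of "x ` {..<Suc W.dim}"] xW by (metis image_subsetI)
    then show False by simp
  qed
  then obtain k where k: "x k \<in> W.span (x ` {..<k})" by blast
  have "W.span (x ` {..<k}) = cspan V (x ` {..<k})"
    by (rule cspan_weight_space) (use xW in auto)
  \<comment> \<open>The bound on the support of \<open>f\<close> is recorded so that subtracting
    \<open>f\<close> from \<open>t^k\<close> cannot give zero.\<close>
  also have "\<dots> \<subseteq> {act (ptensor (VD (-2)) f) v0 | f. Poly_Mapping.keys f \<subseteq> int ` {..<k}}" (is "_ \<subseteq> ?N")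
  proof (rule V.cspan_least)
    show "x ` {..<k} \<subseteq> ?N"
    proof (intro image_subsetI)
      fix j assume "j \<in> {..<k}"
      then have "Poly_Mapping.keys (Poly_Mapping.single (int j) (1::complex)) \<subseteq> int ` {..<k}" by auto
      then show "x j \<in> ?N" unfolding x_def by blast
    qed
    show "subspace class_ring ?N V"
    proof (rule V.subspaceI)
      show "?N \<subseteq> carrier V" by (auto intro: act_closed)
      have "\<zero> = act (ptensor (VD (-2)) 0) v0" by (simp add: ptensor_0)
      then show "\<zero> \<in> ?N" by (intro CollectI exI[of _ 0]) simp
      fix v w assume "v \<in> ?N" "w \<in> ?N"
      then obtain f g where fg: "v = act (ptensor (VD (-2)) f) v0" "w = act (ptensor (VD (-2)) g) v0"
        "Poly_Mapping.keys f \<subseteq> int ` {..<k}" "Poly_Mapping.keys g \<subseteq> int ` {..<k}" by blast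
      then have "v \<oplus> w = act (ptensor (VD (-2)) (f + g)) v0" by (simp add: ptensor_add act_add_left)
      moreover have "Poly_Mapping.keys (f + g) \<subseteq> int ` {..<k}" using Poly_Mapping.keys_add[of f g] fg by blast
      ultimately show "v \<oplus> w \<in> ?N" by blast
    next
      fix a v assume "v \<in> ?N"
      then obtain f where f: "v = act (ptensor (VD (-2)) f) v0" "Poly_Mapping.keys f \<subseteq> int ` {..<k}" by blast
      then have "a \<odot> v = act (ptensor (VD (-2)) (cst a * f)) v0" by (simp add: ptensor_smult act_smult_left)
      moreover have "Poly_Mapping.keys (cst a * f) \<subseteq> int ` {..<k}"
        using order_trans[OF keys_scale[of a f] f(2)] by (simp add: scale_eq)
      ultimately show "a \<odot> v \<in> ?N" by blast
    qed
  qed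
  finally obtain f where f: "x k = act (ptensor (VD (-2)) f) v0" "Poly_Mapping.keys f \<subseteq> int ` {..<k}"
    using k by blast
  define R where "R = Poly_Mapping.single (int k) 1 + cst (-1) * f"
  have "Poly_Mapping.lookup R (int k) = 1"
  proof -
    have "int k \<notin> Poly_Mapping.keys f" using f(2) by auto
    then show ?thesis by (simp add: R_def lookup_add in_keys_iff flip: scale_eq)
  qed
  then have "R \<noteq> 0" by auto
  have "act (ptensor (VD (-2)) R) v0 = x k \<oplus> (-1) \<odot> x k"
    unfolding R_def ptensor_add ptensor_smult by (simp add: act_add_left act_smult_left x_def[symmetric] f(1)[symmetric])
  also have "\<dots> = \<zero>" using act_closed by (simp add: x_def)
  finally have R0: "act (ptensor (VD (-2)) R) v0 = \<zero>" .
  obtain m P where P: "R = Poly_Mapping.single m 1 * laurent_of_poly P" "coeff P 0 \<noteq> 0"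
    using laurent_eq_monom_poly[OF \<open>R \<noteq> 0\<close>] .
  \<comment> \<open>\<open>P\<close> and \<open>R\<close> differ by the unit \<open>t^m\<close>, so
    their multiples are the same.\<close>
  have "Poly_Mapping.single j 1 * laurent_of_poly P = Poly_Mapping.single (j - m) 1 * R" for j
    unfolding P(1) by (simp add: mult_single flip: mult.assoc)
  then have "annihilating_poly \<phi> P"
    unfolding annihilating_poly_def using singular_\<phi>[OF R0] P(2) by simp
  then show ?thesis ..
qed

end

section \<open>Passage to the quotient algebra\<close>

text \<open>The target is not assumed to be a Lie algebra: its laws are images of those of
  \<open>L\<close>. This spares a second verification of the Jacobi identity for coefficients in the
  quotient ring.\<close>

locale lie_surjection = L: lie_algebra L
  for L :: "('a, 'm) lie_alg_scheme" and L' :: "('b, 'k) lie_alg_scheme" and \<pi> :: "'a \<Rightarrow> 'b" +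
  assumes surj: "carrier L' = \<pi> ` carrier L"
    and \<pi>_zero: "\<pi> \<zero>\<^bsub>L\<^esub> = \<zero>\<^bsub>L'\<^esub>"
    and \<pi>_add: "\<lbrakk>x \<in> carrier L; y \<in> carrier L\<rbrakk> \<Longrightarrow> \<pi> (x \<oplus>\<^bsub>L\<^esub> y) = \<pi> x \<oplus>\<^bsub>L'\<^esub> \<pi> y"
    and \<pi>_smult: "x \<in> carrier L \<Longrightarrow> \<pi> (a \<odot>\<^bsub>L\<^esub> x) = a \<odot>\<^bsub>L'\<^esub> \<pi> x"
    and \<pi>_br: "\<lbrakk>x \<in> carrier L; y \<in> carrier L\<rbrakk> \<Longrightarrow> \<pi> (lie_br L x y) = lie_br L' (\<pi> x) (\<pi> y)"
begin

lemma lie_algebra_image: "lie_algebra L'"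
proof -
  have "vectorspace class_ring L'"
    by (rule cvectorspaceI)
       (auto simp: surj L.L.smult_add_left L.L.smult_add_right L.a_ac
         simp flip: \<pi>_zero \<pi>_add \<pi>_smult)
  then interpret L': vectorspace class_ring L' .
  show ?thesis
    by unfold_locales
       (auto simp: surj L.br_closed L.br_add_left L.br_add_right L.br_smult_left L.br_smult_right
         L.br_alternating L.br_jacobi simp flip: \<pi>_zero \<pi>_add \<pi>_smult \<pi>_br)
qed

lemma lie_module_image:
  fixes V :: "(complex, 'v, 'n) module_scheme"
  assumes "lie_module L V act" and act': "\<And>x v. \<lbrakk>x \<in> carrier L; v \<in> carrier V\<rbrakk> \<Longrightarrow> act' (\<pi> x) v = act x v"
  shows "lie_module L' V act'"
proof -
  interpret M: lie_module L V act by fact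
  interpret L': lie_algebra L' by (rule lie_algebra_image)
  show ?thesis
    by unfold_locales
       (auto simp: surj L.br_closed act' M.act_closed M.act_add_left M.act_add_right M.act_smult_left M.act_smult_right M.act_br
         simp flip: \<pi>_zero \<pi>_add \<pi>_smult \<pi>_br)
qed

end

section \<open>The Virasoro algebra over the quotient of the Laurent polynomials\<close>

context
  fixes P :: "complex poly"
begin

abbreviation (input) "QA \<equiv> quot_module laurent_algebra (laurent_ideal P)"
abbreviation (input) "cls f \<equiv> laurent_ideal P +>\<^bsub>laurent_algebra\<^esub> f"

lemma cls_eq_iff: "cls f = cls g \<longleftrightarrow> laurent_of_poly P dvd f - g"
  using LA.coset_eq_iff[OF subspace_laurent_ideal, of f g P]
  by (simp add: laurent_simps laurent_ideal_eq single_uminus)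

lemma cls_simps:
  shows "cls f \<oplus>\<^bsub>QA\<^esub> cls g = cls (f + g)" "a \<odot>\<^bsub>QA\<^esub> cls f = cls (cst a * f)" "\<zero>\<^bsub>QA\<^esub> = cls 0"
    "cls f \<otimes>\<^bsub>QA\<^esub> cls g = cls (f * g)" "cls f \<in> carrier QA"
  using LA.quot_add[OF subspace_laurent_ideal, of f g P] LA.quot_smult[OF subspace_laurent_ideal, where v = f and a = a]
    LA.quot_zero[OF subspace_laurent_ideal, of P] LA.coset_eq_self_iff[OF subspace_laurent_ideal, of 0 P]
    LA.quot_carrierI[OF subspace_laurent_ideal, of f P]
    ideal.rcoset_mult_add[OF ideal_laurent_ideal, of f g P]
  by (simp_all add: laurent_simps laurent_ideal_eq) (simp add: quot_module_def ring.defs module.defs FactRing_def)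

lemma finsum_cls: "finsum QA (\<lambda>p. cls (h p)) S = cls (sum h S)" if "finite S"
proof -
  interpret Q: cvectorspace QA by (rule LA.quot_cvectorspace[OF subspace_laurent_ideal])
  show ?thesis using that by (induction S) (simp_all add: cls_simps)
qed

text \<open>The bracket over the quotient sums over the support of the classes, which may be smaller
  than the support of the representatives.\<close>

lemma finsum_cls_superset:
  assumes "finite S" "T \<subseteq> S" "\<And>p. p \<in> S - T \<Longrightarrow> cls (h p) = \<zero>\<^bsub>QA\<^esub>"
  shows "finsum QA (\<lambda>p. cls (h p)) T = cls (sum h S)"
proof -
  interpret Q: cvectorspace QA by (rule LA.quot_cvectorspace[OF subspace_laurent_ideal])
  have "finsum QA (\<lambda>p. cls (h p)) T = finsum QA (\<lambda>p. cls (h p)) S"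
    using assms by (intro Q.add.finprod_mono_neutral_cong_left) (auto simp: cls_simps)
  then show ?thesis using finsum_cls[OF assms(1)] by simp
qed

lemma lie_surjection_quot: "lie_surjection loop_vir (vir_tensor QA) (\<lambda>x p. cls (x p))"
proof unfold_locales
  show "carrier (vir_tensor QA) = (\<lambda>x p. cls (x p)) ` carrier loop_vir"
  proof (intro equalityI subsetI)
    fix y assume y: "y \<in> carrier (vir_tensor QA)"
    then have yc: "y p \<in> carrier QA" and fin: "finite {p. y p \<noteq> cls 0}" for p
      by (auto simp: vir_tensor_def cls_simps(3))
    have "\<exists>f. y p = cls f" for p
      using LA.quot_carrierE[OF subspace_laurent_ideal yc[of p]] by metis
    then obtain f where f: "\<And>p. y p = cls (f p)" by metis
    \<comment> \<open>Zero is chosen as representative wherever the class is zero, so that the lift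
      has finite support.\<close>
    define x where "x p = (if y p = cls 0 then 0 else f p)" for p
    have "finite {p. x p \<noteq> 0}" by (rule finite_subset[OF _ fin]) (auto simp: x_def)
    moreover have "y = (\<lambda>p. cls (x p))" by (rule ext) (simp add: x_def f)
    ultimately show "y \<in> (\<lambda>x p. cls (x p)) ` carrier loop_vir" by (auto simp: loop_simps)
  next
    fix y assume "y \<in> (\<lambda>x p. cls (x p)) ` carrier loop_vir"
    then obtain x where x: "y = (\<lambda>p. cls (x p))" "finite {p. x p \<noteq> 0}" by (auto simp: loop_simps)
    have "finite {p. cls (x p) \<noteq> cls 0}" by (rule finite_subset[OF _ x(2)]) auto
    then show "y \<in> carrier (vir_tensor QA)" unfolding x(1) vir_tensor_def by (simp add: cls_simps)
  qed
  fix x y assume x: "x \<in> carrier loop_vir" and y: "y \<in> carrier loop_vir"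
  show "(\<lambda>p. cls (lie_br loop_vir x y p)) = lie_br (vir_tensor QA) (\<lambda>p. cls (x p)) (\<lambda>p. cls (y p))"
  proof
    fix r
    let ?h = "\<lambda>p q. cst (Poly_Mapping.lookup (vir_br p q) r) * (x p * y q)"
    let ?X = "{p. x p \<noteq> 0}" and ?Y = "{p. y p \<noteq> 0}"
    have fin: "finite ?X" "finite ?Y" using x y by (auto simp: loop_simps)
    have z: "laurent_of_poly P dvd x p \<Longrightarrow> laurent_of_poly P dvd ?h p q" "laurent_of_poly P dvd y q \<Longrightarrow> laurent_of_poly P dvd ?h p q" for p q
      by simp_all
    have inner: "finsum QA (\<lambda>q. cls (?h p q)) {q. cls (y q) \<noteq> cls 0} = cls (\<Sum>q\<in>?Y. ?h p q)" for p
      by (rule finsum_cls_superset) (use fin z in \<open>auto simp: cls_simps(3) cls_eq_iff\<close>)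
    have "lie_br (vir_tensor QA) (\<lambda>p. cls (x p)) (\<lambda>p. cls (y p)) r
       = finsum QA (\<lambda>p. finsum QA (\<lambda>q. cls (?h p q)) {q. cls (y q) \<noteq> cls 0}) {p. cls (x p) \<noteq> cls 0}"
      by (simp add: vir_tensor_def cls_simps)
    also have "\<dots> = finsum QA (\<lambda>p. cls (\<Sum>q\<in>?Y. ?h p q)) {p. cls (x p) \<noteq> cls 0}"
      unfolding inner ..
    also have "\<dots> = cls (\<Sum>p\<in>?X. \<Sum>q\<in>?Y. ?h p q)"
    proof (rule finsum_cls_superset)
      show "cls (\<Sum>q\<in>?Y. ?h p q) = \<zero>\<^bsub>QA\<^esub>" if "p \<in> ?X - {p. cls (x p) \<noteq> cls 0}" for p
        using that z by (auto simp: cls_simps(3) cls_eq_iff intro!: dvd_sum)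
    qed (use fin in auto)
    also have "(\<Sum>p\<in>?X. \<Sum>q\<in>?Y. ?h p q) = lie_br loop_vir x y r"
      by (rule loop_br[symmetric]) (use fin in auto)
    finally show "cls (lie_br loop_vir x y r) = lie_br (vir_tensor QA) (\<lambda>p. cls (x p)) (\<lambda>p. cls (y p)) r" ..
  qed
next
  fix x y :: loop_elt and a
  show "(\<lambda>p. cls (\<zero>\<^bsub>loop_vir\<^esub> p)) = \<zero>\<^bsub>vir_tensor QA\<^esub>"
    "(\<lambda>p. cls ((x \<oplus>\<^bsub>loop_vir\<^esub> y) p)) = (\<lambda>p. cls (x p)) \<oplus>\<^bsub>vir_tensor QA\<^esub> (\<lambda>p. cls (y p))"
    "(\<lambda>p. cls ((a \<odot>\<^bsub>loop_vir\<^esub> x) p)) = a \<odot>\<^bsub>vir_tensor QA\<^esub> (\<lambda>p. cls (x p))"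
    by (simp_all only: vir_tensor_def cls_simps loop_simps ring.simps module.simps partial_object.simps monoid.simps)
qed

end

section \<open>Factorization of the action\<close>

context irreducible_hw_module
begin

text \<open>Two lifts of the same element differ by an element of
  \<open>coeffs_in (laurent_of_poly P)\<close>, which acts by zero, so acting through a chosen lift
  is well defined.\<close>

lemma annihilating_factors:
  assumes P: "annihilating_poly \<phi> P"
  shows "factors_through_quotient V act P"
proof -
  let ?\<pi> = "\<lambda>x p. laurent_ideal P +>\<^bsub>laurent_algebra\<^esub> x p"
  interpret Q: lie_surjection loop_vir "vir_tensor (quot_module laurent_algebra (laurent_ideal P))" ?\<pi>
    by (rule lie_surjection_quot)
  define act' where "act' y v = act (SOME x. x \<in> carrier loop_vir \<and> y = ?\<pi> x) v" for y v
  have eq: "act x v = act x' v" if x: "x \<in> carrier loop_vir" and x': "x' \<in> carrier loop_vir"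
    and v: "v \<in> carrier V" and e: "?\<pi> x = ?\<pi> x'" for x x' v
  proof -
    let ?d = "x \<oplus>\<^bsub>loop_vir\<^esub> (-1) \<odot>\<^bsub>loop_vir\<^esub> x'"
    have "laurent_of_poly P dvd x p - x' p" for p using fun_cong[OF e, of p] by (simp add: cls_eq_iff)
    then have "?d \<in> coeffs_in (laurent_of_poly P)"
      using x x' LV.a_closed[OF x LV.smult_cl[OF x']] by (simp add: coeffs_in_def) (simp add: loop_simps single_uminus)
    then have "act ?d v = \<zero>" using v by (rule annihilating_act[OF P])
    then have "act x v \<oplus> (-1) \<odot> act x' v = \<zero>" using x x' v by (simp add: act_add_left act_smult_left)
    then show ?thesis using x x' v by (subst V.eq_iff_diff) (simp_all add: act_closed)
  qed
  have act': "act' (?\<pi> x) v = act x v" if x: "x \<in> carrier loop_vir" and v: "v \<in> carrier V" for x v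
  proof -
    let ?s = "SOME x'. x' \<in> carrier loop_vir \<and> ?\<pi> x = ?\<pi> x'"
    have "?s \<in> carrier loop_vir \<and> ?\<pi> x = ?\<pi> ?s" by (rule someI[of _ x]) (use x in simp)
    then show ?thesis unfolding act'_def using eq[OF x _ v, of ?s] by simp
  qed
  show ?thesis
    unfolding factors_through_quotient_def
    by (intro exI[of _ act'] conjI ballI Q.lie_module_image[OF lie_module_axioms] act')
qed

end

theorem theorem6p1:
  fixes \<phi> :: "loop_elt \<Rightarrow> complex"
  assumes "\<phi> \<in> LinearCombinations.module_hom class_ring (loop_vir\<lparr>carrier := loop_zero\<rparr>) complex_space"
  shows "(harish_chandra (hw_space \<phi>) (hw_act \<phi>) \<longleftrightarrow> (\<exists>P. annihilating_poly \<phi> P)) \<and>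
    (\<forall>P. annihilating_poly \<phi> P \<longrightarrow>
      (\<forall>i. \<forall>f\<in>laurent_ideal P. \<forall>v\<in>carrier (hw_space \<phi>).
         hw_act \<phi> (ptensor (VD i) f) v = \<zero>\<^bsub>hw_space \<phi>\<^esub>)) \<and>
    (harish_chandra (hw_space \<phi>) (hw_act \<phi>) \<longrightarrow>
      (\<forall>P. annihilating_poly \<phi> P \<longrightarrow> factors_through_quotient (hw_space \<phi>) (hw_act \<phi>) P))"
proof -
  interpret loop_character \<phi> by (rule loop_character.intro[OF assms])
  obtain v0 l where "irreducible_hw_module \<phi> (hw_space \<phi>) (hw_act \<phi>) v0 l"
    using hw_irreducible by blast
  then interpret M: irreducible_hw_module \<phi> "hw_space \<phi>" "hw_act \<phi>" v0 l .
  have "ptensor (VD i) f \<in> coeffs_in (laurent_of_poly P)" if "f \<in> laurent_ideal P" for i f P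
    using that by (simp add: coeffs_in_def laurent_ideal_eq) (simp add: ptensor_def)
  then show ?thesis
    using M.annihilating_harish_chandra M.harish_chandra_annihilating M.annihilating_act M.annihilating_factors
    by blast
qed

end
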